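(* Let $m\ge1$ and $1\le k\le m$. The Kovalevskaya exponents of the $2m$-dimensional first Painlevé system $$x_1'=x_2,\ \dots,\ x_{2m-1}'=x_{2m},\qquad x_{2m}'=P_m(x_1,\dots,x_{2m-1})+z$$ associated with the Laurent series solution with leading coefficients $c_j(k)=(-1)^{j+1}j!\cdot\frac12k(k+1)$ $(j=1,\dots,2m)$ are the following $2m$ integers: $$\begin{aligned}&2,\,4,\,\dots,\,2m-2k &&(m-k\text{ of them}),\\ &2k+3,\,2k+5,\,\dots,\,2m+1 &&(m-k\text{ of them}),\\ &2m+4,\,2m+6,\,\dots,\,2m+2k+2 &&(k\text{ of them}),\\ &-1,\,-3,\,\dots,\,-(2k-1) &&(k\text{ of them}).\end{aligned}$$ Thus the Laurent series solution includes $2m-k+1$ free parameters (including $z_0$). In particular, the Laurent series for the case $k=1$ includes $2m$ free parameters and represents a general solution.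
   Context: Define differential polynomials $\mathcal{L}_n[x]$ in $x=x(z)$ by $\mathcal{L}_0[x]=1$ and $$\frac{d}{dz}\mathcal{L}_{n+1}[x]=\left(\frac{d^3}{dz^3}-8x\frac{d}{dz}-4\frac{dx}{dz}\right)\mathcal{L}_n[x],$$ where the integration is carried out in the ring of differential polynomials with zero integration constant, so $\mathcal{L}_{n+1}[x]$ has no constant term. The polynomial $P_m$ is determined by $\mathcal{L}_{m+1}[x]=-4\left(x^{(2m)}-P_m(x,x',\dots,x^{(2m-2)})\right)$. For example $P_1=6x_1^2$ and $P_2=20x_1x_3+10x_2^2-40x_1^3$. The $2m$-th order first Painlevé equation is $x^{(2m)}=P_m(x,x',\dots,x^{(2m-2)})+z$; the system above is obtained with $x_j=x^{(j-1)}$. It is quasi-homogeneous with weights $p_j=j+1$ $(j=1,\dots,2m)$ for $x_j$ and $r=2m+2$ for $z$, since $P_m(\lambda^2x_1,\dots,\lambda^{2m}x_{2m-1})=\lambda^{2m+2}P_m(x_1,\dots,x_{2m-1})$. It is known that the system has, for each $k=1,\dots,m$, Laurent series solutions $x_j(z)=c_j(k)(z-z_0)^{-p_j}+\sum_{n\ge1}a_{j,n}(k)(z-z_0)^{-p_j+n}$ with the leading coefficients given in the claim, and that the system has the Painlevé property (all solutions are meromorphic). With $f_j^A(x)=x_{j+1}$ for $j\le 2m-1$ and $f_{2m}^A(x)=P_m(x_1,\dots,x_{2m-1})$, the vector $(c_1(k),\dots,c_{2m}(k))$ satisfies $-p_jc_j=f_j^A(c_1,\dots,c_{2m})$ for all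 $j$. The Kovalevskaya exponents associated with it are the eigenvalues (with multiplicity) of the $2m\times 2m$ matrix $\left(\frac{\partial f_i^A}{\partial x_l}(c_1(k),\dots,c_{2m}(k))+p_i\delta_{il}\right)_{i,l}$. *)

theory Defs
  imports
    "HOL-Complex_Analysis.Complex_Analysis"
    "HOL-Library.Poly_Mapping"
    "Jordan_Normal_Form.Char_Poly"
begin

text \<open>
  Differential polynomials with complex coefficients in one differential indeterminate \<open>x\<close>:
  polynomials in the variables \<open>x, x', x'', \<dots>\<close>, where variable number \<open>i\<close> stands for the
  \<open>i\<close>-th derivative of \<open>x\<close>. A monomial is its finitely supported exponent function.
\<close>

type_synonym diff_poly = "(nat \<Rightarrow>\<^sub>0 nat) \<Rightarrow>\<^sub>0 complex"

definition dvar :: "nat \<Rightarrow> diff_poly" where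
  "dvar i = Poly_Mapping.single (Poly_Mapping.single i 1) 1"

definition dconst :: "complex \<Rightarrow> diff_poly" where
  "dconst c = Poly_Mapping.single 0 c"

text \<open>
  The derivation \<open>d/dz\<close>, by the Leibniz rule on monomials: for each variable \<open>i\<close> of a monomial
  \<open>\<mu>\<close>, one factor \<open>i\<close> is replaced by \<open>Suc i\<close>, and the exponent of \<open>i\<close> comes out as a coefficient.
\<close>

definition dz :: "diff_poly \<Rightarrow> diff_poly" where
  "dz p = (\<Sum>\<mu>\<in>Poly_Mapping.keys p. \<Sum>i\<in>Poly_Mapping.keys \<mu>.
     Poly_Mapping.single
       (\<mu> - Poly_Mapping.single i 1 + Poly_Mapping.single (Suc i) 1)
       (Poly_Mapping.lookup p \<mu> * of_nat (Poly_Mapping.lookup \<mu> i)))"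

definition deval :: "(nat \<Rightarrow> complex) \<Rightarrow> diff_poly \<Rightarrow> complex" where
  "deval v p = (\<Sum>\<mu>\<in>Poly_Mapping.keys p.
     Poly_Mapping.lookup p \<mu> * (\<Prod>i\<in>Poly_Mapping.keys \<mu>. v i ^ Poly_Mapping.lookup \<mu> i))"

text \<open>
  Integration in the ring of differential polynomials with zero integration constant: the
  kernel of \<open>dz\<close> consists of the constants, so the antiderivative without constant term is unique.
\<close>

primrec lenard :: "nat \<Rightarrow> diff_poly" where
  "lenard 0 = 1"
| "lenard (Suc n) = (THE q.
     dz q = dz (dz (dz (lenard n))) - 8 * dvar 0 * dz (lenard n) - 4 * dz (dvar 0) * lenard n
     \<and> Poly_Mapping.lookup q 0 = 0)"

text \<open>This is the solution of \<open>lenard (m + 1) = - 4 * (dvar (2 * m) - painleve_poly m)\<close>.\<close>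

definition painleve_poly :: "nat \<Rightarrow> diff_poly" where
  "painleve_poly m = dvar (2 * m) + dconst (1 / 4) * lenard (m + 1)"

text \<open>
  Points of \<open>\<complex>\<^sup>2\<^sup>m\<close> are functions \<open>x :: nat \<Rightarrow> complex\<close> of which only the
  components \<open>x j\<close> with \<open>j \<in> {1..2*m}\<close> matter. Since \<open>x\<^sub>j\<close> is the derivative of order \<open>j - 1\<close>,
  variable number \<open>i\<close> of a differential polynomial takes the value \<open>x (Suc i)\<close>.
\<close>

definition fA :: "nat \<Rightarrow> nat \<Rightarrow> (nat \<Rightarrow> complex) \<Rightarrow> complex" where
  "fA m j x = (if j < 2 * m then x (Suc j) else deval (\<lambda>i. x (Suc i)) (painleve_poly m))"

definition weight :: "nat \<Rightarrow> nat" where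
  "weight j = j + 1"

definition leading_coeff :: "nat \<Rightarrow> nat \<Rightarrow> complex" where
  "leading_coeff k j = (- 1) ^ (j + 1) * fact j * (1 / 2 * of_nat k * (of_nat k + 1))"

text \<open>Matrices are indexed from 0, the components \<open>x\<^sub>1, \<dots>, x\<^sub>2\<^sub>m\<close> from 1.\<close>

definition kovalevskaya_matrix :: "nat \<Rightarrow> (nat \<Rightarrow> complex) \<Rightarrow> complex mat" where
  "kovalevskaya_matrix m c = Matrix.mat (2 * m) (2 * m) (\<lambda>(i, l).
     deriv (\<lambda>t. fA m (Suc i) (c(Suc l := t))) (c (Suc l))
     + (if i = l then of_nat (weight (Suc i)) else 0))"

definition kovalevskaya_exponents :: "nat \<Rightarrow> nat \<Rightarrow> complex multiset" where
  "kovalevskaya_exponents m k = proots (char_poly (kovalevskaya_matrix m (leading_coeff k)))"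

definition painleve_solution :: "nat \<Rightarrow> complex set \<Rightarrow> (nat \<Rightarrow> complex \<Rightarrow> complex) \<Rightarrow> bool" where
  "painleve_solution m S x \<longleftrightarrow> (\<forall>j\<in>{1..2*m}. \<forall>z\<in>S.
     (x j has_field_derivative
        (fA m j (\<lambda>i. x i z) + (if j = 2 * m then z else 0))) (at z))"

definition laurent_term ::
    "(nat \<Rightarrow> nat \<Rightarrow> complex) \<Rightarrow> complex \<Rightarrow> nat \<Rightarrow> complex \<Rightarrow> nat \<Rightarrow> complex" where
  "laurent_term a z0 j z n = a j n * (z - z0) powi (int n - int (weight j))"

definition laurent_sum ::
    "(nat \<Rightarrow> nat \<Rightarrow> complex) \<Rightarrow> complex \<Rightarrow> nat \<Rightarrow> complex \<Rightarrow> complex" where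
  "laurent_sum a z0 j z = suminf (laurent_term a z0 j z)"

text \<open>
  \<open>a j n\<close> is the coefficient \<open>a\<^sub>j\<^sub>,\<^sub>n\<close> of the series of \<open>x\<^sub>j\<close>, with \<open>a j 0\<close> the
  leading coefficient. The series are required to converge, not merely to solve the system
  formally.
\<close>

definition laurent_solution ::
    "nat \<Rightarrow> nat \<Rightarrow> complex \<Rightarrow> real \<Rightarrow> (nat \<Rightarrow> nat \<Rightarrow> complex) \<Rightarrow> bool" where
  "laurent_solution m k z0 r a \<longleftrightarrow>
     r > 0
     \<and> (\<forall>j\<in>{1..2*m}. a j 0 = leading_coeff k j)
     \<and> (\<forall>j\<in>{1..2*m}. \<forall>z\<in>ball z0 r - {z0}. summable (laurent_term a z0 j z))
     \<and> painleve_solution m (ball z0 r - {z0}) (laurent_sum a z0)"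

definition positive_exponents :: "nat \<Rightarrow> nat \<Rightarrow> nat set" where
  "positive_exponents m k = {n. n > 0 \<and> of_nat n \<in># kovalevskaya_exponents m k}"

text \<open>
  The pole \<open>z\<^sub>0\<close> and the coefficients \<open>a\<^sub>1\<^sub>,\<^sub>n\<close> with \<open>n \<in> R\<close> are free parameters of the
  Laurent series solution: they can be prescribed arbitrarily and determine the whole series.
  Coefficients of \<open>x\<^sub>1\<close> are used because \<open>x\<^sub>j\<^sub>+\<^sub>1 = x\<^sub>j'\<close>, so that all other components follow
  from the first. The number of parameters, including \<open>z\<^sub>0\<close>, is \<open>card R + 1\<close>.
\<close>

definition free_parameters :: "nat \<Rightarrow> nat \<Rightarrow> nat set \<Rightarrow> bool" where
  "free_parameters m k R \<longleftrightarrow> (\<forall>z0 (\<alpha> :: nat \<Rightarrow> complex).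
     (\<exists>r a. laurent_solution m k z0 r a \<and> (\<forall>n\<in>R. a 1 n = \<alpha> n))
     \<and> (\<forall>r r' a b. laurent_solution m k z0 r a \<longrightarrow> laurent_solution m k z0 r' b \<longrightarrow>
          (\<forall>n\<in>R. a 1 n = \<alpha> n) \<longrightarrow> (\<forall>n\<in>R. b 1 n = \<alpha> n) \<longrightarrow>
          (\<forall>j\<in>{1..2*m}. \<forall>n. a j n = b j n)))"

definition includes_free_parameters :: "nat \<Rightarrow> nat \<Rightarrow> nat \<Rightarrow> bool" where
  "includes_free_parameters m k N \<longleftrightarrow>
     free_parameters m k (positive_exponents m k)
     \<and> finite (positive_exponents m k) \<and> card (positive_exponents m k) + 1 = N"

text \<open>
  A family of solutions represents a general solution if at every initial time \<open>z\<^sub>1\<close> it attains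
  all initial values in some nonempty open subset (here a polydisc) of \<open>\<complex>\<^sup>2\<^sup>m\<close>. By uniqueness
  for the initial value problem, all solutions with such initial values then belong to the family.
\<close>

definition represents_general_solution :: "nat \<Rightarrow> nat \<Rightarrow> bool" where
  "represents_general_solution m k \<longleftrightarrow> (\<forall>z1. \<exists>\<xi> :: nat \<Rightarrow> complex. \<exists>\<epsilon>>0.
     \<forall>\<eta>. (\<forall>j\<in>{1..2*m}. dist (\<eta> j) (\<xi> j) < \<epsilon>) \<longrightarrow>
       (\<exists>z0 r a. laurent_solution m k z0 r a \<and> z1 \<in> ball z0 r - {z0}
          \<and> (\<forall>j\<in>{1..2*m}. laurent_sum a z0 j z1 = \<eta> j)))"

end

theory Submission
  imports Defs "HOL-Homology.Homology"
begin

text \<open>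
  Write \<open>L\<^sub>n\<close> for the Lenard polynomials and \<open>K f = f''' - 8 x f' - 4 x' f\<close>, so that \<open>L\<^sub>n\<^sub>+\<^sub>1' = K L\<^sub>n\<close>, and
  \<open>x = \<Sum>\<^sub>n a\<^sub>n t\<^sup>n\<^sup>-\<^sup>2\<close> with \<open>a\<^sub>0 = k (k + 1) / 2\<close>. The system says \<open>L\<^sub>m\<^sub>+\<^sub>1[x] = - 4 (z\<^sub>0 + t)\<close>, and the coefficient
  of \<open>t\<^sup>n\<^sup>-\<^sup>2\<^sup>m\<^sup>-\<^sup>2\<close> of this equation is \<open>\<chi>(n) a\<^sub>n + Q(a\<^sub>1, \<dots>, a\<^sub>n\<^sub>-\<^sub>1)\<close>, where \<open>- \<chi> / 4\<close> is the characteristic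
  polynomial of the Kovalevskaya matrix. If \<open>a\<^sub>l = 0\<close> for all odd \<open>l \<le> 2 k + 1\<close>, an induction on \<open>n\<close>
  with \<open>L\<^sub>n\<^sub>+\<^sub>1' = K L\<^sub>n\<close> shows that \<open>L\<^sub>n[x]\<close> has pole order at most \<open>2 k\<close> and no odd negative powers;
  as \<open>K\<close> is skew-adjoint, \<open>L\<^sub>i' L\<^sub>j\<close> is a total derivative and has residue \<open>0\<close>. For an \<open>x\<close> that differs from
  its leading term by a single monomial, these two facts give the positive zeros of \<open>\<chi>\<close>, and the flows of
  the KdV hierarchy give the negative ones. Applied to a full series, the same two facts show that
  the equation puts no condition on \<open>a\<^sub>1, \<dots>, a\<^sub>n\<^sub>-\<^sub>1\<close> at a positive zero \<open>n\<close> of \<open>\<chi>\<close>, so that \<open>a\<^sub>n\<close> is free there.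
  The series converge since \<open>\<chi>(n)\<close> outgrows the derivatives in the nonlinear monomials of \<open>P\<^sub>m\<close>.
  For \<open>k = 1\<close>, the map from the \<open>2 m\<close> parameters to the initial values at \<open>z\<^sub>1\<close> is continuous, and
  it is injective by uniqueness for the initial value problem; hence it is open, by invariance of domain.
\<close>

text \<open>The characteristic polynomial is never factored. In the recursion \<open>lin_Suc\<close>
  for the first variation the factor \<open>\<rho> - 2 n - 2\<close> vanishes at positive even
  \<open>\<rho>\<close>, so that the recursion alone does not give the values there. Instead,
  \<open>2 m\<close> distinct zeros are exhibited and compared with the degree. The count also
  excludes further positive zeros, which makes the recursion for the coefficients solvable at all
  other orders. The vanishing of the odd coefficients is not imposed on the solution: the odd orders
  up to \<open>2 k + 1\<close> are not exponents, so the recursion forces it. Orders below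
  \<open>2 m + 2\<close> are then settled by the shape of
  \<open>L\<^sub>m\<^sub>+\<^sub>1[x]\<close>. Beyond the inhomogeneous terms the pairing with
  \<open>L\<^sub>1, ..., L\<^sub>k\<close> takes over; the leading coefficient of
  \<open>L\<^sub>i[x]\<close> is nonzero exactly for \<open>i \<le> k\<close>, hence the
  \<open>k\<close> exponents there. The radius of convergence must be uniform in the parameters, and
  it depends only on a bound for finitely many coefficients. Both the continuity of the map to the
  initial values and its injectivity, which compares two solutions on a disc containing both poles,
  rest on this.\<close>

abbreviation "single \<equiv> Poly_Mapping.single"
abbreviation "lookup \<equiv> Poly_Mapping.lookup"
abbreviation "keys \<equiv> Poly_Mapping.keys"

section \<open>Differential polynomials\<close>

definition monom_eval :: "(nat \<Rightarrow> 'a::comm_ring_1) \<Rightarrow> (nat \<Rightarrow>\<^sub>0 nat) \<Rightarrow> 'a" where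
  "monom_eval v \<mu> = (\<Prod>i\<in>keys \<mu>. v i ^ lookup \<mu> i)"

text \<open>The embedding \<open>h\<close> of the scalars allows one evaluation for numbers, formal
  power series and formal Laurent series.\<close>

definition peval :: "(complex \<Rightarrow> 'a::comm_ring_1) \<Rightarrow> (nat \<Rightarrow> 'a) \<Rightarrow> diff_poly \<Rightarrow> 'a" where
  "peval h v p = (\<Sum>\<mu>\<in>keys p. h (lookup p \<mu>) * monom_eval v \<mu>)"

lemma deval_eq_peval: "deval v p = peval id v p"
  by (simp add: deval_def peval_def monom_eval_def)

lemma poly_mapping_sum_single:
  "p = (\<Sum>\<mu>\<in>keys p. single \<mu> (lookup p \<mu>))"
  by (rule poly_mapping_eqI)
    (auto simp: lookup_sum lookup_single when_def not_in_keys_iff_lookup_eq_zero)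

lemma single_sum_eq_prod:
  assumes "finite S"
  shows "single (\<Sum>i\<in>S. f i) (1 :: 'b :: comm_semiring_1)
    = (\<Prod>i\<in>S. single (f i :: 'a :: comm_monoid_add) 1)"
  using assms
proof (induction S)
  case (insert i S)
  then show ?case
    using mult_single[of "f i" "1::'b" "\<Sum>i\<in>S. f i" 1] by simp
qed simp

lemma single_single_eq_power:
  "single (single i n) 1 = dvar i ^ n"
proof (induction n)
  case (Suc n)
  have "single i (Suc n) = single i 1 + single i n"
    by (simp flip: single_add)
  then have "single (single i (Suc n)) (1::complex)
      = dvar i * single (single i n) 1"
    by (simp add: dvar_def mult_single)
  then show ?case
    using Suc by simp
qed simp

lemma single_eq_prod_dvar:
  "single \<mu> c
    = dconst c * (\<Prod>i\<in>keys \<mu>. dvar i ^ lookup \<mu> i)"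
proof -
  have "single \<mu> c = dconst c * single \<mu> 1"
    by (simp add: dconst_def mult_single)
  also have "single \<mu> 1
      = (single (\<Sum>i\<in>keys \<mu>.
           single i (lookup \<mu> i)) 1 :: diff_poly)"
    by (subst poly_mapping_sum_single[of \<mu>]) simp
  also have "\<dots> = (\<Prod>i\<in>keys \<mu>. dvar i ^ lookup \<mu> i)"
    by (simp add: single_sum_eq_prod single_single_eq_power)
  finally show ?thesis .
qed

text \<open>Reduces evaluation, variation and expansion formulas to the generators, so that
  monomials need not be handled again.\<close>

lemma diff_poly_induct [case_names const var add mult]:
  fixes p :: diff_poly
  assumes const: "\<And>c. P (dconst c)"
    and var: "\<And>i. P (dvar i)"
    and add: "\<And>p q. P p \<Longrightarrow> P q \<Longrightarrow> P (p + q)"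
    and mult: "\<And>p q. P p \<Longrightarrow> P q \<Longrightarrow> P (p * q)"
  shows "P p"
proof -
  have P0: "P 0" and P1: "P 1"
    using const[of 0] const[of 1] by (simp_all add: dconst_def)
  have pow: "P (dvar i ^ n)" for i n
    by (induction n) (auto intro: P1 mult var)
  have "P (\<Prod>i\<in>S. dvar i ^ f i)" if "finite S" for S f
    using that by (induction S) (auto intro: P1 mult pow)
  then have single: "P (single \<mu> c)" for \<mu> c
    by (subst single_eq_prod_dvar) (auto intro: mult const)
  have "P (\<Sum>\<mu>\<in>S. single \<mu> (f \<mu>))" if "finite S" for S f
    using that by (induction S) (auto intro: P0 add single)
  then show ?thesis
    by (subst poly_mapping_sum_single) simp
qed

lemma monom_eval_0 [simp]: "monom_eval v 0 = 1"
  by (simp add: monom_eval_def)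

lemma monom_eval_superset:
  assumes "finite S" "keys \<mu> \<subseteq> S"
  shows "monom_eval v \<mu> = (\<Prod>i\<in>S. v i ^ lookup \<mu> i)"
  unfolding monom_eval_def using assms
  by (intro prod.mono_neutral_left) (auto simp: not_in_keys_iff_lookup_eq_zero)

lemma monom_eval_add: "monom_eval v (\<mu> + \<nu>) = monom_eval v \<mu> * monom_eval v \<nu>"
proof -
  let ?S = "keys \<mu> \<union> keys \<nu>"
  have "keys (\<mu> + \<nu>) \<subseteq> ?S"
    by (rule keys_add)
  then have "monom_eval v (\<mu> + \<nu>)
      = (\<Prod>i\<in>?S. v i ^ lookup \<mu> i * v i ^ lookup \<nu> i)"
    by (subst monom_eval_superset[where S = ?S]) (simp_all add: lookup_add power_add)
  also have "\<dots> = monom_eval v \<mu> * monom_eval v \<nu>"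
    unfolding prod.distrib by (subst (1 2) monom_eval_superset[where S = ?S]) auto
  finally show ?thesis .
qed

lemma peval_dconst:
  assumes "h 0 = 0"
  shows "peval h v (dconst c) = h c"
  using assms by (cases "c = 0") (simp_all add: peval_def dconst_def)

lemma peval_superset:
  assumes "h 0 = 0" "finite S" "keys p \<subseteq> S"
  shows "peval h v p = (\<Sum>\<mu>\<in>S. h (lookup p \<mu>) * monom_eval v \<mu>)"
  unfolding peval_def using assms
  by (intro sum.mono_neutral_left) (auto simp: not_in_keys_iff_lookup_eq_zero)

lemma peval_single:
  assumes "h 0 = 0"
  shows "peval h v (single \<mu> c) = h c * monom_eval v \<mu>"
  using assms by (cases "c = 0") (simp_all add: peval_def)

locale scalar_hom = comm_ring_hom h for h :: "complex \<Rightarrow> 'a :: comm_ring_1"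
begin

lemma peval_add: "peval h v (p + q) = peval h v p + peval h v q"
proof -
  let ?S = "keys p \<union> keys q"
  have "keys (p + q) \<subseteq> ?S"
    by (rule keys_add)
  then have "peval h v (p + q) = (\<Sum>\<mu>\<in>?S. h (lookup p \<mu>) * monom_eval v \<mu>
      + h (lookup q \<mu>) * monom_eval v \<mu>)"
    by (subst peval_superset[where S = ?S]) (simp_all add: lookup_add hom_add ring_distribs)
  also have "\<dots> = peval h v p + peval h v q"
    unfolding sum.distrib by (subst (1 2) peval_superset[where S = ?S]) auto
  finally show ?thesis .
qed

lemma peval_0 [simp]: "peval h v 0 = 0"
  by (simp add: peval_def)

lemma peval_sum: "peval h v (\<Sum>i\<in>S. f i) = (\<Sum>i\<in>S. peval h v (f i))"
  by (induction S rule: infinite_finite_induct) (simp_all add: peval_add)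

lemma peval_mult: "peval h v (p * q) = peval h v p * peval h v q"
proof -
  have "peval h v (single \<mu> a * single \<nu> b)
      = peval h v (single \<mu> a) * peval h v (single \<nu> b)" for \<mu> \<nu> a b
    by (simp add: mult_single peval_single hom_mult monom_eval_add mult_ac)
  then have "peval h v ((\<Sum>\<mu>\<in>S. single \<mu> (f \<mu>)) * (\<Sum>\<nu>\<in>T. single \<nu> (g \<nu>)))
      = peval h v (\<Sum>\<mu>\<in>S. single \<mu> (f \<mu>)) *
        peval h v (\<Sum>\<nu>\<in>T. single \<nu> (g \<nu>))" for S T f g
    by (simp add: sum_product peval_sum)
  from this[where S = "keys p" and T = "keys q"
      and f = "lookup p" and g = "lookup q"] show ?thesis
    by (simp only: poly_mapping_sum_single[symmetric])
qed

lemma peval_const [simp]: "peval h v (dconst c) = h c"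
  by (simp add: peval_dconst)

lemma peval_dvar [simp]: "peval h v (dvar i) = v i"
  by (simp add: dvar_def peval_single monom_eval_def)

lemma peval_1 [simp]: "peval h v 1 = 1"
  using peval_const[of v 1] by (simp add: dconst_def del: peval_const)

lemma peval_uminus: "peval h v (- p) = - peval h v p"
  using peval_add[of v p "- p"] by (simp add: eq_neg_iff_add_eq_0 add.commute)

lemma peval_diff: "peval h v (p - q) = peval h v p - peval h v q"
  using peval_add[of v p "- q"] by (simp add: peval_uminus)

lemma peval_of_nat: "peval h v (of_nat n) = of_nat n"
  by (induction n) (simp_all add: peval_add)

lemma peval_numeral [simp]: "peval h v (numeral n) = numeral n"
  using peval_of_nat[of v "numeral n"] by simp

lemma peval_power: "peval h v (p ^ n) = peval h v p ^ n"
  by (induction n) (simp_all add: peval_mult)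

lemmas peval_simps = peval_add peval_mult peval_uminus peval_diff peval_power

end

lemma monom_eval_cong:
  "(\<And>i. i \<in> keys \<mu> \<Longrightarrow> v i = w i) \<Longrightarrow> monom_eval v \<mu> = monom_eval w \<mu>"
  by (simp add: monom_eval_def)

lemma peval_cong:
  assumes "\<And>\<mu> i. \<mu> \<in> keys p \<Longrightarrow> i \<in> keys \<mu> \<Longrightarrow> v i = w i"
  shows "peval h v p = peval h w p"
  unfolding peval_def using assms by (intro sum.cong refl arg_cong2[of _ _ _ _ "(*)"] monom_eval_cong) auto

section \<open>The derivation\<close>

definition dz_monom :: "(nat \<Rightarrow>\<^sub>0 nat) \<Rightarrow> complex \<Rightarrow> diff_poly" where
  "dz_monom \<mu> c = (\<Sum>i\<in>keys \<mu>.
     single (\<mu> - single i 1 + single (Suc i) 1)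
       (c * of_nat (lookup \<mu> i)))"

lemma dz_monom_0 [simp]: "dz_monom \<mu> 0 = 0"
  by (simp add: dz_monom_def)

lemma dz_monom_add: "dz_monom \<mu> (a + b) = dz_monom \<mu> a + dz_monom \<mu> b"
  by (simp add: dz_monom_def ring_distribs single_add sum.distrib)

lemma dz_eq: "dz p = (\<Sum>\<mu>\<in>keys p. dz_monom \<mu> (lookup p \<mu>))"
  by (simp add: dz_def dz_monom_def)

lemma dz_superset:
  assumes "finite S" "keys p \<subseteq> S"
  shows "dz p = (\<Sum>\<mu>\<in>S. dz_monom \<mu> (lookup p \<mu>))"
  unfolding dz_eq using assms
  by (intro sum.mono_neutral_left) (auto simp: not_in_keys_iff_lookup_eq_zero)

lemma dz_add: "dz (p + q) = dz p + dz q"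
proof -
  let ?S = "keys p \<union> keys q"
  have "keys (p + q) \<subseteq> ?S"
    by (rule keys_add)
  then have "dz (p + q) = (\<Sum>\<mu>\<in>?S. dz_monom \<mu> (lookup p \<mu>)
      + dz_monom \<mu> (lookup q \<mu>))"
    by (subst dz_superset[where S = ?S]) (simp_all add: lookup_add dz_monom_add)
  also have "\<dots> = dz p + dz q"
    unfolding sum.distrib by (subst (1 2) dz_superset[where S = ?S]) auto
  finally show ?thesis .
qed

lemma dz_0 [simp]: "dz 0 = 0"
  by (simp add: dz_eq)

lemma dz_sum: "dz (\<Sum>i\<in>S. f i) = (\<Sum>i\<in>S. dz (f i))"
  by (induction S rule: infinite_finite_induct) (simp_all add: dz_add)

lemma dz_single: "dz (single \<mu> c) = dz_monom \<mu> c"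
  by (cases "c = 0") (simp_all add: dz_eq)

lemma dz_monom_superset:
  assumes "finite S" "keys \<mu> \<subseteq> S"
  shows "dz_monom \<mu> c = (\<Sum>i\<in>S.
     single (\<mu> - single i 1 + single (Suc i) 1)
       (c * of_nat (lookup \<mu> i)))"
  unfolding dz_monom_def using assms
  by (intro sum.mono_neutral_left) (auto simp: not_in_keys_iff_lookup_eq_zero)

lemma diff_single_add:
  assumes "lookup \<mu> i \<noteq> (0::nat)"
  shows "\<mu> + \<nu> - single i 1 = \<mu> - single i 1 + \<nu>"
  using assms
  by (intro poly_mapping_eqI) (auto simp: lookup_add lookup_minus lookup_single when_def)

lemma dz_mult_single:
  "dz (single \<mu> a * single \<nu> b)
    = dz (single \<mu> a) * single \<nu> b
      + single \<mu> a * dz (single \<nu> b)"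
proof -
  let ?S = "keys \<mu> \<union> keys \<nu>"
  let ?e = "\<lambda>i. single i (1::nat)"
  have keys: "keys (\<mu> + \<nu>) \<subseteq> ?S"
    by (rule keys_add)
  have split: "single (\<mu> + \<nu> - ?e i + ?e (Suc i))
        (a * b * of_nat (lookup (\<mu> + \<nu>) i))
      = single (\<mu> - ?e i + ?e (Suc i)) (a * of_nat (lookup \<mu> i))
          * single \<nu> b
        + single \<mu> a
          * single (\<nu> - ?e i + ?e (Suc i)) (b * of_nat (lookup \<nu> i))"
    (is "_ = ?A + ?B") for i
  proof -
    \<comment> \<open>If variable \<open>i\<close> does not occur in the differentiated factor, the
      truncated difference of exponents is not the intended one, but its coefficient is 0.\<close>
    have "?A = single (\<mu> + \<nu> - ?e i + ?e (Suc i))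
        (a * b * of_nat (lookup \<mu> i))"
    proof (cases "lookup \<mu> i = 0")
      case False
      show ?thesis
        by (simp only: diff_single_add[OF False] mult_single) (simp add: ac_simps)
    qed simp
    moreover have "?B = single (\<mu> + \<nu> - ?e i + ?e (Suc i))
        (a * b * of_nat (lookup \<nu> i))"
    proof (cases "lookup \<nu> i = 0")
      case False
      have "\<mu> + \<nu> - ?e i = \<nu> - ?e i + \<mu>"
        using diff_single_add[OF False, of \<mu>] by (simp add: add.commute)
      then show ?thesis
        by (simp only: mult_single) (simp add: ac_simps)
    qed simp
    ultimately show ?thesis
      by (simp add: lookup_add ring_distribs single_add)
  qed
  have "dz (single \<mu> a * single \<nu> b)
      = (\<Sum>i\<in>?S. single (\<mu> + \<nu> - ?e i + ?e (Suc i))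
        (a * b * of_nat (lookup (\<mu> + \<nu>) i)))"
    unfolding mult_single dz_single using keys by (intro dz_monom_superset) auto
  also have "\<dots> = dz_monom \<mu> a * single \<nu> b + single \<mu> a * dz_monom \<nu> b"
    unfolding split sum.distrib
    by (subst (1 2) dz_monom_superset[where S = ?S]) (auto simp: sum_distrib_left sum_distrib_right)
  finally show ?thesis
    by (simp add: dz_single)
qed

lemma dz_mult: "dz (p * q) = dz p * q + p * dz q"
proof -
  have "dz ((\<Sum>\<mu>\<in>S. single \<mu> (f \<mu>)) * (\<Sum>\<nu>\<in>T. single \<nu> (g \<nu>)))
      = dz (\<Sum>\<mu>\<in>S. single \<mu> (f \<mu>)) * (\<Sum>\<nu>\<in>T. single \<nu> (g \<nu>))
        + (\<Sum>\<mu>\<in>S. single \<mu> (f \<mu>)) * dz (\<Sum>\<nu>\<in>T. single \<nu> (g \<nu>))"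
    for S T f g
    by (simp add: sum_product dz_sum dz_mult_single sum.distrib)
  from this[where S = "keys p" and T = "keys q"
      and f = "lookup p" and g = "lookup q"] show ?thesis
    by (simp only: poly_mapping_sum_single[symmetric])
qed

lemma dz_dconst [simp]: "dz (dconst c) = 0"
  by (simp add: dconst_def dz_single dz_monom_def)

lemma dz_dvar [simp]: "dz (dvar i) = dvar (Suc i)"
  by (simp add: dvar_def dz_single dz_monom_def)

lemma dz_1 [simp]: "dz 1 = 0"
  using dz_dconst[of 1] by (simp add: dconst_def del: dz_dconst)

lemma dz_uminus: "dz (- p) = - dz p"
  using dz_add[of p "- p"] by (simp add: eq_neg_iff_add_eq_0 add.commute)

lemma dz_diff: "dz (p - q) = dz p - dz q"
  using dz_add[of p "- q"] by (simp add: dz_uminus)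

lemma dz_of_nat: "dz (of_nat n) = 0"
  by (induction n) (simp_all add: dz_add)

lemma dz_numeral [simp]: "dz (numeral n) = 0"
  using dz_of_nat[of "numeral n"] by simp

text \<open>For the highest variable \<open>N\<close> of \<open>q\<close>, a monomial of \<open>dz q\<close> containing \<open>N + 1\<close> arises from
  a single monomial of \<open>q\<close>.\<close>

lemma dz_eq_0_imp_const:
  assumes "dz q = 0"
  shows "q = dconst (lookup q 0)"
proof (rule ccontr)
  assume neq: "q \<noteq> dconst (lookup q 0)"
  let ?e = "\<lambda>i. single i (1::nat)"
  define V where "V = (\<Union>\<mu>\<in>keys q. keys \<mu>)"
  have "finite V"
    by (auto simp: V_def)
  have "V \<noteq> {}"
  proof
    assume "V = {}"
    then have "\<mu> = 0" if "\<mu> \<in> keys q" for \<mu>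
      using that by (auto simp: V_def)
    then have "q = dconst (lookup q 0)"
      by (intro poly_mapping_eqI)
        (force simp: dconst_def lookup_single when_def in_keys_iff)
    with neq show False by simp
  qed
  define N where "N = Max V"
  have "N \<in> V"
    using \<open>finite V\<close> \<open>V \<noteq> {}\<close> by (simp add: N_def)
  then obtain \<mu> where \<mu>: "\<mu> \<in> keys q" "N \<in> keys \<mu>"
    by (auto simp: V_def)
  have max: "i \<le> N" if "i \<in> V" for i
    using \<open>finite V\<close> that by (auto simp: N_def)
  define \<mu>' where "\<mu>' = \<mu> - ?e N + ?e (Suc N)"
  have no_Suc: "lookup \<nu> (Suc N) = 0" if "\<nu> \<in> keys q" for \<nu>
  proof (rule ccontr)
    assume "lookup \<nu> (Suc N) \<noteq> 0"
    then have "Suc N \<in> V"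
      using that by (auto simp: V_def in_keys_iff)
    then show False
      using max[of "Suc N"] by simp
  qed
  have eq: "\<nu> - ?e i + ?e (Suc i) = \<mu>' \<longleftrightarrow> i = N \<and> \<nu> = \<mu>"
    if \<nu>: "\<nu> \<in> keys q" and i: "i \<in> keys \<nu>" for \<nu> i
  proof
    assume *: "\<nu> - ?e i + ?e (Suc i) = \<mu>'"
    then have "lookup (\<nu> - ?e i + ?e (Suc i)) (Suc N) = lookup \<mu>' (Suc N)"
      by simp
    then have "i = N"
      using no_Suc[OF \<nu>] no_Suc[OF \<mu>(1)]
      by (auto simp: \<mu>'_def lookup_add lookup_minus lookup_single when_def split: if_splits)
    moreover have "\<nu> = \<mu>"
    proof (rule poly_mapping_eqI)
      fix j
      have "lookup (\<nu> - ?e i + ?e (Suc i)) j = lookup \<mu>' j"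
        using * by simp
      then show "lookup \<nu> j = lookup \<mu> j"
        using \<open>i = N\<close> \<mu>(2) i
        by (auto simp: \<mu>'_def lookup_add lookup_minus lookup_single when_def in_keys_iff
            split: if_splits)
    qed
    ultimately show "i = N \<and> \<nu> = \<mu>" by simp
  qed (simp add: \<mu>'_def)
  have "lookup (dz q) \<mu>'
      = (\<Sum>\<nu>\<in>keys q. \<Sum>i\<in>keys \<nu>.
          if \<nu> - ?e i + ?e (Suc i) = \<mu>'
          then lookup q \<nu> * of_nat (lookup \<nu> i) else 0)"
    by (simp add: dz_def lookup_sum lookup_single when_def)
  also have "\<dots> = (\<Sum>\<nu>\<in>keys q. \<Sum>i\<in>keys \<nu>.
          if i = N then if \<nu> = \<mu> then lookup q \<mu> * of_nat (lookup \<mu> N) else 0 else 0)"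
  proof (intro sum.cong refl)
    fix \<nu> i assume \<nu>: "\<nu> \<in> keys q" and i: "i \<in> keys \<nu>"
    show "(if \<nu> - ?e i + ?e (Suc i) = \<mu>'
          then lookup q \<nu> * of_nat (lookup \<nu> i) else 0)
      = (if i = N then if \<nu> = \<mu> then lookup q \<mu> * of_nat (lookup \<mu> N) else 0 else 0)"
      unfolding eq[OF \<nu> i] by auto
  qed
  also have "\<dots> = (\<Sum>\<nu>\<in>keys q. if \<nu> = \<mu>
      then lookup q \<mu> * of_nat (lookup \<mu> N) else 0)"
    using \<mu>(2) by (intro sum.cong refl) auto
  also have "\<dots> = lookup q \<mu> * of_nat (lookup \<mu> N)"
    using \<mu>(1) by simp
  also have "\<dots> \<noteq> 0"
    using \<mu> by (simp add: in_keys_iff)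
  finally show False
    using assms by simp
qed

section \<open>Evaluation at numbers, Laurent series and power series\<close>

interpretation eval_complex: scalar_hom "id :: complex \<Rightarrow> complex"
  by unfold_locales auto

interpretation eval_fls: scalar_hom "fls_const :: complex \<Rightarrow> complex fls"
  by unfold_locales (auto simp: fls_plus_const fls_const_mult_const)

interpretation eval_fps: scalar_hom "fps_const :: complex \<Rightarrow> complex fps"
  by unfold_locales auto

lemmas deval_simps = eval_complex.peval_simps[folded deval_eq_peval]
lemmas deval_dvar [simp] = eval_complex.peval_dvar[folded deval_eq_peval]
lemmas deval_1 [simp] = eval_complex.peval_1[folded deval_eq_peval]
lemmas deval_numeral [simp] = eval_complex.peval_numeral[folded deval_eq_peval]

lemma deval_dconst [simp]: "deval v (dconst c) = c"
  by (simp add: deval_eq_peval)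

section \<open>Quasi-homogeneity\<close>

text \<open>Variable \<open>i\<close> is the component with index \<open>i + 1\<close>, whose weight
  is \<open>i + 2\<close>: the pole order of the derivative of order \<open>i\<close> of a double
  pole.\<close>

definition wt :: "(nat \<Rightarrow>\<^sub>0 nat) \<Rightarrow> nat" where
  "wt \<mu> = (\<Sum>i\<in>keys \<mu>. (i + 2) * lookup \<mu> i)"

definition homog :: "nat \<Rightarrow> diff_poly \<Rightarrow> bool" where
  "homog w p \<longleftrightarrow> (\<forall>\<mu>\<in>keys p. wt \<mu> = w)"

lemma wt_0 [simp]: "wt 0 = 0"
  by (simp add: wt_def)

lemma wt_superset:
  assumes "finite S" "keys \<mu> \<subseteq> S"
  shows "wt \<mu> = (\<Sum>i\<in>S. (i + 2) * lookup \<mu> i)"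
  unfolding wt_def using assms
  by (intro sum.mono_neutral_left) (auto simp: not_in_keys_iff_lookup_eq_zero)

lemma wt_add: "wt (\<mu> + \<nu>) = wt \<mu> + wt \<nu>"
proof -
  let ?S = "keys \<mu> \<union> keys \<nu>"
  have "keys (\<mu> + \<nu>) \<subseteq> ?S"
    by (rule keys_add)
  then have "wt (\<mu> + \<nu>) = (\<Sum>i\<in>?S. (i + 2) * lookup \<mu> i + (i + 2) * lookup \<nu> i)"
    by (subst wt_superset[where S = ?S]) (simp_all add: lookup_add distrib_left)
  also have "\<dots> = wt \<mu> + wt \<nu>"
    unfolding sum.distrib by (subst (1 2) wt_superset[where S = ?S]) auto
  finally show ?thesis .
qed

lemma wt_single [simp]: "wt (single i n) = (i + 2) * n"
  by (cases "n = 0") (simp_all add: wt_def)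

lemma homog_0 [simp]: "homog w 0"
  by (simp add: homog_def)

lemma homog_add: "homog w p \<Longrightarrow> homog w q \<Longrightarrow> homog w (p + q)"
  unfolding homog_def using keys_add[of p q] by blast

lemma homog_uminus: "homog w p \<Longrightarrow> homog w (- p)"
  by (simp add: homog_def in_keys_iff)

lemma homog_diff: "homog w p \<Longrightarrow> homog w q \<Longrightarrow> homog w (p - q)"
  using homog_add[of w p "- q"] homog_uminus[of w q] by simp

lemma homog_sum: "(\<And>i. i \<in> S \<Longrightarrow> homog w (f i)) \<Longrightarrow> homog w (\<Sum>i\<in>S. f i)"
  by (induction S rule: infinite_finite_induct) (auto intro: homog_add)

lemma homog_single: "wt \<mu> = w \<Longrightarrow> homog w (single \<mu> c)"
  by (cases "c = 0") (simp_all add: homog_def)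

lemma homog_mult: "homog w p \<Longrightarrow> homog w' q \<Longrightarrow> homog (w + w') (p * q)"
  unfolding homog_def using keys_mult[of p q] by (fastforce simp: wt_add)

lemma homog_dconst: "homog 0 (dconst c)"
  by (simp add: dconst_def homog_single)

lemma homog_1: "homog 0 1"
  using homog_dconst[of 1] by (simp add: dconst_def)

lemma homog_dconst_mult: "homog w p \<Longrightarrow> homog w (dconst c * p)"
  using homog_mult[OF homog_dconst, of w p c] by simp

lemma numeral_eq_dconst: "(numeral n :: diff_poly) = dconst (numeral n)"
  by (simp add: dconst_def flip: single_numeral)

lemma homog_numeral_mult: "homog w p \<Longrightarrow> homog w (numeral n * p)"
  by (simp only: numeral_eq_dconst homog_dconst_mult)

lemma homog_dvar: "homog (i + 2) (dvar i)"
  by (simp add: dvar_def homog_single)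

lemma homog_dz:
  assumes "homog w p"
  shows "homog (Suc w) (dz p)"
  unfolding dz_def
proof (intro homog_sum homog_single)
  fix \<mu> i assume \<mu>: "\<mu> \<in> keys p" and i: "i \<in> keys \<mu>"
  let ?\<nu> = "\<mu> - single i 1"
  have "\<mu> = ?\<nu> + single i 1"
    using i by (intro poly_mapping_eqI)
      (auto simp: lookup_add lookup_minus lookup_single when_def in_keys_iff)
  then have "wt \<mu> = wt ?\<nu> + (i + 2)"
    by (metis wt_add wt_single mult.right_neutral)
  then show "wt (?\<nu> + single (Suc i) 1) = Suc w"
    using assms \<mu> by (simp add: wt_add homog_def)
qed

text \<open>The weight belongs to the predicate because Euler-type identities such as
  \<open>fps_nth_dz\<close> contain it. Zero is a separate case since it has every weight, whereas
  \<open>dconst 0\<close> only covers weight 0.\<close>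

lemma homog_induct [consumes 1, case_names zero const var add mult]:
  assumes "homog w p"
    and zero: "\<And>w. P w 0"
    and const: "\<And>c. P 0 (dconst c)"
    and var: "\<And>i. P (i + 2) (dvar i)"
    and add: "\<And>w p q. P w p \<Longrightarrow> P w q \<Longrightarrow> P w (p + q)"
    and mult: "\<And>w w' p q. P w p \<Longrightarrow> P w' q \<Longrightarrow> P (w + w') (p * q)"
  shows "P w p"
proof -
  have P1: "P 0 1"
    using const[of 1] by (simp add: dconst_def)
  have pow: "P ((i + 2) * n) (dvar i ^ n)" for i n
  proof (induction n)
    case (Suc n)
    then show ?case using mult[OF var[of i] Suc] by simp
  qed (simp add: P1)
  have "P (\<Sum>i\<in>S. (i + 2) * f i) (\<Prod>i\<in>S. dvar i ^ f i)" if "finite S" for S f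
    using that
  proof (induction S)
    case (insert i S)
    then show ?case
      using mult[OF pow[of i "f i"] insert.IH] by simp
  qed (simp add: P1)
  then have single: "P (wt \<mu>) (single \<mu> c)" for \<mu> c
    using mult[OF const[of c], of "wt \<mu>"] by (subst single_eq_prod_dvar) (simp add: wt_def)
  have "P w (\<Sum>\<mu>\<in>S. single \<mu> (f \<mu>))" if "finite S" "\<And>\<mu>. \<mu> \<in> S \<Longrightarrow> wt \<mu> = w" for S f
    using that
  proof (induction S)
    case (insert \<mu> S)
    then show ?case
      using single[of \<mu> "f \<mu>"] by (auto intro!: add)
  qed (simp add: zero)
  then have "P w (\<Sum>\<mu>\<in>keys p. single \<mu> (lookup p \<mu>))"
    using assms(1) by (auto simp: homog_def)
  then show ?thesis
    by (simp only: poly_mapping_sum_single[symmetric])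
qed

lemma homog_lookup_0:
  assumes "homog w p" "w > 0"
  shows "lookup p 0 = 0"
  using assms by (force simp: homog_def in_keys_iff)

section \<open>The Lenard recursion\<close>

definition lenard_op :: "diff_poly \<Rightarrow> diff_poly" where
  "lenard_op p = dz (dz (dz p)) - 8 * dvar 0 * dz p - 4 * dz (dvar 0) * p"

lemma half_diff_poly: "dconst (1 / 2) * p + dconst (1 / 2) * p = p"
proof -
  have "dconst (1 / 2) + dconst (1 / 2) = 1"
    by (simp add: dconst_def flip: single_add)
  then show ?thesis
    by (metis distrib_right mult_1)
qed

text \<open>The coefficients of a first integral of the Lenard recursion: multiplying
  \<open>L' = \<lambda> (L''' - 8 x L' - 4 x' L)\<close> by \<open>L = \<Sum>\<^sub>n \<lambda>\<^sup>n L\<^sub>n\<close> gives a total derivative, which integrates to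
  \<open>L\<^sup>2 = 1 + 2 \<lambda> (L L'' - L'\<^sup>2 / 2 - 4 x L\<^sup>2)\<close>.\<close>

definition lenard_next :: "nat \<Rightarrow> (nat \<Rightarrow> diff_poly) \<Rightarrow> diff_poly" where
  "lenard_next n L =
    (\<Sum>i=0..n. L i * dz (dz (L (n - i))) - dconst (1 / 2) * (dz (L i) * dz (L (n - i)))
      - 4 * (dvar 0 * (L i * L (n - i))))
    - dconst (1 / 2) * (\<Sum>i=1..n. L i * L (Suc n - i))"

lemma sum_rev_0: "(\<Sum>i=0..n. f i) = (\<Sum>i=0..n. f (n - i :: nat))"
  by (subst sum.atLeastAtMost_rev) simp

lemma sum_rev_1: "(\<Sum>i=1..n. f i) = (\<Sum>i=1..n. f (Suc n - i :: nat))"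
  by (subst sum.atLeastAtMost_rev) simp

text \<open>The first sum differentiates to the sum of \<open>L i * lenard_op (L (n - i))\<close>
  over \<open>0 \<le> i \<le> n\<close>. By the recursion already available, the second gives the
  same terms for \<open>1 \<le> i \<le> n\<close>. The term \<open>i = 0\<close> remains, with
  \<open>L 0 = 1\<close>.\<close>

lemma dz_lenard_next:
  assumes L0: "L 0 = 1"
    and rec: "\<And>j. j < n \<Longrightarrow> dz (L (Suc j)) = lenard_op (L j)"
  shows "dz (lenard_next n L) = lenard_op (L n)"
proof -
  let ?h = "dconst (1 / 2)"
  define S1 where "S1 = (\<Sum>i=0..n. dz (L i) * dz (dz (L (n - i))))"
  define S2 where "S2 = (\<Sum>i=0..n. L i * dz (dz (dz (L (n - i)))))"
  define S3 where "S3 = (\<Sum>i=0..n. L i * dz (L (n - i)))"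
  define S4 where "S4 = (\<Sum>i=0..n. L i * L (n - i))"
  define T where "T = (\<Sum>i=1..n. L i * dz (L (Suc n - i)))"
  have S1': "(\<Sum>i=0..n. dz (dz (L i)) * dz (L (n - i))) = S1"
    unfolding S1_def by (subst sum_rev_0) (auto intro!: sum.cong simp: mult.commute)
  have S3': "(\<Sum>i=0..n. dz (L i) * L (n - i)) = S3"
    unfolding S3_def by (subst sum_rev_0) (auto intro!: sum.cong simp: mult.commute)
  have T': "(\<Sum>i=1..n. dz (L i) * L (Suc n - i)) = T"
    unfolding T_def by (subst sum_rev_1) (auto intro!: sum.cong simp: mult.commute)
  have trm: "dz (L i * dz (dz (L (n - i))) - ?h * (dz (L i) * dz (L (n - i)))
      - 4 * (dvar 0 * (L i * L (n - i))))
    = dz (L i) * dz (dz (L (n - i))) + L i * dz (dz (dz (L (n - i))))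
      - ?h * (dz (dz (L i)) * dz (L (n - i)) + dz (L i) * dz (dz (L (n - i))))
      - 4 * (dz (dvar 0) * (L i * L (n - i)) + dvar 0 * (dz (L i) * L (n - i) + L i * dz (L (n - i))))" for i
    by (simp add: dz_diff dz_mult)
  have "dz (\<Sum>i=0..n. L i * dz (dz (L (n - i))) - ?h * (dz (L i) * dz (L (n - i)))
      - 4 * (dvar 0 * (L i * L (n - i))))
    = S1 + S2 - ?h * (S1 + S1) - 4 * (dz (dvar 0) * S4 + dvar 0 * (S3 + S3))"
    unfolding dz_sum trm
    unfolding sum_subtractf sum.distrib sum_distrib_left[symmetric]
    by (simp only: S1' S3' flip: S1_def S2_def S3_def S4_def)
  also have "?h * (S1 + S1) = S1"
    by (simp only: distrib_left half_diff_poly)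
  finally have 1: "dz (\<Sum>i=0..n. L i * dz (dz (L (n - i))) - ?h * (dz (L i) * dz (L (n - i)))
      - 4 * (dvar 0 * (L i * L (n - i)))) = S2 - 8 * (dvar 0 * S3) - 4 * (dz (dvar 0) * S4)"
    by (simp add: algebra_simps)
  have "dz (?h * (\<Sum>i=1..n. L i * L (Suc n - i))) = ?h * (T + T)"
    unfolding dz_sum dz_mult sum.distrib by (simp only: dz_dconst mult_zero_left add_0_left T' flip: T_def)
  also have "\<dots> = T"
    by (simp only: distrib_left half_diff_poly)
  also have "T = (\<Sum>i=1..n. L i * lenard_op (L (n - i)))"
    unfolding T_def
  proof (intro sum.cong refl)
    fix i assume "i \<in> {1..n}"
    then have "Suc n - i = Suc (n - i)" "n - i < n" by auto
    then show "L i * dz (L (Suc n - i)) = L i * lenard_op (L (n - i))"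
      by (simp add: rec)
  qed
  finally have 2: "dz (?h * (\<Sum>i=1..n. L i * L (Suc n - i))) = (\<Sum>i=1..n. L i * lenard_op (L (n - i)))" .
  have trm: "L i * lenard_op (L (n - i)) = L i * dz (dz (dz (L (n - i))))
      - 8 * (dvar 0 * (L i * dz (L (n - i)))) - 4 * (dz (dvar 0) * (L i * L (n - i)))" for i
    by (simp add: lenard_op_def algebra_simps)
  have "S2 - 8 * (dvar 0 * S3) - 4 * (dz (dvar 0) * S4) = (\<Sum>i=0..n. L i * lenard_op (L (n - i)))"
    unfolding trm sum_subtractf sum_distrib_left[symmetric] S2_def S3_def S4_def ..
  also have "\<dots> = lenard_op (L n) + (\<Sum>i=1..n. L i * lenard_op (L (n - i)))"
    by (subst sum.atLeast_Suc_atMost) (simp_all add: L0)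
  finally show ?thesis
    unfolding lenard_next_def dz_diff 1 2 by simp
qed

lemma homog_lenard_next:
  assumes "\<And>j. j \<le> n \<Longrightarrow> homog (2 * j) (L j)"
  shows "homog (2 * Suc n) (lenard_next n L)"
  unfolding lenard_next_def
proof (intro homog_diff homog_sum homog_dconst_mult homog_numeral_mult)
  fix i assume i: "i \<in> {0..n}"
  have Li: "homog (2 * i) (L i)" and Lj: "homog (2 * (n - i)) (L (n - i))"
    using i by (auto intro: assms)
  have w: "2 * i + Suc (Suc (2 * (n - i))) = 2 * Suc n" "Suc (2 * i) + Suc (2 * (n - i)) = 2 * Suc n"
    "0 + 2 + (2 * i + 2 * (n - i)) = 2 * Suc n"
    using i by auto
  show "homog (2 * Suc n) (L i * dz (dz (L (n - i))))"
    using homog_mult[OF Li homog_dz[OF homog_dz[OF Lj]]] by (simp only: w)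
  show "homog (2 * Suc n) (dz (L i) * dz (L (n - i)))"
    using homog_mult[OF homog_dz[OF Li] homog_dz[OF Lj]] by (simp only: w)
  show "homog (2 * Suc n) (dvar 0 * (L i * L (n - i)))"
    using homog_mult[OF homog_dvar[of 0] homog_mult[OF Li Lj]] by (simp only: w)
next
  fix i assume i: "i \<in> {1..n}"
  then have "homog (2 * i) (L i)" "homog (2 * (Suc n - i)) (L (Suc n - i))"
    by (auto intro: assms)
  moreover have "2 * i + 2 * (Suc n - i) = 2 * Suc n"
    using i by auto
  ultimately show "homog (2 * Suc n) (L i * L (Suc n - i))"
    using homog_mult by metis
qed

declare lenard.simps(2) [simp del]

text \<open>Resolves the definite description: \<open>lenard_next\<close> is an antiderivative, its
  positive weight excludes a constant term, and two antiderivatives differ by a constant. Both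
  claims are proved together because each new antiderivative is built from all earlier
  polynomials.\<close>

lemma lenard_aux: "(\<forall>j\<le>n. homog (2 * j) (lenard j)) \<and> (\<forall>j<n. dz (lenard (Suc j)) = lenard_op (lenard j))"
proof (induction n)
  case 0
  then show ?case by (simp add: homog_1)
next
  case (Suc n)
  define q where "q = lenard_next n lenard"
  have q: "dz q = lenard_op (lenard n)"
    unfolding q_def using Suc by (intro dz_lenard_next) auto
  have homog_q: "homog (2 * Suc n) q"
    unfolding q_def by (rule homog_lenard_next) (use Suc in blast)
  have q0: "lookup q 0 = 0"
    using homog_lookup_0[OF homog_q] by simp
  have "lenard (Suc n) = q"
    unfolding lenard.simps
  proof (rule the_equality)
    fix p
    assume p: "dz p = dz (dz (dz (lenard n))) - 8 * dvar 0 * dz (lenard n) - 4 * dz (dvar 0) * lenard n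
      \<and> lookup p 0 = 0"
    then have "dz (p - q) = 0"
      using q by (simp add: dz_diff lenard_op_def)
    then have "p - q = dconst (lookup (p - q) 0)"
      by (rule dz_eq_0_imp_const)
    then show "p = q"
      using p q0 by (simp add: lookup_minus dconst_def)
  qed (use q q0 in \<open>simp add: lenard_op_def\<close>)
  then show ?case
    using Suc q homog_q by (auto simp: le_Suc_eq less_Suc_eq)
qed

lemma homog_lenard: "homog (2 * n) (lenard n)"
  using lenard_aux[of n] by blast

lemma dz_lenard_Suc: "dz (lenard (Suc n)) = lenard_op (lenard n)"
  using lenard_aux[of "Suc n"] by blast

section \<open>Directional derivatives\<close>

text \<open>The derivative of \<open>p\<close> at \<open>v\<close> in direction \<open>w\<close>,
  read off from \<open>p (v + w t)\<close> as a power series in \<open>t\<close>; the Leibniz rule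
  is then the product of series.\<close>

definition ddir :: "(nat \<Rightarrow> complex) \<Rightarrow> (nat \<Rightarrow> complex) \<Rightarrow> diff_poly \<Rightarrow> complex" where
  "ddir v w p = fps_nth (peval fps_const (\<lambda>i. fps_const (v i) + fps_const (w i) * fps_X) p) 1"

lemma peval_fps_nth_0: "fps_nth (peval fps_const y p) 0 = deval (\<lambda>i. fps_nth (y i) 0) p"
  by (induction p rule: diff_poly_induct)
    (simp_all add: deval_simps eval_fps.peval_simps)

lemma ddir_dconst [simp]: "ddir v w (dconst c) = 0"
  by (simp add: ddir_def)

lemma ddir_dvar [simp]: "ddir v w (dvar i) = w i"
  by (simp add: ddir_def)

lemma ddir_add: "ddir v w (p + q) = ddir v w p + ddir v w q"
  by (simp add: ddir_def eval_fps.peval_add)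

lemma ddir_uminus: "ddir v w (- p) = - ddir v w p"
  by (simp add: ddir_def eval_fps.peval_uminus)

lemma ddir_diff: "ddir v w (p - q) = ddir v w p - ddir v w q"
  by (simp add: ddir_def eval_fps.peval_diff)

lemma ddir_mult: "ddir v w (p * q) = ddir v w p * deval v q + deval v p * ddir v w q"
  by (simp add: ddir_def eval_fps.peval_mult fps_mult_nth_1 peval_fps_nth_0)

lemma ddir_1 [simp]: "ddir v w 1 = 0"
  by (simp add: ddir_def)

lemma ddir_0 [simp]: "ddir v w 0 = 0"
  by (simp add: ddir_def)

lemma ddir_numeral [simp]: "ddir v w (numeral n) = 0"
  by (simp add: numeral_eq_dconst)

lemmas ddir_simps = ddir_add ddir_uminus ddir_diff ddir_mult

lemma has_field_derivative_deval:
  assumes "\<And>i. ((\<lambda>s. f i s) has_field_derivative w i) (at s)"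
  shows "((\<lambda>s. deval (\<lambda>i. f i s) p) has_field_derivative ddir (\<lambda>i. f i s) w p) (at s)"
  by (induction p rule: diff_poly_induct)
    (auto simp: deval_simps ddir_simps assms intro!: derivative_eq_intros)

text \<open>The two jets differ by terms of order at least \<open>n\<close>. As
  \<open>n \<ge> 1\<close>, a product of two such differences starts beyond order \<open>n\<close>,
  so up to this order only the first variation at the constant terms is visible.\<close>

lemma peval_fps_taylor:
  assumes "n \<ge> 1" and eq: "\<And>i l. l < n \<Longrightarrow> fps_nth (y i) l = fps_nth (y' i) l"
  shows "(\<forall>l<n. fps_nth (peval fps_const y p) l = fps_nth (peval fps_const y' p) l)
    \<and> fps_nth (peval fps_const y p) n = fps_nth (peval fps_const y' p) n
      + ddir (\<lambda>i. fps_nth (y i) 0) (\<lambda>i. fps_nth (y i) n - fps_nth (y' i) n) p"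
proof (induction p rule: diff_poly_induct)
  case (mult p q)
  let ?v = "\<lambda>i. fps_nth (y i) 0"
  have v: "?v = (\<lambda>i. fps_nth (y' i) 0)"
    using eq[of 0] \<open>n \<ge> 1\<close> by auto
  have split: "fps_nth (f * g) n = fps_nth f 0 * fps_nth g n + fps_nth f n * fps_nth g 0
      + (\<Sum>i=1..<n. fps_nth f i * fps_nth g (n - i))" for f g :: "complex fps"
  proof -
    have "fps_nth (f * g) n = (\<Sum>i=0..<n. fps_nth f i * fps_nth g (n - i)) + fps_nth f n * fps_nth g 0"
      by (simp add: fps_mult_nth sum.last_plus add.commute)
    also have "(\<Sum>i=0..<n. fps_nth f i * fps_nth g (n - i))
        = fps_nth f 0 * fps_nth g n + (\<Sum>i=1..<n. fps_nth f i * fps_nth g (n - i))"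
      using \<open>n \<ge> 1\<close> by (subst sum.atLeast_Suc_lessThan) auto
    finally show ?thesis by simp
  qed
  have "(\<Sum>i=1..<n. fps_nth (peval fps_const y p) i * fps_nth (peval fps_const y q) (n - i))
      = (\<Sum>i=1..<n. fps_nth (peval fps_const y' p) i * fps_nth (peval fps_const y' q) (n - i))"
    using mult by (intro sum.cong) auto
  moreover have "fps_nth (peval fps_const y p * peval fps_const y q) l
      = fps_nth (peval fps_const y' p * peval fps_const y' q) l" if "l < n" for l
    unfolding fps_mult_nth using mult that by (intro sum.cong) auto
  ultimately show ?case
    using mult by (simp add: eval_fps.peval_mult split ddir_mult peval_fps_nth_0 v algebra_simps)
next
  case (const c)
  then show ?case by simp
next
  case (var i)
  then show ?case by (simp add: eq)
next
  case (add p q)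
  then show ?case by (simp add: eval_fps.peval_add ddir_add)
qed

lemma ddir_add_dir: "ddir v (\<lambda>i. w i + w' i) p = ddir v w p + ddir v w' p"
  by (induction p rule: diff_poly_induct) (simp_all add: ddir_simps algebra_simps)

lemma ddir_scale_dir: "ddir v (\<lambda>i. c * w i) p = c * ddir v w p"
  by (induction p rule: diff_poly_induct) (simp_all add: ddir_simps algebra_simps)

lemma ddir_zero_dir [simp]: "ddir v (\<lambda>i. 0) p = 0"
  using ddir_scale_dir[of v 0 "\<lambda>_. 0" p] by simp

definition unit_dir :: "nat \<Rightarrow> nat \<Rightarrow> complex" where
  "unit_dir i = (\<lambda>j. if j = i then 1 else 0)"

definition vars_below :: "nat \<Rightarrow> diff_poly \<Rightarrow> bool" where
  "vars_below N p \<longleftrightarrow> (\<forall>\<mu>\<in>keys p. keys \<mu> \<subseteq> {..<N})"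

lemma peval_cong_vars_below:
  "vars_below N p \<Longrightarrow> (\<And>i. i < N \<Longrightarrow> v i = w i) \<Longrightarrow> peval h v p = peval h w p"
  by (rule peval_cong) (auto simp: vars_below_def)

lemma ddir_cong_vars_below:
  "vars_below N p \<Longrightarrow> (\<And>i. i < N \<Longrightarrow> v i = v' i) \<Longrightarrow> (\<And>i. i < N \<Longrightarrow> w i = w' i)
    \<Longrightarrow> ddir v w p = ddir v' w' p"
  unfolding ddir_def
  by (rule arg_cong[where f = "\<lambda>F. fps_nth F 1"], rule peval_cong_vars_below) auto

lemma ddir_sum_dir: "ddir v (\<lambda>i. \<Sum>j\<in>S. f j i) p = (\<Sum>j\<in>S. ddir v (f j) p)"
  by (induction S rule: infinite_finite_induct) (simp_all add: ddir_add_dir)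

lemma ddir_eq_sum_unit_dir:
  assumes "vars_below N p"
  shows "ddir v w p = (\<Sum>i<N. w i * ddir v (unit_dir i) p)"
proof -
  have "ddir v w p = ddir v (\<lambda>j. \<Sum>i<N. w i * unit_dir i j) p"
    using assms by (rule ddir_cong_vars_below)
      (auto simp: unit_dir_def if_distrib[where f = "\<lambda>x. _ * x"] cong: if_cong)
  then show ?thesis
    by (simp add: ddir_sum_dir ddir_scale_dir)
qed

text \<open>At the origin only monomials of degree one have a nonzero gradient.\<close>

lemma ddir_at_0_eq_lookup:
  "ddir (\<lambda>_. 0) (unit_dir i) p = lookup p (single i 1)"
proof -
  have single: "ddir (\<lambda>_. 0) (unit_dir i) (single \<mu> c)
      = lookup (single \<mu> c) (single i 1)" for \<mu> c
  proof (cases "keys \<mu> \<subseteq> {i}")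
    case True
    have \<mu>: "\<mu> = single i (lookup \<mu> i)"
    proof (rule poly_mapping_eqI)
      fix j show "lookup \<mu> j = lookup (single i (lookup \<mu> i)) j"
        using True by (cases "j = i") (auto simp: lookup_single when_def in_keys_iff)
    qed
    obtain n where n: "\<mu> = single i n"
      using \<mu> by blast
    have "monom_eval (\<lambda>j. fps_const 0 + fps_const (unit_dir i j) * fps_X) \<mu> = (fps_X :: complex fps) ^ n"
      unfolding n by (cases "n = 0") (simp_all add: monom_eval_def unit_dir_def)
    moreover have "single i n = single i 1 \<longleftrightarrow> n = 1"
      by (metis lookup_single_eq)
    ultimately show ?thesis
      by (simp add: ddir_def peval_single n fps_X_power_nth lookup_single when_def)
  next
    case False
    then obtain j where j: "j \<in> keys \<mu>" "j \<noteq> i" by auto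
    have "monom_eval (\<lambda>j. fps_const 0 + fps_const (unit_dir i j) * fps_X) \<mu> = (0 :: complex fps)"
      unfolding monom_eval_def using j
      by (intro prod_zero) (auto intro!: bexI[of _ j] simp: unit_dir_def in_keys_iff)
    moreover have "\<mu> \<noteq> single i 1"
      using j by auto
    ultimately show ?thesis
      by (simp add: ddir_def peval_single lookup_single when_def)
  qed
  have "ddir (\<lambda>_. 0) (unit_dir i) (\<Sum>\<mu>\<in>S. single \<mu> (f \<mu>))
      = lookup (\<Sum>\<mu>\<in>S. single \<mu> (f \<mu>)) (single i 1)" for S f
    by (induction S rule: infinite_finite_induct) (simp_all add: ddir_add lookup_add single)
  from this[where S = "keys p" and f = "lookup p"] show ?thesis
    by (simp only: poly_mapping_sum_single[symmetric])
qed

lemma deval_at_0_dz: "deval (\<lambda>_. 0) (dz p) = 0"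
  by (induction p rule: diff_poly_induct) (simp_all add: dz_add dz_mult deval_simps deval_eq_peval[of _ 0])

lemma deval_at_0_homog: "homog w p \<Longrightarrow> w > 0 \<Longrightarrow> deval (\<lambda>_. 0) p = 0"
  by (induction rule: homog_induct) (auto simp: deval_simps deval_eq_peval[of _ 0])

lemma ddir_at_0_dz: "ddir (\<lambda>_. 0) (unit_dir (Suc i)) (dz p) = ddir (\<lambda>_. 0) (unit_dir i) p"
  by (induction p rule: diff_poly_induct)
    (simp_all add: dz_add dz_mult ddir_simps deval_at_0_dz unit_dir_def)

text \<open>If \<open>f\<close> has no constant term, then \<open>x f'\<close> and
  \<open>x' f\<close> have no linear part, and \<open>lenard_op\<close> acts on linear parts as
  three derivatives, of which integration takes one back. The value -4 enters at
  \<open>m = 0\<close>, from \<open>- 4 x'\<close> times \<open>lenard 0 = 1\<close>.\<close>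

lemma lenard_linear_coeff: "ddir (\<lambda>_. 0) (unit_dir (2 * m)) (lenard (Suc m)) = - 4"
proof (induction m)
  case 0
  have "ddir (\<lambda>_. 0) (unit_dir 0) (lenard 1) = ddir (\<lambda>_. 0) (unit_dir 1) (dz (lenard 1))"
    by (simp add: ddir_at_0_dz)
  also have "\<dots> = - 4"
    by (simp add: dz_lenard_Suc lenard_op_def ddir_simps deval_simps unit_dir_def)
  finally show ?case by simp
next
  case (Suc m)
  have "deval (\<lambda>_. 0) (lenard (Suc m)) = 0"
    using deval_at_0_homog[OF homog_lenard] by simp
  moreover have "ddir (\<lambda>_. 0) (unit_dir (2 * Suc m)) (lenard (Suc (Suc m)))
      = ddir (\<lambda>_. 0) (unit_dir (Suc (Suc (Suc (2 * m))))) (dz (lenard (Suc (Suc m))))"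
    by (simp add: ddir_at_0_dz)
  moreover have "\<dots> = ddir (\<lambda>_. 0) (unit_dir (Suc (Suc (Suc (2 * m))))) (lenard_op (lenard (Suc m)))"
    by (simp only: dz_lenard_Suc)
  ultimately show ?case
    using Suc by (simp add: lenard_op_def ddir_simps deval_simps ddir_at_0_dz deval_at_0_dz)
qed

section \<open>The polynomial P\<close>

lemma homog_painleve_poly: "homog (2 * m + 2) (painleve_poly m)"
  unfolding painleve_poly_def using homog_dvar[of "2 * m"] homog_lenard[of "m + 1"]
  by (auto intro!: homog_add homog_dconst_mult)

lemma lookup_painleve_poly_linear:
  "lookup (painleve_poly m) (single (2 * m) 1) = 0"
proof -
  have "ddir (\<lambda>_. 0) (unit_dir (2 * m)) (painleve_poly m) = 0"
    by (simp add: painleve_poly_def ddir_simps lenard_linear_coeff) (simp add: unit_dir_def)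
  then show ?thesis
    by (simp only: ddir_at_0_eq_lookup)
qed

text \<open>The weight \<open>2 m + 2\<close> is the total order of differentiation plus twice the
  degree. Degree 0 contradicts the weight, and degree 1 would be \<open>dvar (2 * m)\<close>, which
  cancels in \<open>painleve_poly\<close>; so the degree is at least 2 and the order at most
  \<open>2 m - 2\<close>.\<close>

lemma painleve_poly_monom:
  assumes \<mu>: "\<mu> \<in> keys (painleve_poly m)"
  shows "(\<Sum>i\<in>keys \<mu>. lookup \<mu> i) \<ge> 2"
    and "(\<Sum>i\<in>keys \<mu>. i * lookup \<mu> i) + 2 \<le> 2 * m"
proof -
  let ?r = "\<Sum>i\<in>keys \<mu>. lookup \<mu> i"
  have "wt \<mu> = (\<Sum>i\<in>keys \<mu>. i * lookup \<mu> i) + 2 * ?r"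
    by (simp add: wt_def sum.distrib distrib_right flip: sum_distrib_left sum_distrib_right)
  then have wt: "(\<Sum>i\<in>keys \<mu>. i * lookup \<mu> i) + 2 * ?r = 2 * m + 2"
    using homog_painleve_poly[of m] \<mu> by (auto simp: homog_def)
  show r: "?r \<ge> 2"
  proof (rule ccontr)
    assume "\<not> ?r \<ge> 2"
    moreover have "?r \<noteq> 0"
    proof
      assume r0: "?r = 0"
      then have "(\<Sum>i\<in>keys \<mu>. i * lookup \<mu> i) = 0"
        by simp
      with r0 wt show False by simp
    qed
    ultimately have r1: "?r = 1" by linarith
    then obtain i where i: "i \<in> keys \<mu>"
      by (metis sum.empty zero_neq_one equals0I)
    have "?r = lookup \<mu> i + (\<Sum>j\<in>keys \<mu> - {i}. lookup \<mu> j)"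
      using i by (intro sum.remove) auto
    moreover have "lookup \<mu> i \<ge> 1"
      using i by (simp add: in_keys_iff Suc_le_eq)
    ultimately have li: "lookup \<mu> i = 1"
      and "(\<Sum>j\<in>keys \<mu> - {i}. lookup \<mu> j) = 0"
      using r1 by linarith+
    then have "\<forall>j\<in>keys \<mu> - {i}. lookup \<mu> j = 0"
      by (subst (asm) sum_eq_0_iff) auto
    then have "lookup \<mu> j = 0" if "j \<noteq> i" for j
      using that by (auto simp: in_keys_iff)
    then have \<mu>_eq: "\<mu> = single i 1"
      using li by (intro poly_mapping_eqI) (auto simp: lookup_single when_def)
    then have "i = 2 * m"
      using wt by simp
    then show False
      using \<mu> \<mu>_eq lookup_painleve_poly_linear by (simp add: in_keys_iff)
  qed
  show "(\<Sum>i\<in>keys \<mu>. i * lookup \<mu> i) + 2 \<le> 2 * m"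
    using wt r by linarith
qed

lemma painleve_poly_vars:
  assumes \<mu>: "\<mu> \<in> keys (painleve_poly m)" and i: "i \<in> keys \<mu>"
  shows "i + 2 \<le> 2 * m"
proof -
  have "i \<le> i * lookup \<mu> i"
    using i by (simp add: in_keys_iff)
  also have "\<dots> \<le> (\<Sum>i\<in>keys \<mu>. i * lookup \<mu> i)"
    using i by (intro member_le_sum) auto
  finally show ?thesis
    using painleve_poly_monom(2)[OF \<mu>] by linarith
qed

lemma vars_below_painleve_poly: "vars_below (2 * m) (painleve_poly m)"
  using painleve_poly_vars by (fastforce simp: vars_below_def)

section \<open>Linearisation at the leading term of the Laurent series\<close>

text \<open>Falling factorial: the derivative of order \<open>i\<close> of \<open>t powi x\<close>
  is \<open>ffall x i * t powi (x - i)\<close>.\<close>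

primrec ffall :: "complex \<Rightarrow> nat \<Rightarrow> complex" where
  "ffall x 0 = 1"
| "ffall x (Suc i) = (x - of_nat i) * ffall x i"

definition half_tri :: "nat \<Rightarrow> complex" where
  "half_tri k = of_nat k * (of_nat k + 1) / 2"

text \<open>The jet at \<open>z = 1\<close> of the leading term
  \<open>k (k + 1) / 2 * z\<^sup>-\<^sup>2\<close>; \<open>pert_jet\<close> is that of
  \<open>z powi (\<rho> - 2)\<close>. By homogeneity the values at one point suffice.\<close>

definition pole_jet :: "nat \<Rightarrow> nat \<Rightarrow> complex" where
  "pole_jet k i = half_tri k * ffall (- 2) i"

definition pert_jet :: "complex \<Rightarrow> nat \<Rightarrow> complex" where
  "pert_jet \<rho> i = ffall (\<rho> - 2) i"

lemma pole_jet_Suc: "pole_jet k (Suc i) = - of_nat (i + 2) * pole_jet k i"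
  by (simp add: pole_jet_def algebra_simps)

lemma pert_jet_Suc: "pert_jet \<rho> (Suc i) = (\<rho> - of_nat (i + 2)) * pert_jet \<rho> i"
  by (simp add: pert_jet_def algebra_simps)

text \<open>Euler's relation: at the leading term a polynomial of weight \<open>w\<close> is a
  multiple of \<open>z powi (- w)\<close> and its variation one of
  \<open>z powi (\<rho> - w)\<close>, so differentiation multiplies by the exponent.\<close>

lemma ddir_dz_homog:
  assumes "homog w p"
  shows "deval (pole_jet k) (dz p) = - of_nat w * deval (pole_jet k) p
    \<and> ddir (pole_jet k) (pert_jet \<rho>) (dz p) = (\<rho> - of_nat w) * ddir (pole_jet k) (pert_jet \<rho>) p"
  using assms
proof (induction rule: homog_induct)
  case (zero w)
  then show ?case by (simp add: deval_eq_peval)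
next
  case (const c)
  then show ?case by (simp add: deval_eq_peval)
next
  case (var i)
  then show ?case by (simp add: pole_jet_Suc pert_jet_Suc)
next
  case (add w p q)
  then show ?case by (simp add: dz_add deval_simps ddir_simps algebra_simps)
next
  case (mult w w' p q)
  then show ?case by (simp add: dz_mult deval_simps ddir_simps) (simp add: algebra_simps)
qed

text \<open>For \<open>x = k (k + 1) / 2 * z\<^sup>-\<^sup>2\<close>, \<open>L\<^sub>n[x]\<close> is \<open>lead k n * z\<^sup>-\<^sup>2\<^sup>n\<close>, and its first variation in the
  direction \<open>z powi (\<rho> - 2)\<close> is \<open>lin k \<rho> n * z powi (\<rho> - 2 * n)\<close>.\<close>

definition lead :: "nat \<Rightarrow> nat \<Rightarrow> complex" where
  "lead k n = deval (pole_jet k) (lenard n)"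

definition lin :: "nat \<Rightarrow> complex \<Rightarrow> nat \<Rightarrow> complex" where
  "lin k \<rho> n = ddir (pole_jet k) (pert_jet \<rho>) (lenard n)"

text \<open>At the leading term, \<open>K\<close> sends \<open>z powi s\<close> to
  \<open>indicial k s * z powi (s - 3)\<close>. The root \<open>- 2 k\<close> will bound pole
  orders, the root 1 will govern odd powers.\<close>

definition indicial :: "nat \<Rightarrow> complex \<Rightarrow> complex" where
  "indicial k s = (s - 1) * (s + 2 * of_nat k) * (s - 2 * of_nat k - 2)"

lemma lead_0 [simp]: "lead k 0 = 1"
  by (simp add: lead_def)

lemma lin_0 [simp]: "lin k \<rho> 0 = 0"
  by (simp add: lin_def)

lemma lead_Suc_aux:
  fixes n :: nat
  defines "w \<equiv> of_nat (2 * n) :: complex"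
  shows "- (w + 2) * lead k (Suc n) = (- (w + 2) * (- (w + 1)) * (- w) + 16 * half_tri k * of_nat n + 8 * half_tri k) * lead k n"
    and "(\<rho> - w - 2) * lin k \<rho> (Suc n)
      = ((\<rho> - w - 2) * (\<rho> - w - 1) * (\<rho> - w) - 8 * half_tri k * (\<rho> - w) + 8 * half_tri k) * lin k \<rho> n
        + (8 * w - 4 * (\<rho> - 2)) * lead k n"
proof -
  let ?L = "lenard n"
  note h0 = homog_lenard[of n]
  note h1 = homog_dz[OF h0] 
  note h2 = homog_dz[OF h1]
  note h = homog_lenard[of "Suc n"]
  have j: "pole_jet k 0 = half_tri k" "pole_jet k (Suc 0) = - 2 * half_tri k"
    "pert_jet \<rho> 0 = 1" "pert_jet \<rho> (Suc 0) = \<rho> - 2"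
    by (simp_all add: pole_jet_def pert_jet_def)
  note d = ddir_dz_homog[where k = k and \<rho> = \<rho>]
  have "deval (pole_jet k) (dz (lenard (Suc n))) = deval (pole_jet k) (lenard_op ?L)"
    "ddir (pole_jet k) (pert_jet \<rho>) (dz (lenard (Suc n))) = ddir (pole_jet k) (pert_jet \<rho>) (lenard_op ?L)"
    by (simp_all only: dz_lenard_Suc)
  then show "- (w + 2) * lead k (Suc n) = (- (w + 2) * (- (w + 1)) * (- w) + 16 * half_tri k * of_nat n + 8 * half_tri k) * lead k n"
    and "(\<rho> - w - 2) * lin k \<rho> (Suc n)
      = ((\<rho> - w - 2) * (\<rho> - w - 1) * (\<rho> - w) - 8 * half_tri k * (\<rho> - w) + 8 * half_tri k) * lin k \<rho> n
        + (8 * w - 4 * (\<rho> - 2)) * lead k n"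
    unfolding lenard_op_def deval_simps ddir_simps
    by (simp_all add: d[OF h0, THEN conjunct1] d[OF h1, THEN conjunct1] d[OF h2, THEN conjunct1]
        d[OF h, THEN conjunct1] d[OF h0, THEN conjunct2] d[OF h1, THEN conjunct2] d[OF h2, THEN conjunct2]
        d[OF h, THEN conjunct2] j lead_def lin_def w_def algebra_simps)
qed

lemma lead_Suc:
  "(of_nat n + 1) * lead k (Suc n)
    = - 2 * (2 * of_nat n + 1) * (of_nat k - of_nat n) * (of_nat k + of_nat n + 1) * lead k n"
proof -
  have "2 * ((of_nat n + 1) * lead k (Suc n)
    + 2 * (2 * of_nat n + 1) * (of_nat k - of_nat n) * (of_nat k + of_nat n + 1) * lead k n) = 0"
    using lead_Suc_aux(1)[of n k] by (simp add: half_tri_def) (simp add: field_simps power2_eq_square)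
  then have "(of_nat n + 1) * lead k (Suc n)
    + 2 * (2 * of_nat n + 1) * (of_nat k - of_nat n) * (of_nat k + of_nat n + 1) * lead k n = 0"
    by (simp only: mult_eq_0_iff) simp
  then have "(of_nat n + 1) * lead k (Suc n)
    = - (2 * (2 * of_nat n + 1) * (of_nat k - of_nat n) * (of_nat k + of_nat n + 1) * lead k n)"
    by (simp only: eq_neg_iff_add_eq_0)
  then show ?thesis by (simp only: mult_minus_left)
qed

lemma lin_Suc:
  "(\<rho> - 2 * of_nat n - 2) * lin k \<rho> (Suc n)
    = indicial k (\<rho> - 2 * of_nat n) * lin k \<rho> n + 4 * (4 * of_nat n - \<rho> + 2) * lead k n"
  using lead_Suc_aux(2)[of \<rho> n k] by (simp add: half_tri_def indicial_def) (simp add: field_simps)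

text \<open>The factor \<open>of_nat k - of_nat n\<close> of \<open>lead_Suc\<close> vanishes at
  \<open>n = k\<close>, and the recursion carries the zero on.\<close>

lemma lead_eq_0:
  assumes "k < n"
  shows "lead k n = 0"
  using assms
proof (induction n)
  case (Suc n)
  have "(of_nat n + 1) * lead k (Suc n) = 0"
    using Suc lead_Suc[of n k] by (cases "k = n") auto
  moreover have "of_nat n + 1 \<noteq> (0 :: complex)"
    by (metis of_nat_Suc of_nat_neq_0 add.commute)
  ultimately show ?case by simp
qed simp

lemma lead_neq_0: "n \<le> k \<Longrightarrow> lead k n \<noteq> 0"
proof (induction n)
  case (Suc n)
  have "2 * of_nat n + 1 \<noteq> (0 :: complex)" "of_nat k + of_nat n + 1 \<noteq> (0 :: complex)"
    using of_nat_neq_0[of "2 * n", where ?'a = complex] of_nat_neq_0[of "k + n", where ?'a = complex]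
    by (simp_all add: add_ac)
  moreover have "of_nat k - of_nat n \<noteq> (0 :: complex)"
    using Suc by auto
  moreover have "(- 2 :: complex) \<noteq> 0" "lead k n \<noteq> 0"
    using Suc by auto
  ultimately have "- 2 * (2 * of_nat n + 1) * (of_nat k - of_nat n) * (of_nat k + of_nat n + 1) * lead k n \<noteq> 0"
    by (simp only: mult_eq_0_iff de_Morgan_disj simp_thms)
  then show ?case
    unfolding lead_Suc[symmetric] by auto
qed simp

text \<open>At \<open>x = k (k + 1) / 2 * z\<^sup>-\<^sup>2\<close>, the variation \<open>z\<^sup>-\<^sup>2\<^sup>i\<^sup>-\<^sup>1\<close> of \<open>x\<close> is a multiple of \<open>L\<^sub>i'\<close>, the \<open>i\<close>-th flow
  of the KdV hierarchy, under which \<open>L\<^sub>n\<close> varies by a sum of Wronskians \<open>L\<^sub>j L\<^sub>l' - L\<^sub>j' L\<^sub>l\<close> with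
  \<open>j < i\<close> and \<open>j + l = n + i - 1\<close>.\<close>

definition flow :: "nat \<Rightarrow> nat \<Rightarrow> nat \<Rightarrow> complex" where
  "flow k i n = (\<Sum>j<i. lead k j * lead k (n + i - 1 - j) * (4 * of_nat j - 2 * of_nat (n + i - 1)))"

text \<open>The reflection of \<open>j\<close> to \<open>i - 1 - j\<close> changes the sign of each
  summand.\<close>

lemma flow_0: "flow k i 0 = 0"
proof -
  let ?f = "\<lambda>j. lead k j * lead k (i - 1 - j) * (4 * of_nat j - 2 * of_nat (i - 1))"
  have "flow k i 0 = (\<Sum>j<i. ?f (i - Suc j))"
    unfolding flow_def by (subst sum.nat_diff_reindex) simp
  also have "\<dots> = (\<Sum>j<i. - ?f j)"
  proof (intro sum.cong refl)
    fix j assume "j \<in> {..<i}"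
    then obtain l where "i = Suc (j + l)"
      by (auto dest: less_imp_Suc_add)
    then show "?f (i - Suc j) = - ?f j"
      by (simp add: algebra_simps)
  qed
  also have "\<dots> = - flow k i 0"
    by (simp add: flow_def sum_negf)
  finally show ?thesis by (simp add: eq_neg_iff_add_eq_0)
qed

text \<open>A single Wronskian satisfies the homogeneous part of \<open>lin_Suc\<close> only up to a
  difference of two values of \<open>T\<close>. Their indices have the same sum
  \<open>j + M + 1\<close>, so the error telescopes in \<open>j\<close>.\<close>

lemma flow_Suc_telescope:
  fixes j M k :: nat
  defines "N \<equiv> of_nat (j + M) :: complex"
  defines "T \<equiv> (\<lambda>j l. lead k j * lead k l * (8 * of_nat j * of_nat l + 2 * of_nat j * (2 * of_nat j + 1)) :: complex)"
  shows "indicial k (- 2 * N - 1) * (lead k j * lead k M * (4 * of_nat j - 2 * N))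
      + (2 * N + 3) * (lead k j * lead k (Suc M) * (4 * of_nat j - 2 * (N + 1)))
    = T j (Suc M) - T (Suc j) M"
proof -
  define a b a' b' where "a = lead k j" "b = lead k M" "a' = lead k (Suc j)" "b' = lead k (Suc M)"
  define J where "J = (of_nat j :: complex)"
  define M' where "M' = (of_nat M :: complex)"
  define K where "K = (of_nat k :: complex)"
  note defs = a_b_a'_b'_def J_def M'_def K_def
  have A: "(J + 1) * a' = - 2 * (2 * J + 1) * (K - J) * (K + J + 1) * a"
    and B: "(M' + 1) * b' = - 2 * (2 * M' + 1) * (K - M') * (K + M' + 1) * b"
    unfolding defs by (rule lead_Suc)+
  have N: "N = J + M'"
    by (simp add: N_def defs)
  \<comment> \<open>With \<open>T\<close> brought to the left, \<open>b'\<close> occurs with the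
    factor \<open>M' + 1\<close> and \<open>a'\<close> with \<open>J + 1\<close>. These are the
    products evaluated by \<open>lead_Suc\<close>; a polynomial identity remains.\<close>
  have "indicial k (- 2 * N - 1) * (a * b * (4 * J - 2 * N)) + (2 * N + 3) * (a * b' * (4 * J - 2 * (N + 1)))
      - (a * b' * (8 * J * (M' + 1) + 2 * J * (2 * J + 1))
        - a' * b * (8 * (J + 1) * M' + 2 * (J + 1) * (2 * (J + 1) + 1)))
    = indicial k (- 2 * N - 1) * (a * b * (2 * J - 2 * M')) - a * ((M' + 1) * b') * (2 * (2 * M' + 3) + 8 * J)
      + ((J + 1) * a') * b * (8 * M' + 2 * (2 * J + 3))"
    by (simp add: N algebra_simps)
  also have "\<dots> = 0"
    unfolding A B indicial_def N K_def[symmetric] by (simp add: algebra_simps)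
  finally show ?thesis
    unfolding T_def by (simp add: defs add_ac)
qed

text \<open>\<open>T 0\<close> vanishes, and \<open>T i\<close> is the inhomogeneous term of
  \<open>lin_Suc\<close> at \<open>\<rho> = 1 - 2 i\<close>, multiplied by
  \<open>i / 2 * lead k i\<close>. This multiplier is the coefficient of
  \<open>- L\<^sub>i' / 4\<close> at the leading term.\<close>

lemma flow_Suc:
  assumes "i \<ge> 1"
  shows "(1 - 2 * of_nat i - 2 * of_nat n - 2) * flow k i (Suc n)
    = indicial k (1 - 2 * of_nat i - 2 * of_nat n) * flow k i n
      + 4 * (4 * of_nat n - (1 - 2 * of_nat i) + 2) * (of_nat i / 2 * lead k i) * lead k n"
proof -
  obtain i' where i: "i = Suc i'"
    using assms by (cases i) auto
  define N where "N = (of_nat (n + i') :: complex)"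
  define T where "T = (\<lambda>j. lead k j * lead k (Suc (n + i') - j)
    * (8 * of_nat j * of_nat (Suc (n + i') - j) + 2 * of_nat j * (2 * of_nat j + 1)))"
  have "indicial k (- 2 * N - 1) * flow k i n + (2 * N + 3) * flow k i (Suc n)
    = (\<Sum>j<i. indicial k (- 2 * N - 1) * (lead k j * lead k (n + i' - j) * (4 * of_nat j - 2 * N))
      + (2 * N + 3) * (lead k j * lead k (Suc (n + i') - j) * (4 * of_nat j - 2 * (N + 1))))"
    by (simp add: flow_def i N_def sum.distrib sum_distrib_left del: sum.lessThan_Suc)
      (simp add: algebra_simps)?
  also have "\<dots> = (\<Sum>j<i. T j - T (Suc j))"
  proof (intro sum.cong refl)
    fix j assume "j \<in> {..<i}"
    then obtain l where l: "i' = j + l"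
      using i by (auto simp: less_Suc_eq_le dest: le_Suc_ex)
    have 1: "n + i' - j = n + l" "Suc (n + i') - j = Suc (n + l)" "Suc (n + i') - Suc j = n + l"
      using l by auto
    have 2: "N = of_nat (j + (n + l))"
      by (simp add: N_def l)
    show "indicial k (- 2 * N - 1) * (lead k j * lead k (n + i' - j) * (4 * of_nat j - 2 * N))
      + (2 * N + 3) * (lead k j * lead k (Suc (n + i') - j) * (4 * of_nat j - 2 * (N + 1))) = T j - T (Suc j)"
      unfolding T_def 1 2 by (rule flow_Suc_telescope)
  qed
  also have "\<dots> = T 0 - T i"
    by (rule sum_lessThan_telescope')
  also have "\<dots> = - (lead k i * lead k n * (8 * of_nat i * of_nat n + 2 * of_nat i * (2 * of_nat i + 1)))"
    by (simp add: T_def i)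
  finally have "indicial k (- 2 * N - 1) * flow k i n + (2 * N + 3) * flow k i (Suc n)
    = - (lead k i * lead k n * (8 * of_nat i * of_nat n + 2 * of_nat i * (2 * of_nat i + 1)))" .
  moreover have "- Y = X + C" if "X + Y = - C" for X Y C :: complex
    using that by (simp add: algebra_simps eq_neg_iff_add_eq_0 neg_eq_iff_add_eq_0)
  ultimately have "- ((2 * N + 3) * flow k i (Suc n)) = indicial k (- 2 * N - 1) * flow k i n
      + lead k i * lead k n * (8 * of_nat i * of_nat n + 2 * of_nat i * (2 * of_nat i + 1))"
    by blast
  moreover have "lead k i * lead k n * (8 * of_nat i * of_nat n + 2 * of_nat i * (2 * of_nat i + 1))
      = 4 * (4 * of_nat n - (1 - 2 * of_nat i) + 2) * (of_nat i / 2 * lead k i) * lead k n"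
    by (simp add: algebra_simps)
  moreover have "1 - 2 * of_nat i - 2 * of_nat n - 2 = - (2 * N + 3)"
    "1 - 2 * of_nat i - 2 * of_nat n = - 2 * N - 1"
    by (simp_all add: N_def i)
  ultimately show ?thesis
    by (simp only: mult_minus_left)
qed

text \<open>At \<open>\<rho> = 1 - 2 i\<close> the factor \<open>\<rho> - 2 n - 2\<close> is a
  negative odd number, so \<open>lin_Suc\<close> has only one solution, which is \<open>flow\<close>
  up to the multiplier. In \<open>flow k i (Suc m)\<close> each second factor is
  \<open>lead k (m + i - j)\<close> with \<open>j < i\<close>, beyond index
  \<open>k\<close>.\<close>

lemma lin_negative_exponent:
  assumes "1 \<le> i" "i \<le> k" "k \<le> m"
  shows "lin k (1 - 2 * of_nat i) (Suc m) = 0"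
proof -
  let ?\<rho> = "1 - 2 * of_nat i :: complex" and ?\<omega> = "of_nat i / 2 * lead k i"
  have "?\<omega> * lin k ?\<rho> n = flow k i n" for n
  proof (induction n)
    case (Suc n)
    have 1: "(?\<rho> - 2 * of_nat n - 2) * (?\<omega> * lin k ?\<rho> (Suc n)) = (?\<rho> - 2 * of_nat n - 2) * flow k i (Suc n)"
      using lin_Suc[of ?\<rho> n k] flow_Suc[OF assms(1), of n k]
      unfolding Suc[symmetric] by (simp add: algebra_simps) 
    have 2: "?\<rho> - 2 * of_nat n - 2 \<noteq> 0"
    proof -
      have "?\<rho> - 2 * of_nat n - 2 = - of_nat (Suc (2 * i + 2 * n))"
        by simp
      then show ?thesis
        by (metis neg_equal_0_iff_equal of_nat_neq_0)
    qed
    from 1 show ?case unfolding mult_left_cancel[OF 2] .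
  qed (simp add: flow_0)
  moreover have "flow k i (Suc m) = 0"
    unfolding flow_def using assms by (intro sum.neutral) (auto simp: lead_eq_0)
  moreover have "?\<omega> \<noteq> 0"
    using assms lead_neq_0[of i k] by auto
  ultimately show ?thesis
    by (metis mult_eq_0_iff)
qed

section \<open>Formal Laurent series\<close>

text \<open>The derivative of order \<open>i\<close> of \<open>\<Sum>\<^sub>n a\<^sub>n t\<^sup>n\<^sup>-\<^sup>2\<close> is \<open>t\<^sup>-\<^sup>i\<^sup>-\<^sup>2\<close> times the following power series.\<close>

definition jet_fps :: "(nat \<Rightarrow> complex) \<Rightarrow> nat \<Rightarrow> complex fps" where
  "jet_fps a i = Abs_fps (\<lambda>n. ffall (of_nat n - 2) i * a n)"

text \<open>This is \<open>L\<^sub>n[x]\<close> multiplied by \<open>t\<^sup>2\<^sup>n\<close>: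
  coefficient \<open>e\<close> belongs to the power \<open>e - 2 n\<close> of
  \<open>t\<close>.\<close>

definition len_fps :: "(nat \<Rightarrow> complex) \<Rightarrow> nat \<Rightarrow> complex fps" where
  "len_fps a n = peval fps_const (jet_fps a) (lenard n)"

lemma fps_nth_dz:
  assumes "homog w p"
  shows "fps_nth (peval fps_const (jet_fps a) (dz p)) n
    = (of_nat n - of_nat w) * fps_nth (peval fps_const (jet_fps a) p) n"
proof -
  have eq: "peval fps_const (jet_fps a) (dz p)
    = fps_X * fps_deriv (peval fps_const (jet_fps a) p) - of_nat w * peval fps_const (jet_fps a) p"
    using assms
  proof (induction rule: homog_induct)
    case (var i)
    show ?case
      by (rule fps_ext) (auto simp: jet_fps_def fps_of_nat[symmetric] algebra_simps)
  next
    case (mult w w' p q)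
    then show ?case
      by (simp add: eval_fps.peval_simps dz_mult) (simp add: algebra_simps)
  qed (simp_all add: eval_fps.peval_simps dz_add algebra_simps)
  show ?thesis
    unfolding eq by (simp add: fps_of_nat[symmetric] left_diff_distrib)
qed

lemma jet_fps_nth [simp]: "fps_nth (jet_fps a i) n = ffall (of_nat n - 2) i * a n"
  by (simp add: jet_fps_def)

lemma len_fps_0 [simp]: "len_fps a 0 = 1"
  by (simp add: len_fps_def)

lemma lenard_op_altdef:
  "lenard_op p = dz (dz (dz p)) - dconst 8 * (dvar 0 * dz p) - dconst 4 * (dz (dvar 0) * p)"
  by (simp add: lenard_op_def mult.assoc flip: numeral_eq_dconst)

text \<open>The coefficient of \<open>t powi (s - 3)\<close> in
  \<open>L\<^sub>n\<^sub>+\<^sub>1' = K L\<^sub>n\<close>. The leading term of \<open>x\<close>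
  makes up the indicial polynomial, its other terms the convolution.\<close>

lemma len_fps_Suc:
  fixes e n :: nat and a :: "nat \<Rightarrow> complex"
  defines "s \<equiv> of_nat e - 2 * of_nat n :: complex"
  assumes a0: "a 0 = half_tri k"
  shows "(s - 2) * fps_nth (len_fps a (Suc n)) e
    = indicial k s * fps_nth (len_fps a n) e
      - (\<Sum>l=1..e. (8 * s - 4 * of_nat l - 8) * (a l * fps_nth (len_fps a n) (e - l)))"
proof -
  let ?g = "fps_nth (len_fps a n)"
  note h0 = homog_lenard[of n]
  note h1 = homog_dz[OF h0]
  note h2 = homog_dz[OF h1]
  note h = homog_lenard[of "Suc n"]
  note d = fps_nth_dz[where a = a]
  have "(s - 2) * fps_nth (len_fps a (Suc n)) e = fps_nth (peval fps_const (jet_fps a) (lenard_op (lenard n))) e"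
    using d[OF h, of e] by (simp add: dz_lenard_Suc len_fps_def s_def algebra_simps)
  also have "\<dots> = s * (s - 1) * (s - 2) * ?g e
      - 8 * (\<Sum>l=0..e. a l * ((of_nat (e - l) - 2 * of_nat n) * ?g (e - l)))
      - 4 * (\<Sum>l=0..e. ((of_nat l - 2) * a l) * ?g (e - l))"
    unfolding lenard_op_altdef eval_fps.peval_simps eval_fps.peval_const fps_sub_nth
      fps_mult_left_const_nth fps_mult_nth[of "peval _ _ (dvar 0)"]
      fps_mult_nth[of "peval _ _ (dz (dvar 0))"]
    by (simp add: d[OF h0] d[OF h1] d[OF h2] len_fps_def s_def) (simp add: algebra_simps)
  also have "\<dots> = s * (s - 1) * (s - 2) * ?g e
      - (\<Sum>l=0..e. (8 * s - 4 * of_nat l - 8) * (a l * ?g (e - l)))"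
  proof -
    have "8 * (\<Sum>l=0..e. a l * ((of_nat (e - l) - 2 * of_nat n) * ?g (e - l)))
        + 4 * (\<Sum>l=0..e. ((of_nat l - 2) * a l) * ?g (e - l))
      = (\<Sum>l=0..e. (8 * s - 4 * of_nat l - 8) * (a l * ?g (e - l)))"
      unfolding sum_distrib_left sum.distrib[symmetric]
      by (intro sum.cong refl) (auto simp: s_def of_nat_diff algebra_simps)
    then show ?thesis by (simp add: algebra_simps)
  qed
  also have "(\<Sum>l=0..e. (8 * s - 4 * of_nat l - 8) * (a l * ?g (e - l)))
      = (8 * s - 8) * (half_tri k * ?g e) + (\<Sum>l=1..e. (8 * s - 4 * of_nat l - 8) * (a l * ?g (e - l)))"
    by (subst sum.atLeast_Suc_atMost) (auto simp: a0)
  finally show ?thesis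
    by (simp add: indicial_def half_tri_def) (simp add: field_simps)
qed

text \<open>The trivial monodromy condition of Duistermaat and Gruenbaum for the Schroedinger operator with
  potential \<open>2 x\<close>.\<close>

definition no_log :: "nat \<Rightarrow> (nat \<Rightarrow> complex) \<Rightarrow> bool" where
  "no_log k a \<longleftrightarrow> a 0 = half_tri k \<and> (\<forall>l\<le>2 * k + 1. odd l \<longrightarrow> a l = 0)"

text \<open>At the one new order that the induction hypothesis does not reach, the indicial
  polynomial vanishes: at \<open>s = - 2 k\<close> for the pole order and at \<open>s = 1\<close>
  for the odd powers. In the convolution, even \<open>l\<close> preserve parity, odd
  \<open>l \<le> 2 k + 1\<close> have \<open>a l = 0\<close>, and larger odd \<open>l\<close> lead
  beyond the pole bound.\<close>

lemma len_fps_eq_0: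
  assumes k: "k \<ge> 1" and a: "no_log k a"
  shows "(e + 2 * k < 2 * n \<longrightarrow> fps_nth (len_fps a n) e = 0)
    \<and> (odd e \<and> e < 2 * n \<longrightarrow> fps_nth (len_fps a n) e = 0)"
proof (induction n arbitrary: e)
  case 0
  then show ?case by simp
next
  case (Suc n)
  define s where "s = (of_nat e - 2 * of_nat n :: complex)"
  have a0: "a 0 = half_tri k" and a_odd: "a l = 0" if "odd l" "l \<le> 2 * k + 1" for l
    using a that by (auto simp: no_log_def)
  have rec: "(s - 2) * fps_nth (len_fps a (Suc n)) e
    = indicial k s * fps_nth (len_fps a n) e
      - (\<Sum>l=1..e. (8 * s - 4 * of_nat l - 8) * (a l * fps_nth (len_fps a n) (e - l)))"
    unfolding s_def using a by (intro len_fps_Suc) (simp add: no_log_def)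
  \<comment> \<open>The exception is the constant term of
    \<open>L\<^sub>n\<^sub>+\<^sub>1[x]\<close>, which differentiation loses; neither claim concerns
    it.\<close>
  have s2: "s - 2 \<noteq> 0" if "e \<noteq> 2 * n + 2"
  proof
    assume "s - 2 = 0"
    then have "of_nat e = (of_nat (2 * n + 2) :: complex)"
      by (simp add: s_def algebra_simps)
    then show False
      using that by (simp only: of_nat_eq_iff)
  qed
  show ?case
  proof (intro conjI impI)
    assume e: "e + 2 * k < 2 * Suc n"
    have "indicial k s * fps_nth (len_fps a n) e = 0"
    proof -
      have "e + 2 * k < 2 * n \<or> e + 2 * k = 2 * n \<or> e + 2 * k = 2 * n + 1"
        using e by arith
      then consider "e + 2 * k < 2 * n" | "e + 2 * k = 2 * n" | "e + 2 * k = 2 * n + 1"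
        by blast
      then show ?thesis
      proof cases
        case 2
        then have "of_nat (e + 2 * k) = (of_nat (2 * n) :: complex)" by simp
        then have "s + 2 * of_nat k = 0"
          by (simp add: s_def algebra_simps)
        then show ?thesis by (simp add: indicial_def)
      next
        \<comment> \<open>One order above the pole bound for \<open>n\<close> the indicial factor
          need not vanish, but this order is odd and, as \<open>k \<ge> 1\<close>, below
          \<open>2 n\<close>: the parity claim applies.\<close>
        case 3
        then have "odd e" "e < 2 * n" using k by presburger+
        then show ?thesis using Suc.IH by simp
      qed (use Suc.IH in simp)
    qed
    moreover have "(8 * s - 4 * of_nat l - 8) * (a l * fps_nth (len_fps a n) (e - l)) = 0" if "l \<in> {1..e}" for l
    proof (cases "l = 1")
      case False
      then have "e - l + 2 * k < 2 * n" using that e by auto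
      then show ?thesis using Suc.IH by simp
    qed (simp add: a_odd)
    ultimately have "(s - 2) * fps_nth (len_fps a (Suc n)) e = 0"
      unfolding rec by (subst sum.neutral) auto
    then show "fps_nth (len_fps a (Suc n)) e = 0"
      using s2 e k by auto
  next
    assume e: "odd e \<and> e < 2 * Suc n"
    have "indicial k s * fps_nth (len_fps a n) e = 0"
    proof (cases "e = 2 * n + 1")
      case True
      then have "s = 1" by (simp add: s_def)
      then show ?thesis by (simp add: indicial_def)
    next
      case False
      then have "e < 2 * n" using e by presburger
      then show ?thesis using Suc.IH e by simp
    qed
    moreover have "(8 * s - 4 * of_nat l - 8) * (a l * fps_nth (len_fps a n) (e - l)) = 0" if "l \<in> {1..e}" for l
    proof (cases "odd l")
      case True
      show ?thesis
      proof (cases "l \<le> 2 * k + 1")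
        case False
        then have "e - l + 2 * k < 2 * n"
          using that e True by presburger
        then show ?thesis using Suc.IH by simp
      qed (simp add: a_odd True)
    next
      case False
      then have "odd (e - l) \<and> e - l < 2 * n"
        using that e unfolding atLeastAtMost_iff by presburger
      then show ?thesis using Suc.IH by simp
    qed
    ultimately have "(s - 2) * fps_nth (len_fps a (Suc n)) e = 0"
      unfolding rec by (subst sum.neutral) auto
    moreover have "e \<noteq> 2 * n + 2" using e by auto
    ultimately show "fps_nth (len_fps a (Suc n)) e = 0"
      using s2 by auto
  qed
qed

text \<open>The operator \<open>lenard_op\<close> is skew-adjoint, so \<open>L\<^sub>i' L\<^sub>j\<close> is a total derivative.\<close>

lemma lenard_op_skew:
  "p * lenard_op q + q * lenard_op p
    = dz (p * dz (dz q) + dz (dz p) * q - dz p * dz q - 8 * (dvar 0 * (p * q)))"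
  by (simp add: lenard_op_def dz_diff dz_add dz_mult algebra_simps)

text \<open>Skew-adjointness transfers one application of \<open>K\<close>:
  \<open>L\<^sub>i\<^sub>+\<^sub>1' L\<^sub>j\<close> and
  \<open>L\<^sub>i' L\<^sub>j\<^sub>+\<^sub>1\<close> differ by a total derivative. The descent ends
  at \<open>L\<^sub>0' = 0\<close>.\<close>

lemma dz_lenard_mult_lenard: "\<exists>q. homog (2 * i + 2 * j) q \<and> dz q = dz (lenard i) * lenard j"
proof (induction i arbitrary: j)
  case 0
  then show ?case by (auto intro!: exI[of _ 0])
next
  case (Suc i)
  obtain q where q: "homog (2 * i + 2 * Suc j) q" "dz q = dz (lenard i) * lenard (Suc j)"
    using Suc by blast
  let ?p = "lenard i" and ?r = "lenard j"
  define b where "b = ?p * dz (dz ?r) + dz (dz ?p) * ?r - dz ?p * dz ?r - 8 * (dvar 0 * (?p * ?r))"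
  have hom: "homog (2 * Suc i + 2 * j) b" "homog (2 * Suc i + 2 * j) (?p * lenard (Suc j))"
    "homog (2 * Suc i + 2 * j) q"
  proof -
    note hp = homog_lenard[of i] and hr = homog_lenard[of j]
    have "homog (2 * Suc i + 2 * j) (?p * dz (dz ?r))"
      using homog_mult[OF hp homog_dz[OF homog_dz[OF hr]]] by simp
    moreover have "homog (2 * Suc i + 2 * j) (dz (dz ?p) * ?r)"
      using homog_mult[OF homog_dz[OF homog_dz[OF hp]] hr] by simp
    moreover have "homog (2 * Suc i + 2 * j) (dz ?p * dz ?r)"
      using homog_mult[OF homog_dz[OF hp] homog_dz[OF hr]] by simp
    moreover have "homog (2 * Suc i + 2 * j) (8 * (dvar 0 * (?p * ?r)))"
      using homog_numeral_mult[OF homog_mult[OF homog_dvar[of 0] homog_mult[OF hp hr]]] by simp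
    ultimately show "homog (2 * Suc i + 2 * j) b"
      unfolding b_def by (intro homog_diff homog_add)
    show "homog (2 * Suc i + 2 * j) (?p * lenard (Suc j))"
      using homog_mult[OF hp homog_lenard[of "Suc j"]] by simp
    show "homog (2 * Suc i + 2 * j) q"
      using q(1) by simp
  qed
  have "dz (lenard (Suc i)) * ?r = dz b - ?p * lenard_op ?r"
    unfolding b_def lenard_op_skew[symmetric] by (simp add: dz_lenard_Suc mult.commute)
  also have "\<dots> = dz (b - (?p * lenard (Suc j) - q))"
    by (simp add: dz_diff dz_mult q(2) dz_lenard_Suc)
  finally show ?case
    using hom by (intro exI[of _ "b - (?p * lenard (Suc j) - q)"]) (auto intro!: homog_diff)
qed

text \<open>With the normalisation of \<open>len_fps\<close>, coefficient \<open>2 i + 2 j\<close>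
  of \<open>L\<^sub>i' L\<^sub>j\<close> belongs to \<open>1 / t\<close>, and a derivative has no
  residue.\<close>

lemma residue_dz_lenard_mult_lenard:
  "(\<Sum>l=0..2*i+2*j. (of_nat l - of_nat (2 * i)) * fps_nth (len_fps a i) l * fps_nth (len_fps a j) (2*i+2*j-l)) = 0"
proof -
  obtain q where q: "homog (2 * i + 2 * j) q" "dz q = dz (lenard i) * lenard j"
    using dz_lenard_mult_lenard by blast
  have "fps_nth (peval fps_const (jet_fps a) (dz q)) (2 * i + 2 * j) = 0"
    unfolding fps_nth_dz[OF q(1)] by simp
  then show ?thesis
    unfolding q(2) eval_fps.peval_mult fps_mult_nth fps_nth_dz[OF homog_lenard] len_fps_def
    by (simp add: mult.assoc)
qed

lemma len_fps_nth_0: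
  assumes "a 0 = half_tri k"
  shows "fps_nth (len_fps a n) 0 = lead k n"
  unfolding len_fps_def peval_fps_nth_0 lead_def
  by (rule arg_cong[where f = "\<lambda>v. deval v _"]) (simp add: fun_eq_iff pole_jet_def assms)

text \<open>The hypothesis says \<open>L\<^sub>m\<^sub>+\<^sub>1[x] = b + b' t + g t\<^sup>2\<^sup>i + \<dots>\<close>. Since \<open>L\<^sub>i[x]\<close> has no odd negative powers, the
  residue of \<open>L\<^sub>i' L\<^sub>m\<^sub>+\<^sub>1\<close> is \<open>g\<close> times a nonzero constant.\<close>

lemma len_fps_compatible:
  assumes k: "k \<ge> 1" and a: "no_log k a" and i: "1 \<le> i" "i \<le> k"
    and low: "\<And>l. l < 2 * m + 2 + 2 * i \<Longrightarrow> l \<noteq> 2 * m + 2 \<Longrightarrow> l \<noteq> 2 * m + 3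
      \<Longrightarrow> fps_nth (len_fps a (Suc m)) l = 0"
  shows "fps_nth (len_fps a (Suc m)) (2 * m + 2 + 2 * i) = 0"
proof -
  let ?N = "2 * i + 2 * Suc m" and ?G = "fps_nth (len_fps a (Suc m))"
  have a0: "a 0 = half_tri k" using a by (simp add: no_log_def)
  have "0 = (\<Sum>l=0..?N. (of_nat l - of_nat (2 * i)) * fps_nth (len_fps a i) l * ?G (?N - l))"
    using residue_dz_lenard_mult_lenard[where i = i and j = "Suc m" and a = a] by simp
  also have "\<dots> = (of_nat 0 - of_nat (2 * i)) * fps_nth (len_fps a i) 0 * ?G ?N
      + (\<Sum>l=1..?N. (of_nat l - of_nat (2 * i)) * fps_nth (len_fps a i) l * ?G (?N - l))"
    by (subst sum.atLeast_Suc_atMost) auto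
  also have "(\<Sum>l=1..?N. (of_nat l - of_nat (2 * i)) * fps_nth (len_fps a i) l * ?G (?N - l)) = 0"
  proof (intro sum.neutral ballI)
    fix l assume l: "l \<in> {1..?N}"
    \<comment> \<open>The coefficients \<open>2 m + 2\<close> and \<open>2 m + 3\<close> of
      \<open>L\<^sub>m\<^sub>+\<^sub>1\<close>, which may be nonzero, meet \<open>l = 2 i\<close>
      and \<open>l = 2 i - 1\<close>. The former is the constant term of \<open>L\<^sub>i\<close>,
      removed by the derivative; the latter is an odd negative power.\<close>
    consider "l = 2 * i" | "l = 2 * i - 1" | "?N - l \<noteq> 2 * m + 2" "?N - l \<noteq> 2 * m + 3"
      using l i by force
    then show "(of_nat l - of_nat (2 * i)) * fps_nth (len_fps a i) l * ?G (?N - l) = 0"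
    proof cases
      case 2
      then have "odd l" "l < 2 * i" using i by auto
      then show ?thesis using len_fps_eq_0[OF k a] by simp
    next
      case 3
      moreover have "?N - l < 2 * m + 2 + 2 * i"
        using l i by auto
      ultimately show ?thesis using low[of "?N - l"] by simp
    qed simp
  qed
  finally have "(2 * of_nat i) * lead k i * ?G ?N = 0"
    by (simp add: len_fps_nth_0[where a = a and k = k, OF a0])
  then show ?thesis
    using lead_neq_0[OF i(2)] i by (simp add: add.commute)
qed

section \<open>Kovalevskaya exponents\<close>

definition trunc :: "nat \<Rightarrow> (nat \<Rightarrow> complex) \<Rightarrow> nat \<Rightarrow> complex" where
  "trunc n a l = (if l < n then a l else 0)"

text \<open>\<open>a\<close> and its truncation differ from order \<open>n\<close> on, so
  \<open>peval_fps_taylor\<close> isolates \<open>a n\<close>. For \<open>N = m + 1\<close> this is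
  the splitting \<open>\<chi>(n) a\<^sub>n + Q\<close>, with
  \<open>\<chi>(n) = lin k (of_nat n) (Suc m)\<close>.\<close>

lemma len_fps_nth_split:
  assumes a0: "a 0 = half_tri k" and n: "n \<ge> 1"
  shows "fps_nth (len_fps a N) n = fps_nth (len_fps (trunc n a) N) n + lin k (of_nat n) N * a n"
proof -
  have "fps_nth (peval fps_const (jet_fps a) (lenard N)) n
    = fps_nth (peval fps_const (jet_fps (trunc n a)) (lenard N)) n
      + ddir (\<lambda>i. fps_nth (jet_fps a i) 0) (\<lambda>i. fps_nth (jet_fps a i) n - fps_nth (jet_fps (trunc n a) i) n) (lenard N)"
    using peval_fps_taylor[OF n, of "jet_fps a" "jet_fps (trunc n a)"] by (simp add: trunc_def)
  also have "(\<lambda>i. fps_nth (jet_fps a i) 0) = pole_jet k"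
    by (simp add: fun_eq_iff pole_jet_def a0)
  also have "(\<lambda>i. fps_nth (jet_fps a i) n - fps_nth (jet_fps (trunc n a) i) n) = (\<lambda>i. a n * pert_jet (of_nat n) i)"
    by (simp add: fun_eq_iff pert_jet_def trunc_def)
  finally show ?thesis
    by (simp add: len_fps_def lin_def ddir_scale_dir)
qed

lemma len_fps_nth_cong:
  assumes "\<And>l. l \<le> n \<Longrightarrow> a l = b l"
  shows "fps_nth (len_fps a N) n = fps_nth (len_fps b N) n"
  using peval_fps_taylor[of "Suc n" "jet_fps a" "jet_fps b" "lenard N"] assms
  by (simp add: len_fps_def)

lemma len_fps_pole:
  assumes "n \<ge> 1" "\<And>l. 1 \<le> l \<Longrightarrow> l \<le> n \<Longrightarrow> a l = 0"
  shows "fps_nth (len_fps a N) n = 0"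
proof -
  have const: "peval fps_const (\<lambda>i. fps_const (v i)) p = fps_const (deval v p)" for v p
    by (induction p rule: diff_poly_induct) (simp_all add: eval_fps.peval_simps deval_simps)
  define b where "b = (\<lambda>l::nat. if l = 0 then a 0 else 0)"
  have "jet_fps b = (\<lambda>i. fps_const (ffall (- 2) i * a 0))"
    by (rule ext, rule fps_ext) (auto simp: b_def)
  then have "fps_nth (len_fps b N) n = 0"
    using assms(1) by (simp add: len_fps_def const)
  moreover have "fps_nth (len_fps a N) n = fps_nth (len_fps b N) n"
    using assms by (intro len_fps_nth_cong) (auto simp: b_def)
  ultimately show ?thesis by simp
qed

text \<open>The three families are the orders controlled by the pole bound, by the absence of odd
  negative powers and by the residue, in this order.\<close>

definition resonances :: "nat \<Rightarrow> nat \<Rightarrow> nat set" where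
  "resonances m k = (\<lambda>i. 2 * i) ` {1..m - k} \<union> (\<lambda>i. 2 * k + 1 + 2 * i) ` {1..m - k}
    \<union> (\<lambda>i. 2 * m + 2 + 2 * i) ` {1..k}"

lemma lin_resonance:
  assumes k: "1 \<le> k" "k \<le> m" and n: "n \<in> resonances m k"
  shows "lin k (of_nat n) (Suc m) = 0"
proof -
  define a where "a = (\<lambda>l. if l = 0 then half_tri k else if l = n then 1 else 0)"
  have n1: "n \<ge> 1" using n by (auto simp: resonances_def)
  \<comment> \<open>The odd resonances start at \<open>2 k + 3\<close>, so the perturbation is
    compatible with \<open>no_log\<close>.\<close>
  have a: "no_log k a"
    using n by (auto simp: resonances_def no_log_def a_def)
  have low: "fps_nth (len_fps a (Suc m)) l = 0" if "l < n" for l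
  proof (cases "l = 0")
    case True
    have "a 0 = half_tri k" by (simp add: a_def)
    from len_fps_nth_0[where k = k and a = a and n = "Suc m", OF this] show ?thesis
      using k True by (simp add: lead_eq_0)
  next
    case False
    then show ?thesis using that by (intro len_fps_pole) (auto simp: a_def)
  qed
  have "fps_nth (len_fps a (Suc m)) n = fps_nth (len_fps (trunc n a) (Suc m)) n + lin k (of_nat n) (Suc m) * a n"
    using n1 by (intro len_fps_nth_split) (auto simp: a_def)
  moreover have "fps_nth (len_fps (trunc n a) (Suc m)) n = 0"
    using n1 by (intro len_fps_pole) (auto simp: a_def trunc_def)
  moreover have "fps_nth (len_fps a (Suc m)) n = 0"
  proof -
    consider i where "n = 2 * i" "i \<in> {1..m - k}" | i where "n = 2 * k + 1 + 2 * i" "i \<in> {1..m - k}"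
      | i where "n = 2 * m + 2 + 2 * i" "i \<in> {1..k}"
      using n by (auto simp: resonances_def)
    then show ?thesis
    proof cases
      case 1
      then have "n + 2 * k < 2 * Suc m" using k by auto
      then show ?thesis using len_fps_eq_0[OF k(1) a] by blast
    next
      case 2
      then have "odd n \<and> n < 2 * Suc m" using k by auto
      then show ?thesis using len_fps_eq_0[OF k(1) a] by blast
    next
      case 3
      then show ?thesis using len_fps_compatible[OF k(1) a, of i m] low by simp
    qed
  qed
  ultimately show ?thesis using n1 by (simp add: a_def)
qed

lemma leading_coeff_Suc: "leading_coeff k (Suc i) = pole_jet k i"
proof (induction i)
  case (Suc i)
  define H where "H = (1 / 2 * of_nat k * (of_nat k + 1) :: complex)"
  have "leading_coeff k (Suc (Suc i)) = - of_nat (i + 2) * leading_coeff k (Suc i)"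
    unfolding leading_coeff_def H_def[symmetric] by (simp add: algebra_simps)
  then show ?case
    using Suc by (simp only: pole_jet_Suc)
qed (simp add: leading_coeff_def pole_jet_def half_tri_def)

lemma deriv_fA_shift:
  assumes "Suc i < 2 * m"
  shows "deriv (\<lambda>t. fA m (Suc i) (c(Suc l := t))) (c (Suc l)) = (if l = Suc i then 1 else 0)"
  using assms by (auto simp: fA_def)

lemma deriv_fA_last:
  assumes "Suc i = 2 * m"
  shows "deriv (\<lambda>t. fA m (Suc i) (c(Suc l := t))) (c (Suc l))
    = ddir (\<lambda>j. c (Suc j)) (unit_dir l) (painleve_poly m)"
proof -
  have "((\<lambda>t. deval (\<lambda>j. (c(Suc l := t)) (Suc j)) (painleve_poly m)) has_field_derivative
      ddir (\<lambda>j. (c(Suc l := c (Suc l))) (Suc j)) (unit_dir l) (painleve_poly m)) (at (c (Suc l)))"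
    by (rule has_field_derivative_deval) (auto simp: unit_dir_def)
  then show ?thesis
    using assms by (simp add: fA_def DERIV_imp_deriv)
qed

text \<open>The jet \<open>pert_jet \<rho>\<close>, with first entry 1, is an eigenvector: all rows
  but the last express \<open>pert_jet_Suc\<close>, and the last one is the hypothesis, as
  \<open>lenard (Suc m)\<close> is 4 times \<open>painleve_poly m - dvar (2 * m)\<close>.\<close>

lemma eigenvalue_kovalevskaya_matrix:
  assumes m: "m \<ge> 1" and lin: "lin k \<rho> (Suc m) = 0"
  shows "eigenvalue (kovalevskaya_matrix m (leading_coeff k)) \<rho>"
proof -
  let ?A = "kovalevskaya_matrix m (leading_coeff k)"
  let ?c = "leading_coeff k"
  define v where "v = Matrix.vec (2 * m) (pert_jet \<rho>)"
  have A: "?A \<in> carrier_mat (2 * m) (2 * m)"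
    by (simp add: kovalevskaya_matrix_def)
  have row: "(\<Sum>l<2*m. (deriv (\<lambda>t. fA m (Suc i) (?c(Suc l := t))) (?c (Suc l))
      + (if i = l then of_nat (weight (Suc i)) else 0)) * pert_jet \<rho> l) = \<rho> * pert_jet \<rho> i"
    if i: "i < 2 * m" for i
  proof -
    have "(\<Sum>l<2*m. deriv (\<lambda>t. fA m (Suc i) (?c(Suc l := t))) (?c (Suc l)) * pert_jet \<rho> l)
      = pert_jet \<rho> (Suc i)"
    proof (cases "Suc i = 2 * m")
      case False
      then have "Suc i < 2 * m" using i by simp
      then show ?thesis
        by (simp add: deriv_fA_shift if_distrib[where f = "\<lambda>x. x * _"] cong: if_cong)
    next
      case True
      have "(\<Sum>l<2*m. deriv (\<lambda>t. fA m (Suc i) (?c(Suc l := t))) (?c (Suc l)) * pert_jet \<rho> l)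
        = ddir (\<lambda>j. ?c (Suc j)) (pert_jet \<rho>) (painleve_poly m)"
        unfolding deriv_fA_last[OF True] ddir_eq_sum_unit_dir[OF vars_below_painleve_poly, of _ "pert_jet \<rho>"]
        by (simp add: mult.commute)
      also have "\<dots> = pert_jet \<rho> (2 * m)"
        using lin by (simp add: painleve_poly_def ddir_simps leading_coeff_Suc lin_def)
      finally show ?thesis
        by (simp only: True)
    qed
    moreover have "(\<Sum>l<2*m. (if i = l then of_nat (weight (Suc i)) else 0) * pert_jet \<rho> l)
        = of_nat (i + 2) * pert_jet \<rho> i"
      using i by (simp add: weight_def if_distrib[where f = "\<lambda>x. x * _"] cong: if_cong)
    ultimately show ?thesis
      by (simp only: distrib_right sum.distrib pert_jet_Suc) (simp add: algebra_simps)
  qed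
  have "?A *\<^sub>v v = \<rho> \<cdot>\<^sub>v v"
  proof (rule eq_vecI)
    fix i assume "i < dim_vec (\<rho> \<cdot>\<^sub>v v)"
    then have i: "i < 2 * m" by (simp add: v_def)
    have "vec_index (?A *\<^sub>v v) i = (\<Sum>l<2*m. (deriv (\<lambda>t. fA m (Suc i) (?c(Suc l := t))) (?c (Suc l))
      + (if i = l then of_nat (weight (Suc i)) else 0)) * pert_jet \<rho> l)"
      using i by (simp add: kovalevskaya_matrix_def v_def scalar_prod_def lessThan_atLeast0)
    then show "vec_index (?A *\<^sub>v v) i = vec_index (\<rho> \<cdot>\<^sub>v v) i"
      using row[OF i] i by (simp add: v_def)
  qed (simp add: v_def kovalevskaya_matrix_def)
  moreover have "v \<noteq> 0\<^sub>v (2 * m)"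
  proof
    assume "v = 0\<^sub>v (2 * m)"
    then have "vec_index v 0 = vec_index (0\<^sub>v (2 * m)) 0" by simp
    then show False using m by (simp add: v_def pert_jet_def)
  qed
  moreover have "v \<in> carrier_vec (2 * m)" by (simp add: v_def)
  ultimately have "eigenvector ?A v \<rho>"
    using A by (simp add: eigenvector_def)
  then show ?thesis
    by (auto simp: eigenvalue_def)
qed

section \<open>Root count: the complete multiset of exponents\<close>

lemma proots_eq_mset_set:
  fixes p :: "complex poly"
  assumes "p \<noteq> 0" "finite S" "\<And>x. x \<in> S \<Longrightarrow> poly p x = 0" "degree p \<le> card S"
  shows "proots p = mset_set S"
proof -
  have "mset_set S \<subseteq># proots p"
    using assms by (intro mset_subset_eqI) (auto simp: count_mset_set' order_root Suc_le_eq)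
  moreover have "size (proots p) \<le> size (mset_set S)"
    using size_proots_le[of p] assms by simp
  ultimately show ?thesis
    by (metis mset_subset_size nat_less_le not_le subset_mset.le_less)
qed

definition exponents :: "nat \<Rightarrow> nat \<Rightarrow> complex set" where
  "exponents m k = of_nat ` resonances m k \<union> (\<lambda>i. - of_nat (2 * i - 1)) ` {1..k}"

lemma finite_resonances [simp]: "finite (resonances m k)"
  by (simp add: resonances_def)

lemma finite_exponents: "finite (exponents m k)"
  by (simp add: exponents_def)

lemma resonances_disjoint:
  fixes m k :: nat
  shows "(\<lambda>i. 2 * i) ` {1..m - k} \<inter> (\<lambda>i. 2 * k + 1 + 2 * i) ` {1..m - k} = {}"
    and "((\<lambda>i. 2 * i) ` {1..m - k} \<union> (\<lambda>i. 2 * k + 1 + 2 * i) ` {1..m - k})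
      \<inter> (\<lambda>i. 2 * m + 2 + 2 * i) ` {1..k} = {}"
proof -
  have "2 * i \<noteq> 2 * k + 1 + 2 * j" for i j :: nat by presburger
  then show "(\<lambda>i. 2 * i) ` {1..m - k} \<inter> (\<lambda>i. 2 * k + 1 + 2 * i) ` {1..m - k} = {}"
    by blast
  have "2 * i \<noteq> 2 * m + 2 + 2 * j" "2 * k + 1 + 2 * i \<noteq> 2 * m + 2 + 2 * j" if "i \<in> {1..m - k}" for i j
    using that by auto
  then show "((\<lambda>i. 2 * i) ` {1..m - k} \<union> (\<lambda>i. 2 * k + 1 + 2 * i) ` {1..m - k})
      \<inter> (\<lambda>i. 2 * m + 2 + 2 * i) ` {1..k} = {}"
    by blast
qed

lemma card_resonances:
  assumes "k \<le> m"
  shows "card (resonances m k) = 2 * m - k"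
proof -
  have "card (resonances m k) = card ((\<lambda>i. 2 * i) ` {1..m - k} \<union> (\<lambda>i. 2 * k + 1 + 2 * i) ` {1..m - k})
      + card ((\<lambda>i. 2 * m + 2 + 2 * i) ` {1..k})"
    unfolding resonances_def by (rule card_Un_disjoint[OF _ _ resonances_disjoint(2)]) auto
  also have "card ((\<lambda>i. 2 * i) ` {1..m - k} \<union> (\<lambda>i. 2 * k + 1 + 2 * i) ` {1..m - k})
      = card ((\<lambda>i. 2 * i) ` {1..m - k}) + card ((\<lambda>i. 2 * k + 1 + 2 * i) ` {1..m - k})"
    by (rule card_Un_disjoint[OF _ _ resonances_disjoint(1)]) auto
  finally show ?thesis
    using assms by (simp add: card_image inj_on_def)
qed

lemma neg_of_nat_eq_of_nat:
  "- of_nat a = (of_nat b :: complex) \<longleftrightarrow> a = 0 \<and> b = 0"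
proof -
  have "- of_nat a = (of_nat b :: complex) \<longleftrightarrow> of_nat (a + b) = (0 :: complex)"
    by (metis add.commute add.right_inverse minus_unique of_nat_add)
  then show ?thesis
    by (simp only: of_nat_eq_0_iff) simp
qed

lemma of_nat_notin_neg_odd: "of_nat n \<notin> (\<lambda>i. - of_nat (2 * i - 1) :: complex) ` {1..k}"
proof
  assume "of_nat n \<in> (\<lambda>i. - of_nat (2 * i - 1) :: complex) ` {1..k}"
  then obtain i where i: "i \<in> {1..k}" and "of_nat n = (- of_nat (2 * i - 1) :: complex)" ..
  then have "2 * i - 1 = 0"
    using neg_of_nat_eq_of_nat[of "2 * i - 1" n] by metis
  then show False using i by auto
qed

lemma exponents_disjoint: "of_nat ` resonances m k \<inter> (\<lambda>i. - of_nat (2 * i - 1)) ` {1..k} = ({} :: complex set)"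
  using of_nat_notin_neg_odd by blast

lemma inj_on_neg_odd: "inj_on (\<lambda>i. - of_nat (2 * i - 1) :: complex) {1..k}"
proof (rule inj_onI)
  fix i j assume "i \<in> {1..k}" "j \<in> {1..k}" "- of_nat (2 * i - 1) = (- of_nat (2 * j - 1) :: complex)"
  then have "2 * i - 1 = 2 * j - 1"
    by (metis neg_equal_iff_equal of_nat_eq_iff)
  then show "i = j"
    using \<open>i \<in> {1..k}\<close> \<open>j \<in> {1..k}\<close> by auto
qed

lemma card_exponents:
  assumes "k \<le> m"
  shows "card (exponents m k) = 2 * m"
proof -
  have "card (exponents m k) = card (of_nat ` resonances m k :: complex set) + card ((\<lambda>i. - of_nat (2 * i - 1) :: complex) ` {1..k})"
    unfolding exponents_def by (rule card_Un_disjoint[OF _ _ exponents_disjoint]) auto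
  also have "\<dots> = card (resonances m k) + k"
    unfolding card_image[OF inj_on_neg_odd] card_image[OF inj_on_of_nat] by simp
  finally show ?thesis
    using assms by (simp add: card_resonances)
qed

lemma kovalevskaya_exponents_eq_mset_set:
  assumes k: "1 \<le> k" "k \<le> m"
  shows "kovalevskaya_exponents m k = mset_set (exponents m k)"
proof -
  let ?A = "kovalevskaya_matrix m (leading_coeff k)"
  have A: "?A \<in> carrier_mat (2 * m) (2 * m)"
    by (simp add: kovalevskaya_matrix_def)
  have deg: "degree (char_poly ?A) = 2 * m \<and> Polynomial.coeff (char_poly ?A) (2 * m) = 1"
    by (rule degree_monic_char_poly[OF A])
  show ?thesis
    unfolding kovalevskaya_exponents_def
  proof (rule proots_eq_mset_set)
    show "char_poly ?A \<noteq> 0" using deg by auto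
    show "finite (exponents m k)" by (simp add: exponents_def)
    show "degree (char_poly ?A) \<le> card (exponents m k)"
      using deg k by (simp add: card_exponents)
    fix \<rho> assume "\<rho> \<in> exponents m k"
    then have "lin k \<rho> (Suc m) = 0"
      unfolding exponents_def
    proof
      assume "\<rho> \<in> of_nat ` resonances m k"
      then show ?thesis using lin_resonance[OF k] by auto
    next
      assume "\<rho> \<in> (\<lambda>i. - of_nat (2 * i - 1)) ` {1..k}"
      then obtain i where i: "i \<in> {1..k}" "\<rho> = - of_nat (2 * i - 1)" by auto
      have "\<rho> = 1 - 2 * of_nat i"
        using i by (simp add: of_nat_diff)
      then show ?thesis using lin_negative_exponent[of i k m] i k by simp
    qed
    then show "poly (char_poly ?A) \<rho> = 0"
      using eigenvalue_kovalevskaya_matrix[of m k \<rho>] k eigenvalue_root_char_poly[OF A] by simp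
  qed
qed

lemma mset_set_exponents:
  assumes "k \<le> m"
  shows "mset_set (exponents m k) =
           image_mset (\<lambda>i. of_nat (2 * i)) (mset_set {1..m - k})
         + image_mset (\<lambda>i. of_nat (2 * k + 1 + 2 * i)) (mset_set {1..m - k})
         + image_mset (\<lambda>i. of_nat (2 * m + 2 + 2 * i)) (mset_set {1..k})
         + image_mset (\<lambda>i. - of_nat (2 * i - 1)) (mset_set {1..k})"
proof -
  have "mset_set (exponents m k) = mset_set (of_nat ` resonances m k)
      + mset_set ((\<lambda>i. - of_nat (2 * i - 1)) ` {1..k})"
    unfolding exponents_def by (rule mset_set_Union[OF _ _ exponents_disjoint]) auto
  also have "mset_set (of_nat ` resonances m k) = image_mset (of_nat :: nat \<Rightarrow> complex) (mset_set (resonances m k))"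
    by (rule image_mset_mset_set[symmetric]) (rule inj_on_of_nat)
  also have "mset_set (resonances m k) = mset_set ((\<lambda>i. 2 * i) ` {1..m - k} \<union> (\<lambda>i. 2 * k + 1 + 2 * i) ` {1..m - k})
      + mset_set ((\<lambda>i. 2 * m + 2 + 2 * i) ` {1..k})"
    unfolding resonances_def by (rule mset_set_Union[OF _ _ resonances_disjoint(2)]) auto
  also have "mset_set ((\<lambda>i. 2 * i) ` {1..m - k} \<union> (\<lambda>i. 2 * k + 1 + 2 * i) ` {1..m - k})
      = mset_set ((\<lambda>i. 2 * i) ` {1..m - k}) + mset_set ((\<lambda>i. 2 * k + 1 + 2 * i) ` {1..m - k})"
    by (rule mset_set_Union[OF _ _ resonances_disjoint(1)]) auto
  also have "mset_set ((\<lambda>i. 2 * i) ` {1..m - k}) = image_mset (\<lambda>i. 2 * i) (mset_set {1..m - k})"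
    by (rule image_mset_mset_set[symmetric]) (simp add: inj_on_def)
  also have "mset_set ((\<lambda>i. 2 * k + 1 + 2 * i) ` {1..m - k}) = image_mset (\<lambda>i. 2 * k + 1 + 2 * i) (mset_set {1..m - k})"
    by (rule image_mset_mset_set[symmetric]) (simp add: inj_on_def)
  also have "mset_set ((\<lambda>i. 2 * m + 2 + 2 * i) ` {1..k}) = image_mset (\<lambda>i. 2 * m + 2 + 2 * i) (mset_set {1..k})"
    by (rule image_mset_mset_set[symmetric]) (simp add: inj_on_def)
  also have "mset_set ((\<lambda>i. - of_nat (2 * i - 1) :: complex) ` {1..k}) = image_mset (\<lambda>i. - of_nat (2 * i - 1)) (mset_set {1..k})"
    by (rule image_mset_mset_set[symmetric]) (rule inj_on_neg_odd)
  finally show ?thesis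
    by (simp only: image_mset_union multiset.map_comp o_def)
qed

text \<open>A further positive zero would be an eigenvalue outside the complete list. This direction
  justifies the division by \<open>lin\<close> in the construction of solutions.\<close>

lemma lin_eq_0_iff:
  assumes k: "1 \<le> k" "k \<le> m" and n: "n \<ge> 1"
  shows "lin k (of_nat n) (Suc m) = 0 \<longleftrightarrow> n \<in> resonances m k"
proof
  assume "lin k (of_nat n) (Suc m) = 0"
  then have ev: "eigenvalue (kovalevskaya_matrix m (leading_coeff k)) (of_nat n)"
    using eigenvalue_kovalevskaya_matrix k by simp
  let ?A = "kovalevskaya_matrix m (leading_coeff k)"
  have A: "?A \<in> carrier_mat (2 * m) (2 * m)"
    by (simp add: kovalevskaya_matrix_def)
  have "char_poly ?A \<noteq> 0"
    using degree_monic_char_poly[OF A] by auto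
  then have "of_nat n \<in># kovalevskaya_exponents m k"
    using ev eigenvalue_root_char_poly[OF A] by (simp add: kovalevskaya_exponents_def)
  then have "of_nat n \<in> exponents m k"
    by (simp add: kovalevskaya_exponents_eq_mset_set[OF k] finite_exponents)
  then show "n \<in> resonances m k"
    using of_nat_notin_neg_odd[of n k] unfolding exponents_def by auto
qed (rule lin_resonance[OF k])

lemma positive_exponents_eq:
  assumes k: "1 \<le> k" "k \<le> m"
  shows "positive_exponents m k = resonances m k"
proof -
  have "of_nat n \<in> exponents m k \<longleftrightarrow> n \<in> resonances m k" for n
    using of_nat_notin_neg_odd[of n k] unfolding exponents_def by auto
  moreover have "n > 0" if "n \<in> resonances m k" for n
    using that by (auto simp: resonances_def)
  ultimately show ?thesis
    by (auto simp: positive_exponents_def kovalevskaya_exponents_eq_mset_set[OF k] finite_exponents)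
qed

section \<open>Formal solutions\<close>

definition forcing :: "nat \<Rightarrow> complex \<Rightarrow> nat \<Rightarrow> complex" where
  "forcing m z0 n = (if n = 2 * m + 2 then - 4 * z0 else if n = 2 * m + 3 then - 4 else 0)"

text \<open>The equation \<open>L\<^sub>m\<^sub>+\<^sub>1[x] = - 4 (z\<^sub>0 + t)\<close>, multiplied by \<open>t\<^sup>2\<^sup>m\<^sup>+\<^sup>2\<close>.\<close>

definition formal_solution :: "nat \<Rightarrow> nat \<Rightarrow> complex \<Rightarrow> (nat \<Rightarrow> complex) \<Rightarrow> bool" where
  "formal_solution m k z0 a \<longleftrightarrow> a 0 = half_tri k
    \<and> (\<forall>n. fps_nth (len_fps a (Suc m)) n = forcing m z0 n)"

lemma formal_solution_unique:
  assumes k: "1 \<le> k" "k \<le> m"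
    and a: "formal_solution m k z0 a" and b: "formal_solution m k z0 b"
    and eq: "\<And>n. n \<in> resonances m k \<Longrightarrow> a n = b n"
  shows "a n = b n"
proof (induction n rule: less_induct)
  case (less n)
  have a0: "a 0 = half_tri k" and b0: "b 0 = half_tri k"
    using a b by (auto simp: formal_solution_def)
  show ?case
  proof (cases "n = 0 \<or> n \<in> resonances m k")
    case True
    then show ?thesis using a0 b0 eq by auto
  next
    case False
    then have n: "n \<ge> 1" and lin: "lin k (of_nat n) (Suc m) \<noteq> 0"
      using lin_eq_0_iff[OF k] by auto
    have "trunc n a = trunc n b"
      using less by (auto simp: trunc_def)
    moreover have "fps_nth (len_fps a (Suc m)) n = fps_nth (len_fps b (Suc m)) n"
      using a b by (simp add: formal_solution_def)
    ultimately show ?thesis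
      using lin unfolding len_fps_nth_split[of a, OF a0 n] len_fps_nth_split[of b, OF b0 n] by simp
  qed
qed

text \<open>Resonant coefficients are taken from \<open>\<alpha>\<close>, the others are solved for
  by \<open>len_fps_nth_split\<close>. The truncation is written out so that the guard
  \<open>l < n\<close> is visible to the termination argument.\<close>

fun formal_sol :: "nat \<Rightarrow> nat \<Rightarrow> complex \<Rightarrow> (nat \<Rightarrow> complex) \<Rightarrow> nat \<Rightarrow> complex" where
  "formal_sol m k z0 \<alpha> n =
    (if n = 0 then half_tri k
     else if n \<in> resonances m k then \<alpha> n
     else (forcing m z0 n - fps_nth (len_fps (\<lambda>l. if l < n then formal_sol m k z0 \<alpha> l else 0) (Suc m)) n)
       / lin k (of_nat n) (Suc m))"

declare formal_sol.simps [simp del]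

lemma formal_sol_0 [simp]: "formal_sol m k z0 \<alpha> 0 = half_tri k"
  by (simp add: formal_sol.simps)

lemma resonances_pos: "n \<in> resonances m k \<Longrightarrow> n > 0"
  by (auto simp: resonances_def)

lemma formal_sol_resonance: "n \<in> resonances m k \<Longrightarrow> formal_sol m k z0 \<alpha> n = \<alpha> n"
  using resonances_pos[of n m k] by (subst formal_sol.simps) simp

lemma formal_sol_nonresonance:
  assumes "n \<ge> 1" "n \<notin> resonances m k"
  shows "formal_sol m k z0 \<alpha> n
    = (forcing m z0 n - fps_nth (len_fps (trunc n (formal_sol m k z0 \<alpha>)) (Suc m)) n) / lin k (of_nat n) (Suc m)"
proof -
  have "(\<lambda>l. if l < n then formal_sol m k z0 \<alpha> l else 0) = trunc n (formal_sol m k z0 \<alpha>)"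
    by (auto simp: trunc_def)
  then show ?thesis
    using assms by (subst formal_sol.simps) simp
qed

text \<open>Such an \<open>n\<close> is neither a resonance nor an order with forcing. The
  truncation satisfies \<open>no_log\<close> by induction, so its odd coefficient
  \<open>n < 2 m + 2\<close> of \<open>L\<^sub>m\<^sub>+\<^sub>1\<close> vanishes, and the recursion
  returns 0.\<close>

lemma formal_sol_odd_eq_0:
  assumes k: "1 \<le> k" "k \<le> m"
  shows "n \<le> 2 * k + 1 \<Longrightarrow> odd n \<Longrightarrow> formal_sol m k z0 \<alpha> n = 0"
proof (induction n rule: less_induct)
  case (less n)
  have n: "n \<ge> 1" "n \<notin> resonances m k"
    using less.prems k by (auto simp: resonances_def elim: oddE)
  have "no_log k (trunc n (formal_sol m k z0 \<alpha>))"
    using n less by (auto simp: no_log_def trunc_def)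
  then have "fps_nth (len_fps (trunc n (formal_sol m k z0 \<alpha>)) (Suc m)) n = 0"
    using len_fps_eq_0[OF k(1), of _ n "Suc m"] less.prems k by auto
  moreover have "forcing m z0 n = 0"
    using less.prems k by (auto simp: forcing_def)
  ultimately show ?case
    by (simp add: formal_sol_nonresonance[OF n])
qed

lemma formal_solution_formal_sol:
  assumes k: "1 \<le> k" "k \<le> m"
  shows "formal_solution m k z0 (formal_sol m k z0 \<alpha>)"
proof -
  let ?a = "formal_sol m k z0 \<alpha>"
  have a: "no_log k ?a"
    using formal_sol_odd_eq_0[OF k] by (simp add: no_log_def)
  have "fps_nth (len_fps ?a (Suc m)) n = forcing m z0 n" for n
  proof (induction n rule: less_induct)
    case (less n)
    consider "n = 0" | "n \<ge> 1" "n \<notin> resonances m k" | i where "n = 2 * i" "i \<in> {1..m - k}"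
      | i where "n = 2 * k + 1 + 2 * i" "i \<in> {1..m - k}" | i where "n = 2 * m + 2 + 2 * i" "i \<in> {1..k}"
      by (cases "n \<in> resonances m k") (auto simp: resonances_def Suc_le_eq)
    then show ?case
    proof cases
      case 1
      have "fps_nth (len_fps ?a (Suc m)) 0 = lead k (Suc m)"
        by (rule len_fps_nth_0) simp
      then show ?thesis
        using 1 k by (simp add: lead_eq_0 forcing_def)
    next
      case 2
      then have "lin k (of_nat n) (Suc m) \<noteq> 0"
        using lin_eq_0_iff[OF k] by blast
      then show ?thesis
        using len_fps_nth_split[of ?a k n "Suc m"] 2 by (simp add: formal_sol_nonresonance[OF 2])
    next
      case 3
      then have "n + 2 * k < 2 * Suc m" "forcing m z0 n = 0"
        using k by (auto simp: forcing_def)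
      then show ?thesis using len_fps_eq_0[OF k(1) a] by simp
    next
      case 4
      then have "odd n \<and> n < 2 * Suc m" "forcing m z0 n = 0"
        using k by (auto simp: forcing_def)
      then show ?thesis using len_fps_eq_0[OF k(1) a] by metis
    next
      case 5
      \<comment> \<open>By the induction hypothesis all lower coefficients equal
        \<open>forcing\<close>, which is nonzero at most at the two exceptional orders.\<close>
      have "fps_nth (len_fps ?a (Suc m)) (2 * m + 2 + 2 * i) = 0"
        using 5 less by (intro len_fps_compatible[OF k(1) a]) (auto simp: forcing_def)
      moreover have "forcing m z0 n = 0"
        using 5 by (auto simp: forcing_def)
      ultimately show ?thesis using 5 by simp
    qed
  qed
  then show ?thesis by (simp add: formal_solution_def)
qed

section \<open>Dependence of the coefficients on the parameters\<close>

text \<open>Boundedness accompanies continuity because the parameter set need not be compact, while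
  a uniform radius of convergence needs a common bound for the first coefficients.\<close>

definition bcont :: "'p::topological_space set \<Rightarrow> ('p \<Rightarrow> complex) \<Rightarrow> bool" where
  "bcont U f \<longleftrightarrow> continuous_on U f \<and> (\<exists>C. \<forall>q\<in>U. norm (f q) \<le> C)"

lemma bcont_const [simp]: "bcont U (\<lambda>q. c)"
  by (auto simp: bcont_def)

lemma bcont_add: "bcont U f \<Longrightarrow> bcont U g \<Longrightarrow> bcont U (\<lambda>q. f q + g q)"
  unfolding bcont_def
proof (elim conjE exE, intro conjI exI ballI)
  fix C D q assume "\<forall>q\<in>U. norm (f q) \<le> C" "\<forall>q\<in>U. norm (g q) \<le> D" "q \<in> U"
  then show "norm (f q + g q) \<le> C + D"
    by (meson add_mono norm_triangle_le)
qed (rule continuous_on_add)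

lemma bcont_mult: "bcont U f \<Longrightarrow> bcont U g \<Longrightarrow> bcont U (\<lambda>q. f q * g q)"
  unfolding bcont_def
proof (elim conjE exE, intro conjI exI ballI)
  fix C D q assume "\<forall>q\<in>U. norm (f q) \<le> C" "\<forall>q\<in>U. norm (g q) \<le> D" "q \<in> U"
  then show "norm (f q * g q) \<le> C * D"
    unfolding norm_mult by (intro mult_mono) (auto intro: order_trans[OF norm_ge_zero])
qed (rule continuous_on_mult)

lemma bcont_sum: "(\<And>i. i \<in> S \<Longrightarrow> bcont U (f i)) \<Longrightarrow> bcont U (\<lambda>q. \<Sum>i\<in>S. f i q)"
  by (induction S rule: infinite_finite_induct) (auto intro: bcont_add)

lemma bcont_diff: "bcont U f \<Longrightarrow> bcont U g \<Longrightarrow> bcont U (\<lambda>q. f q - g q)"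
  using bcont_add[of U f "\<lambda>q. - 1 * g q"] bcont_mult[of U "\<lambda>q. - 1" g] by simp

lemma bcont_divide_const: "bcont U f \<Longrightarrow> bcont U (\<lambda>q. f q / c)"
  using bcont_mult[of U f "\<lambda>q. inverse c"] by (simp add: divide_inverse)

lemma bcont_peval:
  assumes "\<And>i n. bcont U (\<lambda>q. fps_nth (y q i) n)"
  shows "bcont U (\<lambda>q. fps_nth (peval fps_const (y q) p) n)"
proof (induction p arbitrary: n rule: diff_poly_induct)
  case (mult p q)
  then show ?case
    by (auto simp: eval_fps.peval_mult fps_mult_nth intro!: bcont_sum bcont_mult)
qed (auto simp: eval_fps.peval_add assms intro!: bcont_add)

text \<open>Each coefficient is a polynomial in the parameters: the denominators \<open>lin\<close>
  do not depend on them.\<close>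

lemma bcont_formal_sol:
  assumes z0: "bcont U z0" and \<alpha>: "\<And>n. n \<in> resonances m k \<Longrightarrow> bcont U (\<lambda>q. \<alpha> q n)"
  shows "bcont U (\<lambda>q. formal_sol m k (z0 q) (\<alpha> q) n)"
proof (induction n rule: less_induct)
  case (less n)
  consider "n = 0" | "n \<in> resonances m k" | "n \<ge> 1" "n \<notin> resonances m k"
    by fastforce
  then show ?case
  proof cases
    case 3
    have "bcont U (\<lambda>q. fps_nth (jet_fps (trunc n (formal_sol m k (z0 q) (\<alpha> q))) i) l)" for i l
      using less by (cases "l < n") (auto simp: trunc_def intro!: bcont_mult)
    then have "bcont U (\<lambda>q. fps_nth (len_fps (trunc n (formal_sol m k (z0 q) (\<alpha> q))) (Suc m)) n)"
      unfolding len_fps_def by (rule bcont_peval)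
    moreover have "bcont U (\<lambda>q. forcing m (z0 q) n)"
      using z0 bcont_mult[of U "\<lambda>q. - 4" z0] by (cases "n = 2 * m + 2"; cases "n = 2 * m + 3") (simp_all add: forcing_def)
    ultimately show ?thesis
      unfolding formal_sol_nonresonance[OF 3] by (intro bcont_divide_const bcont_diff)
  qed (simp_all add: formal_sol_resonance \<alpha>)
qed

section \<open>Convergence\<close>

text \<open>Majorants up to a fixed order only, since the factors produced by differentiation grow
  with the order.\<close>

definition maj_upto :: "nat \<Rightarrow> complex fps \<Rightarrow> real fps \<Rightarrow> bool" where
  "maj_upto n f g \<longleftrightarrow> (\<forall>l\<le>n. norm (fps_nth f l) \<le> fps_nth g l)"

lemma maj_upto_1: "maj_upto n 1 1"
  by (simp add: maj_upto_def)

lemma maj_upto_mult: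
  assumes "maj_upto n f g" "maj_upto n f' g'"
  shows "maj_upto n (f * f') (g * g')"
  unfolding maj_upto_def fps_mult_nth
proof (intro allI impI)
  fix l assume "l \<le> n"
  show "norm (\<Sum>i=0..l. fps_nth f i * fps_nth f' (l - i)) \<le> (\<Sum>i=0..l. fps_nth g i * fps_nth g' (l - i))"
  proof (rule sum_norm_le)
    fix i assume "i \<in> {0..l}"
    with \<open>l \<le> n\<close> have "norm (fps_nth f i) \<le> fps_nth g i" "norm (fps_nth f' (l - i)) \<le> fps_nth g' (l - i)"
      using assms by (auto simp: maj_upto_def)
    then show "norm (fps_nth f i * fps_nth f' (l - i)) \<le> fps_nth g i * fps_nth g' (l - i)"
      unfolding norm_mult by (intro mult_mono) (auto intro: order_trans[OF norm_ge_zero])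
  qed
qed

lemma maj_upto_power: "maj_upto n f g \<Longrightarrow> maj_upto n (f ^ e) (g ^ e)"
  by (induction e) (auto intro: maj_upto_1 maj_upto_mult)

lemma maj_upto_prod:
  "(\<And>i. i \<in> S \<Longrightarrow> maj_upto n (f i) (g i)) \<Longrightarrow> maj_upto n (\<Prod>i\<in>S. f i) (\<Prod>i\<in>S. g i)"
  by (induction S rule: infinite_finite_induct) (auto intro: maj_upto_1 maj_upto_mult)

lemma norm_ffall_le:
  assumes "\<And>j. j < i \<Longrightarrow> norm (x - of_nat j) \<le> R"
  shows "norm (ffall x i) \<le> R ^ i"
  using assms
proof (induction i)
  case (Suc i)
  then have "norm (x - of_nat i) \<le> R" "norm (ffall x i) \<le> R ^ i" by auto
  then show ?case
    unfolding ffall.simps norm_mult power_Suc by (intro mult_mono) (auto intro: order_trans[OF norm_ge_zero])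
qed simp

lemma norm_ffall_ge:
  assumes "R \<ge> 0" "\<And>j. j < i \<Longrightarrow> R \<le> norm (x - of_nat j)"
  shows "R ^ i \<le> norm (ffall x i)"
  using assms
proof (induction i)
  case (Suc i)
  then have "R \<le> norm (x - of_nat i)" "R ^ i \<le> norm (ffall x i)" by auto
  then show ?case
    using \<open>R \<ge> 0\<close> unfolding ffall.simps norm_mult power_Suc by (intro mult_mono) auto
qed simp

lemma norm_ffall_mono:
  assumes "i \<le> j" "\<And>l. l < j \<Longrightarrow> 1 \<le> norm (x - of_nat l)"
  shows "norm (ffall x i) \<le> norm (ffall x j)"
  using assms
proof (induction j rule: dec_induct)
  case (step j)
  then have "norm (ffall x i) \<le> norm (ffall x j)" "1 \<le> norm (x - of_nat j)" by auto
  then have "1 * norm (ffall x i) \<le> norm (x - of_nat j) * norm (ffall x j)"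
    by (intro mult_mono) auto
  then show ?case by (simp add: norm_mult)
qed simp

definition norm_fps :: "(nat \<Rightarrow> complex) \<Rightarrow> real fps" where
  "norm_fps b = Abs_fps (\<lambda>l. norm (b l))"

text \<open>Up to order \<open>n\<close> each differentiation costs at most a factor
  \<open>R\<close>, so a monomial costs \<open>R\<close> to its total order of
  differentiation.\<close>

lemma maj_upto_monom:
  assumes R: "\<And>l j. l \<le> n \<Longrightarrow> j < N \<Longrightarrow> norm (of_nat l - 2 - of_nat j :: complex) \<le> R"
    and \<mu>: "keys \<mu> \<subseteq> {..<N}"
  shows "maj_upto n (monom_eval (jet_fps b) \<mu>)
    (fps_const (R ^ (\<Sum>i\<in>keys \<mu>. i * lookup \<mu> i))
      * norm_fps b ^ (\<Sum>i\<in>keys \<mu>. lookup \<mu> i))"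
proof -
  have "maj_upto n (jet_fps b i) (fps_const (R ^ i) * norm_fps b)" if "i \<in> keys \<mu>" for i
    unfolding maj_upto_def
  proof (intro allI impI)
    fix l assume "l \<le> n"
    have "norm (ffall (of_nat l - 2) i) \<le> R ^ i"
      using R[OF \<open>l \<le> n\<close>] that \<mu> by (intro norm_ffall_le) auto
    then show "norm (fps_nth (jet_fps b i) l) \<le> fps_nth (fps_const (R ^ i) * norm_fps b) l"
      by (auto simp: norm_fps_def norm_mult intro: mult_right_mono)
  qed
  then have "maj_upto n (monom_eval (jet_fps b) \<mu>)
      (\<Prod>i\<in>keys \<mu>. (fps_const (R ^ i) * norm_fps b) ^ lookup \<mu> i)"
    unfolding monom_eval_def by (intro maj_upto_prod maj_upto_power)
  also have "(\<Prod>i\<in>keys \<mu>. (fps_const (R ^ i) * norm_fps b) ^ lookup \<mu> i)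
    = (\<Prod>i\<in>keys \<mu>. fps_const R ^ (i * lookup \<mu> i) * norm_fps b ^ lookup \<mu> i)"
    by (intro prod.cong refl) (simp add: power_mult_distrib power_mult flip: fps_const_power)
  also have "\<dots> = fps_const R ^ (\<Sum>i\<in>keys \<mu>. i * lookup \<mu> i)
      * norm_fps b ^ (\<Sum>i\<in>keys \<mu>. lookup \<mu> i)"
    by (simp add: prod.distrib power_sum)
  finally show ?thesis by (simp add: fps_const_power)
qed

definition mdeg :: "(nat \<Rightarrow>\<^sub>0 nat) \<Rightarrow> nat" where
  "mdeg \<mu> = (\<Sum>i\<in>keys \<mu>. lookup \<mu> i)"

lemma norm_fps_power_nonneg: "fps_nth (norm_fps b ^ e) l \<ge> 0"
proof -
  have "maj_upto l (Abs_fps b ^ e) (norm_fps b ^ e)"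
    by (rule maj_upto_power) (simp add: maj_upto_def norm_fps_def)
  then show ?thesis
    by (auto simp: maj_upto_def intro: order_trans[OF norm_ge_zero])
qed

lemma norm_peval_painleve_poly_le:
  assumes R: "\<And>l j. l \<le> n \<Longrightarrow> j < 2 * m \<Longrightarrow> norm (of_nat l - 2 - of_nat j :: complex) \<le> R" and "R \<ge> 1"
  shows "norm (fps_nth (peval fps_const (jet_fps b) (painleve_poly m)) n)
    \<le> R ^ (2 * m - 2) * (\<Sum>\<mu>\<in>keys (painleve_poly m).
      norm (lookup (painleve_poly m) \<mu>) * fps_nth (norm_fps b ^ mdeg \<mu>) n)"
proof -
  have "norm (fps_nth (peval fps_const (jet_fps b) (painleve_poly m)) n)
    = norm (\<Sum>\<mu>\<in>keys (painleve_poly m).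
      lookup (painleve_poly m) \<mu> * fps_nth (monom_eval (jet_fps b) \<mu>) n)"
    by (simp add: peval_def fps_sum_nth)
  also have "\<dots> \<le> (\<Sum>\<mu>\<in>keys (painleve_poly m).
      norm (lookup (painleve_poly m) \<mu>) * (R ^ (2 * m - 2) * fps_nth (norm_fps b ^ mdeg \<mu>) n))"
  proof (rule sum_norm_le)
    fix \<mu> assume \<mu>: "\<mu> \<in> keys (painleve_poly m)"
    let ?w = "\<Sum>i\<in>keys \<mu>. i * lookup \<mu> i"
    have "maj_upto n (monom_eval (jet_fps b) \<mu>) (fps_const (R ^ ?w) * norm_fps b ^ mdeg \<mu>)"
      unfolding mdeg_def using vars_below_painleve_poly[of m] \<mu>
      by (intro maj_upto_monom[where N = "2 * m"] R) (auto simp: vars_below_def)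
    then have "norm (fps_nth (monom_eval (jet_fps b) \<mu>) n) \<le> R ^ ?w * fps_nth (norm_fps b ^ mdeg \<mu>) n"
      by (simp add: maj_upto_def)
    also have "R ^ ?w \<le> R ^ (2 * m - 2)"
      using painleve_poly_monom(2)[OF \<mu>] \<open>R \<ge> 1\<close> by (intro power_increasing) auto
    finally have "norm (fps_nth (monom_eval (jet_fps b) \<mu>) n)
        \<le> R ^ (2 * m - 2) * fps_nth (norm_fps b ^ mdeg \<mu>) n"
      by (simp add: mult_right_mono norm_fps_power_nonneg)
    then show "norm (lookup (painleve_poly m) \<mu> * fps_nth (monom_eval (jet_fps b) \<mu>) n)
      \<le> norm (lookup (painleve_poly m) \<mu>) * (R ^ (2 * m - 2) * fps_nth (norm_fps b ^ mdeg \<mu>) n)"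
      unfolding norm_mult by (intro mult_left_mono) auto
  qed
  finally show ?thesis
    by (simp add: sum_distrib_left mult_ac)
qed

lemma lenard_eq_painleve_poly: "lenard (Suc m) = dconst 4 * (painleve_poly m - dvar (2 * m))"
proof -
  have "dconst 4 * dconst (1 / 4) = 1"
    by (simp only: dconst_def mult_single) simp
  then show ?thesis
    by (simp add: painleve_poly_def mult.assoc[symmetric])
qed

text \<open>Beyond the forcing, and since the truncation has coefficient 0 at order
  \<open>n\<close>, the linear term \<open>dvar (2 * m)\<close> drops out and only the nonlinear
  polynomial remains.\<close>

lemma formal_solution_recursion:
  assumes a: "formal_solution m k z0 a" and n: "n > 2 * m + 3"
  shows "lin k (of_nat n) (Suc m) * a n
    = - 4 * fps_nth (peval fps_const (jet_fps (trunc n a)) (painleve_poly m)) n"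
proof -
  have "fps_nth (len_fps (trunc n a) (Suc m)) n
    = 4 * fps_nth (peval fps_const (jet_fps (trunc n a)) (painleve_poly m)) n"
    unfolding len_fps_def lenard_eq_painleve_poly by (simp add: eval_fps.peval_simps trunc_def)
  moreover have "fps_nth (len_fps a (Suc m)) n = 0"
    using a n by (simp add: formal_solution_def forcing_def)
  ultimately show ?thesis
    using len_fps_nth_split[of a k n "Suc m"] a n by (simp add: formal_solution_def eq_neg_iff_add_eq_0 add.commute)
qed

text \<open>The variables of \<open>painleve_poly\<close> have order at most \<open>2 m - 2\<close>,
  so its variation is at most a constant times the entry \<open>2 m - 2\<close> of the jet. Entry
  \<open>2 m\<close> has two more factors of size about \<open>n\<close> and dominates.\<close>

lemma lin_lower_bound:
  assumes "m \<ge> 1"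
  shows "\<exists>c>0. \<exists>n0. \<forall>n\<ge>n0. c * real n ^ (2 * m - 2) \<le> norm (lin k (of_nat n) (Suc m))"
proof -
  let ?P = "painleve_poly m"
  define C where "C = (\<Sum>i<2*m-1. norm (ddir (pole_jet k) (unit_dir i) ?P))"
  have vb: "vars_below (2 * m - 1) ?P"
    using painleve_poly_vars by (fastforce simp: vars_below_def)
  obtain K :: nat where K: "C + 1 \<le> real K"
    using real_arch_simple by blast
  \<comment> \<open>\<open>4 m\<close> makes \<open>n - 2 - j \<ge> n / 2\<close> for
    \<open>j < 2 m - 2\<close>, and \<open>K\<close> makes \<open>n - 2 - (2 m - 1)\<close> exceed
    \<open>C + 1\<close>.\<close>
  define n0 where "n0 = 4 * m + 2 + K"
  have "4 * (1/2) ^ (2 * m - 2) * real n ^ (2 * m - 2) \<le> norm (lin k (of_nat n) (Suc m))" if n: "n \<ge> n0" for n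
  proof -
    let ?v = "pert_jet (of_nat n)"
    have nm: "norm (of_nat n - 2 - of_nat j :: complex) = real n - 2 - real j" if "j \<le> 2 * m" for j
    proof -
      have "(of_nat n - 2 - of_nat j :: complex) = of_nat (n - 2 - j)"
        using n that by (simp add: n0_def of_nat_diff)
      then show ?thesis
        using n that by (simp add: n0_def of_nat_diff del: of_nat_diff)
    qed
    have lin: "lin k (of_nat n) (Suc m) = 4 * (ddir (pole_jet k) ?v ?P - ?v (2 * m))"
      by (simp add: lin_def lenard_eq_painleve_poly ddir_simps)
    let ?V = "norm (?v (2 * m - 2))"
    have low: "norm (ddir (pole_jet k) ?v ?P) \<le> C * ?V"
    proof -
      have "norm (ddir (pole_jet k) ?v ?P) \<le> (\<Sum>i<2*m-1. norm (?v i * ddir (pole_jet k) (unit_dir i) ?P))"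
        unfolding ddir_eq_sum_unit_dir[OF vb, of _ ?v] by (rule norm_sum)
      also have "\<dots> \<le> (\<Sum>i<2*m-1. ?V * norm (ddir (pole_jet k) (unit_dir i) ?P))"
        unfolding norm_mult
      proof (intro sum_mono mult_right_mono)
        fix i assume i: "i \<in> {..<2*m-1}"
        have "1 \<le> norm (of_nat n - 2 - of_nat l :: complex)" if "l < 2 * m - 2" for l
          using nm[of l] that n by (simp add: n0_def)
        then show "norm (?v i) \<le> ?V"
          unfolding pert_jet_def using i by (intro norm_ffall_mono) auto
      qed auto
      finally show ?thesis by (simp add: C_def sum_distrib_left sum_distrib_right mult.commute)
    qed
    have "?v (2 * m) = (of_nat n - 2 - of_nat (2 * m - 1)) * ((of_nat n - 2 - of_nat (2 * m - 2)) * ?v (2 * m - 2))"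
    proof -
      obtain l where m: "m = Suc l" using assms by (cases m) auto
      show ?thesis by (simp add: m pert_jet_def)
    qed
    then have "norm (?v (2 * m)) = (real n - 2 - real (2 * m - 1)) * ((real n - 2 - real (2 * m - 2)) * ?V)"
      using nm[of "2 * m - 1"] nm[of "2 * m - 2"] by (simp only: norm_mult)
    moreover have "(real n - 2 - real (2 * m - 1)) * ((real n - 2 - real (2 * m - 2)) * ?V) \<ge> (C + 1) * (1 * ?V)"
      using K n assms by (intro mult_mono) (auto simp: n0_def of_nat_diff)
    ultimately have "norm (?v (2 * m)) \<ge> C * ?V + ?V"
      by (simp add: algebra_simps)
    then have "?V \<le> norm (?v (2 * m)) - norm (ddir (pole_jet k) ?v ?P)"
      using low by simp
    also have "\<dots> \<le> norm (ddir (pole_jet k) ?v ?P - ?v (2 * m))"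
      by (metis norm_minus_commute norm_triangle_ineq2)
    finally have "4 * ?V \<le> norm (lin k (of_nat n) (Suc m))"
      unfolding lin norm_mult by simp
    moreover have "(real n / 2) ^ (2 * m - 2) \<le> ?V"
      unfolding pert_jet_def
    proof (rule norm_ffall_ge)
      fix j assume "j < 2 * m - 2"
      then show "real n / 2 \<le> norm (of_nat n - 2 - of_nat j :: complex)"
        using nm[of j] n by (simp add: n0_def)
    qed simp
    ultimately show ?thesis
      by (simp add: power_divide)
  qed
  then show ?thesis
    by (intro exI[of _ "4 * (1/2) ^ (2 * m - 2)"] conjI exI[of _ n0]) auto
qed

text \<open>The power \<open>n ^ (2 m - 2)\<close> caused by the derivatives cancels against the
  lower bound for \<open>lin\<close>. The remaining inequality is free of derivatives, with
  constants independent of the solution and of \<open>z0\<close>.\<close>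

lemma coeff_bound:
  assumes "m \<ge> 1"
  shows "\<exists>n0>2*m+3. \<exists>C\<ge>0. \<forall>z0 a. formal_solution m k z0 a \<longrightarrow> (\<forall>n\<ge>n0. norm (a n)
    \<le> C * (\<Sum>\<mu>\<in>keys (painleve_poly m).
      norm (lookup (painleve_poly m) \<mu>) * fps_nth (norm_fps (trunc n a) ^ mdeg \<mu>) n))"
proof -
  obtain c n1 where c: "c > 0" "\<And>n. n \<ge> n1 \<Longrightarrow> c * real n ^ (2 * m - 2) \<le> norm (lin k (of_nat n) (Suc m))"
    using lin_lower_bound[OF assms] by metis
  define n0 where "n0 = max n1 (2 * m + 4)"
  \<comment> \<open>From \<open>norm (l - 2 - j) \<le> n + 2 n + 2 m n\<close>.\<close>
  define D where "D = real (2 * m + 3)"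
  define C where "C = 4 * D ^ (2 * m - 2) / c"
  have "norm (a n) \<le> C * (\<Sum>\<mu>\<in>keys (painleve_poly m).
      norm (lookup (painleve_poly m) \<mu>) * fps_nth (norm_fps (trunc n a) ^ mdeg \<mu>) n)"
    (is "_ \<le> C * ?S")
    if a: "formal_solution m k z0 a" and n: "n \<ge> n0" for z0 a n
  proof -
    have npos: "real n \<ge> 1" using n by (simp add: n0_def)
    have R: "norm (of_nat l - 2 - of_nat j :: complex) \<le> D * real n" if "l \<le> n" "j < 2 * m" for l j
    proof -
      have "norm (of_nat l - 2 - of_nat j :: complex) \<le> norm (of_nat l :: complex) + norm (2 :: complex) + norm (of_nat j :: complex)"
        by (meson add_mono norm_triangle_ineq4 order_refl order_trans)
      also have "\<dots> \<le> real n + 2 * real n + real (2 * m) * real n"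
        using that npos by (intro add_mono) (auto intro!: order_trans[OF _ mult_left_mono[OF npos]])
      finally show ?thesis by (simp add: D_def algebra_simps)
    qed
    have "D * real n \<ge> 1 * 1"
      using npos by (intro mult_mono) (auto simp: D_def)
    then have "norm (fps_nth (peval fps_const (jet_fps (trunc n a)) (painleve_poly m)) n) \<le> (D * real n) ^ (2 * m - 2) * ?S"
      by (intro norm_peval_painleve_poly_le R) auto
    moreover have "norm (lin k (of_nat n) (Suc m)) * norm (a n)
        = 4 * norm (fps_nth (peval fps_const (jet_fps (trunc n a)) (painleve_poly m)) n)"
      using arg_cong[OF formal_solution_recursion[OF a], of n norm] n
      by (simp add: norm_mult n0_def)
    moreover have "c * real n ^ (2 * m - 2) * norm (a n) \<le> norm (lin k (of_nat n) (Suc m)) * norm (a n)"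
      using c(2)[of n] n by (intro mult_right_mono) (auto simp: n0_def)
    ultimately have "real n ^ (2 * m - 2) * (c * norm (a n)) \<le> real n ^ (2 * m - 2) * (4 * D ^ (2 * m - 2) * ?S)"
      by (simp add: power_mult_distrib mult_ac)
    then have "c * norm (a n) \<le> 4 * D ^ (2 * m - 2) * ?S"
      using npos by (subst (asm) mult_le_cancel_left_pos) auto
    then show ?thesis
      using c(1) by (simp add: C_def field_simps)
  qed
  moreover have "C \<ge> 0"
    using c(1) by (simp add: C_def D_def)
  moreover have "n0 > 2 * m + 3"
    by (simp add: n0_def)
  ultimately show ?thesis by blast
qed

section \<open>Weighted partial sums and the quadratic majorant estimate\<close>

definition wsum :: "nat \<Rightarrow> real \<Rightarrow> real fps \<Rightarrow> real" where
  "wsum N s f = (\<Sum>n<N. fps_nth f n * s ^ n)"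

text \<open>The truncated product only omits nonnegative terms with
  \<open>i + j \<ge> N\<close>.\<close>

lemma wsum_mult_le:
  assumes "s \<ge> 0" "\<And>n. fps_nth f n \<ge> 0" "\<And>n. fps_nth g n \<ge> 0"
  shows "wsum N s (f * g) \<le> wsum N s f * wsum N s g"
proof -
  let ?h = "\<lambda>i j. (fps_nth f i * s ^ i) * (fps_nth g j * s ^ j)"
  have "wsum N s (f * g) = (\<Sum>n<N. \<Sum>i\<le>n. ?h i (n - i))"
    unfolding wsum_def fps_mult_nth sum_distrib_right atLeast0AtMost
  proof (intro sum.cong refl)
    fix n i :: nat assume "i \<in> {..n}"
    then have "s ^ n = s ^ i * s ^ (n - i)" by (simp flip: power_add)
    then show "fps_nth f i * fps_nth g (n - i) * s ^ n = ?h i (n - i)" by simp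
  qed
  also have "\<dots> = (\<Sum>(i, j)\<in>{(i, j). i + j < N}. ?h i j)"
    by (rule sum.triangle_reindex[symmetric])
  also have "\<dots> \<le> (\<Sum>(i, j)\<in>{..<N} \<times> {..<N}. ?h i j)"
    using assms by (intro sum_mono2) auto
  also have "\<dots> = wsum N s f * wsum N s g"
    by (simp add: wsum_def sum_product sum.cartesian_product)
  finally show ?thesis .
qed

lemma wsum_nonneg: "s \<ge> 0 \<Longrightarrow> (\<And>n. fps_nth f n \<ge> 0) \<Longrightarrow> wsum N s f \<ge> 0"
  by (simp add: wsum_def sum_nonneg)

lemma wsum_power_le:
  assumes "s \<ge> 0"
  shows "wsum N s (norm_fps b ^ q) \<le> wsum N s (norm_fps b) ^ q"
proof (induction q)
  case 0
  show ?case by (cases N) (auto simp: wsum_def sum.lessThan_Suc_shift simp del: sum.lessThan_Suc)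
next
  case (Suc q)
  have nn: "fps_nth (norm_fps b) n \<ge> 0" for n
    by (simp add: norm_fps_def)
  have "wsum N s (norm_fps b ^ Suc q) \<le> wsum N s (norm_fps b) * wsum N s (norm_fps b ^ q)"
    unfolding power_Suc using assms by (intro wsum_mult_le nn norm_fps_power_nonneg)
  also have "\<dots> \<le> wsum N s (norm_fps b) * wsum N s (norm_fps b) ^ q"
    using assms Suc by (intro mult_left_mono wsum_nonneg nn)
  finally show ?case by simp
qed

lemma norm_fps_power_mono:
  assumes "\<And>l. l \<le> n \<Longrightarrow> norm (b l) \<le> norm (b' l)"
  shows "fps_nth (norm_fps b ^ q) n \<le> fps_nth (norm_fps b' ^ q) n"
proof -
  have "maj_upto n (Abs_fps (\<lambda>l. of_real (norm (b l))) ^ q) (norm_fps b' ^ q)"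
    using assms by (intro maj_upto_power) (simp add: maj_upto_def norm_fps_def)
  moreover have "fps_nth (Abs_fps (\<lambda>l. of_real (norm (b l))) ^ q) l = complex_of_real (fps_nth (norm_fps b ^ q) l)" for l
    by (induction q arbitrary: l) (simp_all add: fps_mult_nth norm_fps_def)
  ultimately show ?thesis
    by (auto simp: maj_upto_def norm_fps_power_nonneg)
qed

text \<open>The binomial terms \<open>q = 0\<close> and \<open>q = 1\<close> do not reach order
  \<open>n\<close>: the first is constant, the second is coefficient \<open>n\<close> of
  \<open>X\<close>. What is left is at least quadratic in \<open>X\<close>.\<close>

lemma fps_nth_power_quadratic:
  fixes X :: "real fps"
  assumes "n \<ge> 1" "fps_nth X n = 0"
  shows "fps_nth ((fps_const c + X) ^ r) n = (\<Sum>q=2..r. of_nat (r choose q) * c ^ (r - q) * fps_nth (X ^ q) n)"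
proof -
  have "(fps_const c + X) ^ r = (\<Sum>q\<le>r. of_nat (r choose q) * X ^ q * fps_const c ^ (r - q))"
    by (subst add.commute) (rule binomial_ring)
  then have "fps_nth ((fps_const c + X) ^ r) n = (\<Sum>q\<le>r. of_nat (r choose q) * c ^ (r - q) * fps_nth (X ^ q) n)"
    by (simp add: fps_sum_nth fps_const_power mult_ac flip: fps_of_nat)
  also have "\<dots> = (\<Sum>q=2..r. of_nat (r choose q) * c ^ (r - q) * fps_nth (X ^ q) n)"
  proof (rule sum.mono_neutral_right)
    show "\<forall>q\<in>{..r} - {2..r}. of_nat (r choose q) * c ^ (r - q) * fps_nth (X ^ q) n = 0"
    proof
      fix q assume "q \<in> {..r} - {2..r}"
      then have "q = 0 \<or> q = 1" by auto
      then show "of_nat (r choose q) * c ^ (r - q) * fps_nth (X ^ q) n = 0"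
        using assms by auto
    qed
  qed auto
  finally show ?thesis .
qed

definition tail :: "nat \<Rightarrow> (nat \<Rightarrow> complex) \<Rightarrow> nat \<Rightarrow> complex" where
  "tail n a l = (if 1 \<le> l \<and> l < n then a l else 0)"

lemma norm_fps_trunc: "n \<ge> 1 \<Longrightarrow> norm_fps (trunc n a) = fps_const (norm (a 0)) + norm_fps (tail n a)"
  by (rule fps_ext) (auto simp: norm_fps_def trunc_def tail_def)

lemma wsum_tail: "N \<le> M \<Longrightarrow> wsum M s (norm_fps (tail N a)) = (\<Sum>l=1..<N. norm (a l) * s ^ l)"
  unfolding wsum_def by (rule sum.mono_neutral_cong_right) (auto simp: norm_fps_def tail_def)

text \<open>All tails \<open>tail n a\<close> with \<open>n \<le> N\<close> are dominated by
  \<open>tail N a\<close>. Its powers \<open>q \<ge> 2\<close> contribute at most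
  \<open>S ^ q \<le> S\<^sup>2\<close>, and the binomial weights add up to at most
  \<open>(1 + norm (a 0)) ^ r\<close>.\<close>

lemma sum_quadratic_bound:
  assumes "1 \<le> n0" "s \<ge> 0" and S: "S = (\<Sum>l=1..<N. norm (a l) * s ^ l)" "S \<le> 1"
  shows "(\<Sum>n=n0..N. fps_nth (norm_fps (trunc n a) ^ r) n * s ^ n) \<le> (1 + norm (a 0)) ^ r * S\<^sup>2"
proof -
  let ?c = "norm (a 0)"
  let ?X = "norm_fps (tail N a)"
  have S0: "S \<ge> 0" using \<open>s \<ge> 0\<close> by (simp add: S sum_nonneg)
  have "(\<Sum>n=n0..N. fps_nth (norm_fps (trunc n a) ^ r) n * s ^ n)
    \<le> (\<Sum>n=n0..N. (\<Sum>q=2..r. of_nat (r choose q) * ?c ^ (r - q) * fps_nth (?X ^ q) n) * s ^ n)"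
  proof (intro sum_mono mult_right_mono)
    fix n assume n: "n \<in> {n0..N}"
    then have n1: "n \<ge> 1" using assms by auto
    have "fps_nth (norm_fps (trunc n a) ^ r) n
      = (\<Sum>q=2..r. of_nat (r choose q) * ?c ^ (r - q) * fps_nth (norm_fps (tail n a) ^ q) n)"
      unfolding norm_fps_trunc[OF n1] using n1 by (intro fps_nth_power_quadratic) (auto simp: norm_fps_def tail_def)
    also have "\<dots> \<le> (\<Sum>q=2..r. of_nat (r choose q) * ?c ^ (r - q) * fps_nth (?X ^ q) n)"
      using n by (intro sum_mono mult_left_mono norm_fps_power_mono) (auto simp: tail_def)
    finally show "fps_nth (norm_fps (trunc n a) ^ r) n
      \<le> (\<Sum>q=2..r. of_nat (r choose q) * ?c ^ (r - q) * fps_nth (?X ^ q) n)" .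
  qed (use \<open>s \<ge> 0\<close> in auto)
  also have "\<dots> = (\<Sum>q=2..r. of_nat (r choose q) * ?c ^ (r - q) * (\<Sum>n=n0..N. fps_nth (?X ^ q) n * s ^ n))"
    unfolding sum_distrib_right sum_distrib_left by (subst sum.swap) (simp add: mult_ac)
  also have "\<dots> \<le> (\<Sum>q=2..r. of_nat (r choose q) * ?c ^ (r - q) * S\<^sup>2)"
  proof (intro sum_mono mult_left_mono)
    fix q assume q: "q \<in> {2..r}"
    have "(\<Sum>n=n0..N. fps_nth (?X ^ q) n * s ^ n) \<le> wsum (Suc N) s (?X ^ q)"
      unfolding wsum_def using \<open>s \<ge> 0\<close> by (intro sum_mono2) (auto simp: norm_fps_power_nonneg)
    also have "\<dots> \<le> wsum (Suc N) s ?X ^ q"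
      using \<open>s \<ge> 0\<close> by (rule wsum_power_le)
    also have "wsum (Suc N) s ?X = S"
      unfolding S by (rule wsum_tail) simp
    also have "S ^ q \<le> S\<^sup>2"
      using q S0 S(2) by (intro power_decreasing) auto
    finally show "(\<Sum>n=n0..N. fps_nth (?X ^ q) n * s ^ n) \<le> S\<^sup>2" .
  qed auto
  also have "\<dots> \<le> (\<Sum>q\<le>r. of_nat (r choose q) * ?c ^ (r - q) * S\<^sup>2)"
    by (intro sum_mono2) auto
  also have "\<dots> = (1 + ?c) ^ r * S\<^sup>2"
    unfolding sum_distrib_right[symmetric] by (subst binomial_ring) simp
  finally show ?thesis .
qed

text \<open>A bootstrap: if \<open>S N \<le> \<delta>\<close>, then \<open>S (Suc N)\<close> is at
  most an initial part \<open>\<delta> / 2\<close> plus \<open>C1 * \<delta>\<^sup>2\<close>, hence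
  again at most \<open>\<delta>\<close>. Here \<open>n0\<close> precedes \<open>B\<close>, and
  \<open>s\<close> depends on \<open>B\<close> alone, uniformly in \<open>z0\<close> and
  \<open>a\<close>.\<close>

lemma formal_solution_convergent:
  assumes "m \<ge> 1"
  shows "\<exists>n0. \<forall>B. \<exists>s>0. \<forall>z0 a. formal_solution m k z0 a \<longrightarrow> (\<forall>n<n0. norm (a n) \<le> B)
    \<longrightarrow> (\<forall>n\<ge>1. norm (a n) * s ^ n \<le> 1)"
proof -
  let ?P = "painleve_poly m"
  obtain n0 C where n0: "n0 > 2 * m + 3" and C: "C \<ge> 0"
    and bound: "\<And>z0 a n. formal_solution m k z0 a \<Longrightarrow> n \<ge> n0 \<Longrightarrow> norm (a n)
      \<le> C * (\<Sum>\<mu>\<in>keys ?P. norm (lookup ?P \<mu>) * fps_nth (norm_fps (trunc n a) ^ mdeg \<mu>) n)"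
    using coeff_bound[OF assms, of k] by blast
  define c where "c = norm (half_tri k)"
  define C1 where "C1 = C * (\<Sum>\<mu>\<in>keys ?P. norm (lookup ?P \<mu>) * (1 + c) ^ mdeg \<mu>)"
  have C1: "C1 \<ge> 0"
    unfolding C1_def using C by (intro mult_nonneg_nonneg sum_nonneg) (auto simp: c_def)
  define \<delta> where "\<delta> = 1 / (2 * C1 + 1)"
  have \<delta>: "\<delta> > 0" "\<delta> \<le> 1" "C1 * \<delta>\<^sup>2 \<le> \<delta> / 2"
  proof -
    show "\<delta> > 0" "\<delta> \<le> 1" using C1 by (auto simp: \<delta>_def field_simps)
    have "C1 * \<delta> \<le> 1 / 2" using C1 by (simp add: \<delta>_def field_simps)
    then have "C1 * \<delta> * \<delta> \<le> 1 / 2 * \<delta>"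
      using \<open>\<delta> > 0\<close> by (intro mult_right_mono) auto
    then show "C1 * \<delta>\<^sup>2 \<le> \<delta> / 2" by (simp add: power2_eq_square mult_ac)
  qed
  have "\<exists>s>0. \<forall>z0 a. formal_solution m k z0 a \<longrightarrow> (\<forall>n<n0. norm (a n) \<le> B)
    \<longrightarrow> (\<forall>n\<ge>1. norm (a n) * s ^ n \<le> 1)" for B
  proof -
    \<comment> \<open>Small enough for the initial part to be at most \<open>\<delta> / 2\<close>;
      \<open>s \<le> 1\<close> gives \<open>s ^ l \<le> s\<close>, and
      \<open>\<bar>B\<bar> + 1\<close> keeps the denominator positive for every
      \<open>B\<close>.\<close>
    define s where "s = min 1 (\<delta> / (2 * (real n0 * (\<bar>B\<bar> + 1))))"
    have s: "s > 0" "s \<le> 1" "real n0 * (\<bar>B\<bar> + 1) * s \<le> \<delta> / 2"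
    proof -
      have pos: "real n0 * (\<bar>B\<bar> + 1) > 0" using n0 by auto
      then show "s > 0" "s \<le> 1" using \<delta> by (auto simp: s_def)
      have "real n0 * (\<bar>B\<bar> + 1) * s \<le> real n0 * (\<bar>B\<bar> + 1) * (\<delta> / (2 * (real n0 * (\<bar>B\<bar> + 1))))"
        using pos by (intro mult_left_mono) (auto simp: s_def)
      also have "\<dots> = \<delta> / 2" using pos by (simp add: field_simps)
      finally show "real n0 * (\<bar>B\<bar> + 1) * s \<le> \<delta> / 2" .
    qed
    have "norm (a n) * s ^ n \<le> 1"
      if a: "formal_solution m k z0 a" and B: "\<forall>n<n0. norm (a n) \<le> B" and n: "n \<ge> 1" for z0 a n
    proof -
      define S where "S = (\<lambda>N. \<Sum>l=1..<N. norm (a l) * s ^ l)"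
      have initial: "S N \<le> \<delta> / 2" if "N \<le> n0" for N
      proof -
        have "S N \<le> (\<Sum>l=1..<N. (\<bar>B\<bar> + 1) * s)"
          unfolding S_def
        proof (intro sum_mono mult_mono)
          fix l assume l: "l \<in> {1..<N}"
          then show "norm (a l) \<le> \<bar>B\<bar> + 1"
            using B that by (smt (verit) atLeastLessThan_iff order_less_le_trans)
          have "s ^ l \<le> s ^ 1" using l s by (intro power_decreasing) auto
          then show "s ^ l \<le> s" by simp
        qed (use s in auto)
        also have "\<dots> \<le> real n0 * (\<bar>B\<bar> + 1) * s"
          using that s by (auto intro!: mult_right_mono simp: mult.assoc)
        finally show ?thesis using s by simp
      qed
      have "S N \<le> \<delta>" for N
      proof (induction N)
        case 0
        then show ?case using \<delta> by (simp add: S_def)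
      next
        case (Suc N)
        show ?case
        proof (cases "Suc N \<le> n0")
          case True
          then show ?thesis using initial[OF True] \<delta> by simp
        next
          case False
          then have N: "n0 \<le> N" by simp
          have S0: "S N \<ge> 0" unfolding S_def using s by (intro sum_nonneg) auto
          have "S (Suc N) = S n0 + (\<Sum>n=n0..N. norm (a n) * s ^ n)"
            unfolding S_def using n0 N
            by (subst sum.atLeastLessThan_concat[symmetric, of 1 n0]) (auto simp: atLeastLessThanSuc_atLeastAtMost)
          also have "(\<Sum>n=n0..N. norm (a n) * s ^ n) \<le> (\<Sum>n=n0..N. C * (\<Sum>\<mu>\<in>keys ?P.
              norm (lookup ?P \<mu>) * fps_nth (norm_fps (trunc n a) ^ mdeg \<mu>) n) * s ^ n)"
            using s by (intro sum_mono mult_right_mono bound[OF a]) auto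
          also have "\<dots> = C * (\<Sum>\<mu>\<in>keys ?P. norm (lookup ?P \<mu>) *
              (\<Sum>n=n0..N. fps_nth (norm_fps (trunc n a) ^ mdeg \<mu>) n * s ^ n))"
            unfolding sum_distrib_left sum_distrib_right by (subst sum.swap) (simp add: mult_ac)
          also have "\<dots> \<le> C * (\<Sum>\<mu>\<in>keys ?P. norm (lookup ?P \<mu>) *
              ((1 + c) ^ mdeg \<mu> * (S N)\<^sup>2))"
          proof (intro mult_left_mono sum_mono)
            fix \<mu>
            have "c = norm (a 0)" using a by (simp add: c_def formal_solution_def)
            then show "(\<Sum>n=n0..N. fps_nth (norm_fps (trunc n a) ^ mdeg \<mu>) n * s ^ n) \<le> (1 + c) ^ mdeg \<mu> * (S N)\<^sup>2"
              using n0 s Suc \<delta> by (auto intro!: sum_quadratic_bound simp: S_def)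
          qed (use C in auto)
          also have "\<dots> = C1 * (S N)\<^sup>2"
            by (simp add: C1_def sum_distrib_right sum_distrib_left mult_ac)
          also have "\<dots> \<le> C1 * \<delta>\<^sup>2"
            using C1 Suc S0 by (intro mult_left_mono power_mono) auto
          finally show ?thesis
            using initial[of n0] \<delta> by simp
        qed
      qed
      then have "S (Suc n) \<le> 1" using \<delta> by (meson order_trans)
      moreover have "norm (a n) * s ^ n \<le> S (Suc n)"
        unfolding S_def using n s by (intro member_le_sum) auto
      ultimately show ?thesis by simp
    qed
    then show ?thesis using s by blast
  qed
  then show ?thesis by blast
qed

section \<open>Convergent Laurent series\<close>

definition jet_fls :: "(nat \<Rightarrow> complex) \<Rightarrow> nat \<Rightarrow> complex fls" where
  "jet_fls a i = fls_shift (int i + 2) (fps_to_fls (jet_fps a i))"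

lemma fls_deriv_jet_fls: "fls_deriv (jet_fls a i) = jet_fls a (Suc i)"
proof (rule fls_eqI)
  fix n :: int
  show "fls_nth (fls_deriv (jet_fls a i)) n = fls_nth (jet_fls a (Suc i)) n"
  proof (cases "n + int i + 3 \<ge> 0")
    case True
    then obtain l :: nat where "n + int i + 3 = int l"
      by (metis nonneg_int_cases)
    then have l: "n = int l - int i - 3" by simp
    have 1: "fls_nth (jet_fls a i) (int l - int i - 3 + 1) = ffall (of_nat l - 2) i * a l"
      by (simp add: jet_fls_def)
    have 2: "fls_nth (jet_fls a (Suc i)) (int l - int i - 3) = ffall (of_nat l - 2) (Suc i) * a l"
      by (simp add: jet_fls_def del: ffall.simps)
    show ?thesis
      unfolding l fls_deriv_nth 1 2 by simp
  next
    case False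
    then have "n + 1 + (int i + 2) < 0" "n + (int (Suc i) + 2) < 0" by auto
    then show ?thesis
      by (simp only: jet_fls_def fls_deriv_nth fls_shift_nth fps_to_fls_nth if_True if_False mult_zero_right)
  qed
qed

lemma fls_shift_mult_shift: "fls_shift m f * fls_shift n g = fls_shift (m + n) (f * g :: complex fls)"
  by (rule fls_times_both_shifted_simp)

lemma peval_jet_fls:
  assumes "homog w p"
  shows "peval fls_const (jet_fls a) p = fls_shift (int w) (fps_to_fls (peval fps_const (jet_fps a) p))"
  using assms
proof (induction rule: homog_induct)
  case (zero w)
  then show ?case by simp
next
  case (const c)
  then show ?case by simp
next
  case (var i)
  then show ?case by (simp add: jet_fls_def add.commute)
next
  case (add w p q)
  then show ?case by (simp add: eval_fls.peval_add eval_fps.peval_add)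
next
  case (mult w w' p q)
  then show ?case
    by (simp add: eval_fls.peval_mult eval_fps.peval_mult fls_shift_mult_shift fls_times_fps_to_fls)
qed

text \<open>Returns from coefficients to the differential equation in the field of Laurent series.
  Every term is \<open>t\<close> to the power \<open>- 2 m - 2\<close> times a power series, and
  these power series are compared.\<close>

lemma formal_solution_iff_fls:
  "formal_solution m k z0 a \<longleftrightarrow> a 0 = half_tri k
    \<and> jet_fls a (2 * m) = peval fls_const (jet_fls a) (painleve_poly m) + (fls_const z0 + fls_X)"
proof -
  let ?G = "peval fps_const (jet_fps a) (painleve_poly m)"
  have shift: "fls_const z0 + fls_X = fls_shift (int (2 * m + 2))
      (fps_to_fls (fps_const z0 * fps_X ^ (2 * m + 2) + fps_X ^ (2 * m + 3)))"
    (is "_ = fls_shift _ (fps_to_fls ?Z)")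
  proof (rule fls_eqI)
    fix n :: int
    have "n + int (2 * m + 2) = int (2 * m + 2) \<longleftrightarrow> n = 0" "n + int (2 * m + 2) = int (2 * m + 3) \<longleftrightarrow> n = 1"
      by auto
    then show "fls_nth (fls_const z0 + fls_X) n = fls_nth (fls_shift (int (2 * m + 2)) (fps_to_fls ?Z)) n"
      by (auto simp: fps_X_power_nth nat_eq_iff)
  qed
  have lhs: "jet_fls a (2 * m) = fls_shift (int (2 * m + 2)) (fps_to_fls (jet_fps a (2 * m)))"
    by (simp add: jet_fls_def add.commute)
  have rhs: "peval fls_const (jet_fls a) (painleve_poly m) + (fls_const z0 + fls_X)
      = fls_shift (int (2 * m + 2)) (fps_to_fls (?G + ?Z))"
    unfolding peval_jet_fls[OF homog_painleve_poly] shift fps_to_fls_plus by (rule fls_eqI) simp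
  have "jet_fls a (2 * m) = peval fls_const (jet_fls a) (painleve_poly m) + (fls_const z0 + fls_X)
    \<longleftrightarrow> fls_shift (int (2 * m + 2)) (fps_to_fls (jet_fps a (2 * m))) = fls_shift (int (2 * m + 2)) (fps_to_fls (?G + ?Z))"
    by (simp only: lhs rhs)
  also have "\<dots> \<longleftrightarrow> jet_fps a (2 * m) = ?G + ?Z"
    by (simp only: fls_shift_eq_iff fps_to_fls_eq_iff)
  also have "\<dots> \<longleftrightarrow> (\<forall>n. fps_nth (jet_fps a (2 * m)) n = fps_nth ?G n + fps_nth ?Z n)"
    by (simp only: fps_eq_iff fps_add_nth)
  also have "\<dots> \<longleftrightarrow> (\<forall>n. fps_nth (len_fps a (Suc m)) n = forcing m z0 n)"
  proof (intro all_cong1)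
    fix n
    have "fps_nth (len_fps a (Suc m)) n = 4 * (fps_nth ?G n - fps_nth (jet_fps a (2 * m)) n)"
      unfolding len_fps_def lenard_eq_painleve_poly by (simp add: eval_fps.peval_simps)
    moreover have "forcing m z0 n = - 4 * fps_nth ?Z n"
      by (auto simp: forcing_def fps_X_power_nth)
    moreover have "J = G + Z \<longleftrightarrow> 4 * (G - J) = - 4 * Z" for J G Z :: complex
    proof -
      have "4 * (G - J) = - 4 * Z \<longleftrightarrow> 4 * (G + Z - J) = 0"
        by (simp add: algebra_simps eq_neg_iff_add_eq_0)
      also have "\<dots> \<longleftrightarrow> J = G + Z"
        by (simp only: mult_eq_0_iff) auto
      finally show ?thesis by blast
    qed
    ultimately show "(fps_nth (jet_fps a (2 * m)) n = fps_nth ?G n + fps_nth ?Z n)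
        \<longleftrightarrow> fps_nth (len_fps a (Suc m)) n = forcing m z0 n"
      by (simp only:)
  qed
  finally show ?thesis by (simp only: formal_solution_def)
qed

lemma eval_fls_peval:
  assumes R: "\<And>i. fls_conv_radius (F i) \<ge> ereal R" and t: "t \<noteq> 0" "norm t < R"
  shows "fls_conv_radius (peval fls_const F p) \<ge> ereal R
    \<and> eval_fls (peval fls_const F p) t = deval (\<lambda>i. eval_fls (F i) t) p"
proof -
  have less: "ereal (norm t) < r" if "ereal R \<le> r" for r
    using t that by (meson ereal_less_eq less_ereal.simps(1) order_less_le_trans)
  show ?thesis
  proof (induction p rule: diff_poly_induct)
    case (const c)
    then show ?case by simp
  next
    case (var i)
    then show ?case using R by simp
  next
    case (add p q)
    then show ?case
      using t by (simp add: eval_fls.peval_add deval_simps fls_conv_radius_add_ge eval_fls_add less)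
  next
    case (mult p q)
    then show ?case
      using t by (simp add: eval_fls.peval_mult deval_simps fls_conv_radius_mult_ge eval_fls_mult less)
  qed
qed

lemma ereal_less_of_le: "x < R \<Longrightarrow> ereal R \<le> r \<Longrightarrow> ereal x < r"
  by (rule less_le_trans[of _ "ereal R"]) simp_all

lemma laurent_term_eq:
  assumes "z \<noteq> z0"
  shows "laurent_term a z0 j z n = a j n * (z - z0) ^ n * (z - z0) powi (- int (j + 1))"
  using assms power_int_add[of "z - z0" "int n" "- int (j + 1)", unfolded add_uminus_conv_diff power_int_of_nat]
  unfolding laurent_term_def weight_def by simp

definition comp_fls :: "(nat \<Rightarrow> nat \<Rightarrow> complex) \<Rightarrow> nat \<Rightarrow> complex fls" where
  "comp_fls a j = fls_shift (int (j + 1)) (fps_to_fls (Abs_fps (a j)))"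

lemma laurent_sum_eq_eval_fls:
  assumes z: "z \<noteq> z0" "ereal (norm (z - z0)) < fls_conv_radius (comp_fls a j)"
  shows "summable (laurent_term a z0 j z)"
    and "laurent_sum a z0 j z = eval_fls (comp_fls a j) (z - z0)"
proof -
  have r: "ereal (norm (z - z0)) < fps_conv_radius (Abs_fps (a j))"
    using z by (simp add: comp_fls_def)
  have "(\<lambda>n. a j n * (z - z0) ^ n) sums eval_fps (Abs_fps (a j)) (z - z0)"
    using sums_eval_fps[OF r] by simp
  then have "laurent_term a z0 j z sums (eval_fps (Abs_fps (a j)) (z - z0) * (z - z0) powi (- int (j + 1)))"
    unfolding laurent_term_eq[OF z(1)] by (rule sums_mult2)
  then show "summable (laurent_term a z0 j z)"
    and "laurent_sum a z0 j z = eval_fls (comp_fls a j) (z - z0)"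
    using z r by (auto simp: sums_iff laurent_sum_def comp_fls_def eval_fls_shift eval_fps_to_fls)
qed

text \<open>Convergence at the points \<open>z0 + s\<close> of one ray already bounds the radius
  from below.\<close>

lemma comp_fls_conv_radius_ge:
  assumes "\<And>z. z \<in> ball z0 r - {z0} \<Longrightarrow> summable (laurent_term a z0 j z)"
  shows "fls_conv_radius (comp_fls a j) \<ge> ereal r"
proof -
  have "conv_radius (a j) \<ge> ereal r"
  proof (rule conv_radius_geI_ex')
    fix s :: real assume s: "0 < s" "ereal s < ereal r"
    define z where "z = z0 + of_real s"
    have z: "z \<noteq> z0" "z - z0 = of_real s"
      using s by (auto simp: z_def)
    have "z \<in> ball z0 r - {z0}"
      using s by (auto simp: z_def dist_norm)
    then have "summable (laurent_term a z0 j z)" by (rule assms)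
    also have "laurent_term a z0 j z = (\<lambda>n. (a j n * (z - z0) ^ n) * (z - z0) powi (- int (j + 1)))"
      by (rule ext) (rule laurent_term_eq[OF z(1)])
    finally have "summable (\<lambda>n. (a j n * (z - z0) ^ n) * (z - z0) powi (- int (j + 1)) / (z - z0) powi (- int (j + 1)))"
      by (rule summable_divide)
    moreover have "(z - z0) powi (- int (j + 1)) \<noteq> 0"
      using z s by simp
    ultimately show "summable (\<lambda>n. a j n * of_real s ^ n)"
      by (simp only: nonzero_mult_div_cancel_right z(2) not_False_eq_True)
  qed
  then show ?thesis
    by (simp add: comp_fls_def fps_conv_radius_def)
qed

lemma jet_fls_conv_radius_ge:
  assumes "s > 0" "\<And>n. n \<ge> 1 \<Longrightarrow> norm (a n) * s ^ n \<le> C"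
  shows "fls_conv_radius (jet_fls a i) \<ge> ereal s"
proof (induction i)
  case 0
  have "conv_radius a \<ge> ereal s"
  proof (rule conv_radius_geI_ex')
    fix r :: real assume r: "0 < r" "ereal r < ereal s"
    show "summable (\<lambda>n. a n * of_real r ^ n)"
    proof (rule summable_comparison_test_ev)
      show "summable (\<lambda>n. C * (r / s) ^ n)"
        using r assms(1) by (intro summable_mult summable_geometric) auto
      show "\<forall>\<^sub>F n in sequentially. norm (a n * of_real r ^ n) \<le> C * (r / s) ^ n"
        using eventually_ge_at_top[of 1]
      proof eventually_elim
        case (elim n)
        have "norm (a n) * s ^ n * (r / s) ^ n \<le> C * (r / s) ^ n"
          using assms(2)[OF elim] r assms(1) by (intro mult_right_mono) auto
        then show ?case
          using assms(1) r by (simp add: norm_mult norm_power power_divide)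
      qed
    qed
  qed
  moreover have "jet_fps a 0 = Abs_fps a"
    by (rule fps_ext) simp
  ultimately show ?case
    by (simp add: jet_fls_def fps_conv_radius_def)
next
  case (Suc i)
  show ?case
    unfolding fls_deriv_jet_fls[symmetric] using Suc fls_conv_radius_deriv order_trans by blast
qed

definition jet_coeffs :: "(nat \<Rightarrow> complex) \<Rightarrow> nat \<Rightarrow> nat \<Rightarrow> complex" where
  "jet_coeffs a j n = ffall (of_nat n - 2) (j - 1) * a n"

lemma comp_fls_jet_coeffs: "comp_fls (jet_coeffs a) (Suc i) = jet_fls a i"
proof -
  have "Abs_fps (jet_coeffs a (Suc i)) = jet_fps a i"
    by (rule fps_ext) (simp add: jet_coeffs_def)
  then show ?thesis
    by (simp add: comp_fls_def jet_fls_def add.commute)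
qed

lemma has_field_derivative_laurent_sum:
  assumes z: "z \<noteq> z0" "norm (z - z0) < r" and r: "fls_conv_radius (comp_fls a j) \<ge> ereal r"
  shows "(laurent_sum a z0 j has_field_derivative eval_fls (fls_deriv (comp_fls a j)) (z - z0)) (at z)"
proof -
  have mem: "z - z0 \<in> eball 0 (fls_conv_radius (comp_fls a j)) - {0}"
    using z ereal_less_of_le[OF z(2) r] by (simp add: eball_def)
  have "((\<lambda>z. eval_fls (comp_fls a j) (z - z0)) has_field_derivative
      eval_fls (fls_deriv (comp_fls a j)) (z - z0) * 1) (at z)"
    by (rule DERIV_chain2[where f = "eval_fls (comp_fls a j)" and g = "\<lambda>z. z - z0", OF has_field_derivative_eval_fls[OF mem]]) (auto intro!: derivative_eq_intros)
  then have "((\<lambda>z. eval_fls (comp_fls a j) (z - z0)) has_field_derivative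
      eval_fls (fls_deriv (comp_fls a j)) (z - z0)) (at z)"
    by simp
  moreover have "eventually (\<lambda>w. w \<in> ball z0 r - {z0}) (nhds z)"
    using z by (intro eventually_nhds_in_open) (auto simp: dist_norm norm_minus_commute)
  then have "eventually (\<lambda>w. laurent_sum a z0 j w = eval_fls (comp_fls a j) (w - z0)) (nhds z)"
  proof eventually_elim
    case (elim w)
    then have "ereal (norm (w - z0)) < fls_conv_radius (comp_fls a j)"
      by (intro ereal_less_of_le[OF _ r]) (simp add: dist_norm norm_minus_commute)
    then show ?case using elim by (intro laurent_sum_eq_eval_fls) auto
  qed
  ultimately show ?thesis
    by (subst DERIV_cong_ev[OF refl _ refl]) auto
qed

lemma painleve_rhs:
  assumes "i < 2 * m"
  shows "fA m (Suc i) (\<lambda>j. x j z) + (if Suc i = 2 * m then z else 0)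
    = (if Suc i < 2 * m then x (Suc (Suc i)) z else deval (\<lambda>i. x (Suc i) z) (painleve_poly m) + z)"
  using assms by (simp add: fA_def)

lemma laurent_solution_jet_coeffs:
  assumes a: "formal_solution m k z0 a" and s: "s > 0" "\<And>n. n \<ge> 1 \<Longrightarrow> norm (a n) * s ^ n \<le> C"
  shows "laurent_solution m k z0 s (jet_coeffs a)"
proof -
  have rad: "fls_conv_radius (jet_fls a i) \<ge> ereal s" for i
    using s by (rule jet_fls_conv_radius_ge)
  have eq: "laurent_sum (jet_coeffs a) z0 (Suc i) z = eval_fls (jet_fls a i) (z - z0)"
    and summable: "summable (laurent_term (jet_coeffs a) z0 (Suc i) z)" if "z \<in> ball z0 s - {z0}" for z i
  proof -
    have "ereal (norm (z - z0)) < fls_conv_radius (comp_fls (jet_coeffs a) (Suc i))"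
      unfolding comp_fls_jet_coeffs using that
      by (intro ereal_less_of_le[OF _ rad]) (simp add: dist_norm norm_minus_commute)
    then show "laurent_sum (jet_coeffs a) z0 (Suc i) z = eval_fls (jet_fls a i) (z - z0)"
      "summable (laurent_term (jet_coeffs a) z0 (Suc i) z)"
      using that by (auto simp: laurent_sum_eq_eval_fls comp_fls_jet_coeffs)
  qed
  have deriv: "(laurent_sum (jet_coeffs a) z0 (Suc i) has_field_derivative
      fA m (Suc i) (\<lambda>j. laurent_sum (jet_coeffs a) z0 j z) + (if Suc i = 2 * m then z else 0)) (at z)"
    if z: "z \<in> ball z0 s - {z0}" and i: "i < 2 * m" for z i
  proof -
    have z': "z \<noteq> z0" "norm (z - z0) < s"
      using z by (auto simp: dist_norm norm_minus_commute)
    have "(laurent_sum (jet_coeffs a) z0 (Suc i) has_field_derivative eval_fls (jet_fls a (Suc i)) (z - z0)) (at z)"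
      using has_field_derivative_laurent_sum[OF z', of "jet_coeffs a" "Suc i"] rad
      by (simp add: comp_fls_jet_coeffs fls_deriv_jet_fls)
    moreover have "eval_fls (jet_fls a (Suc i)) (z - z0)
      = (if Suc i < 2 * m then laurent_sum (jet_coeffs a) z0 (Suc (Suc i)) z
         else deval (\<lambda>i. laurent_sum (jet_coeffs a) z0 (Suc i) z) (painleve_poly m) + z)"
    proof (cases "Suc i < 2 * m")
      case False
      then have Suc_i: "Suc i = 2 * m" using i by simp
      let ?G = "peval fls_const (jet_fls a) (painleve_poly m)"
      have G: "fls_conv_radius ?G \<ge> ereal s"
        "eval_fls ?G (z - z0) = deval (\<lambda>i. eval_fls (jet_fls a i) (z - z0)) (painleve_poly m)"
        using eval_fls_peval[of s "jet_fls a" "z - z0" "painleve_poly m"] rad z' by auto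
      have "ereal (norm (z - z0)) < fls_conv_radius ?G"
        using G(1) z'(2) by (meson ereal_less_eq less_ereal.simps(1) order_less_le_trans)
      moreover have "fls_conv_radius (fls_const z0 + fls_X) = \<infinity>"
        using fls_conv_radius_add_ge[of \<infinity> "fls_const z0" fls_X] by simp
      ultimately have "eval_fls (?G + (fls_const z0 + fls_X)) (z - z0) = eval_fls ?G (z - z0) + (z0 + (z - z0))"
        using z' by (simp add: eval_fls_add)
      moreover have "jet_fls a (Suc i) = ?G + (fls_const z0 + fls_X)"
        using a unfolding Suc_i formal_solution_iff_fls by blast
      ultimately show ?thesis
        using False eq[OF z] G(2) by simp
    qed (simp add: eq[OF z])
    ultimately show ?thesis
      by (simp only: painleve_rhs[OF i])
  qed
  have lead: "jet_coeffs a (Suc i) 0 = leading_coeff k (Suc i)" for i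
    using a by (simp add: jet_coeffs_def leading_coeff_Suc pole_jet_def formal_solution_def)
  show ?thesis
    unfolding laurent_solution_def painleve_solution_def
  proof (intro conjI ballI)
    fix j z assume j: "j \<in> {1..2*m}"
    then obtain i where i: "j = Suc i" "i < 2 * m" by (cases j) auto
    show "jet_coeffs a j 0 = leading_coeff k j"
      unfolding i by (rule lead)
    assume z: "z \<in> ball z0 s - {z0}"
    show "summable (laurent_term (jet_coeffs a) z0 j z)"
      unfolding i by (rule summable[OF z])
    show "(laurent_sum (jet_coeffs a) z0 j has_field_derivative
        fA m j (\<lambda>j. laurent_sum (jet_coeffs a) z0 j z) + (if j = 2 * m then z else 0)) (at z)"
      unfolding i(1) by (rule deriv[OF z i(2)])
  qed (rule s(1))
qed

section \<open>From convergent solutions back to formal ones\<close>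

lemma has_laurent_expansion_deval:
  assumes "\<And>i. f i has_laurent_expansion F i"
  shows "(\<lambda>t. deval (\<lambda>i. f i t) p) has_laurent_expansion peval fls_const F p"
  by (induction p rule: diff_poly_induct)
    (auto simp: deval_simps eval_fls.peval_simps assms intro!: laurent_expansion_intros)

lemma has_laurent_expansion_transfer:
  assumes "f has_laurent_expansion F" "eventually (\<lambda>t. f t = g t) (at 0)"
  shows "g has_laurent_expansion F"
  using assms has_laurent_expansion_cong[OF assms(2) refl] by blast

text \<open>Uniqueness of Laurent expansions turns the equations between functions near the pole
  into equations between series: all but the last component equation identify the components with
  derivatives of the first, and the last is the Painleve equation.\<close>

lemma laurent_solution_imp_formal:
  assumes m: "m \<ge> 1" and sol: "laurent_solution m k z0 r a"
  shows "formal_solution m k z0 (a 1) \<and> (\<forall>j\<in>{1..2*m}. \<forall>n. a j n = jet_coeffs (a 1) j n)"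
proof -
  have r: "r > 0" and lead: "\<And>j. j \<in> {1..2*m} \<Longrightarrow> a j 0 = leading_coeff k j"
    and summable: "\<And>j z. j \<in> {1..2*m} \<Longrightarrow> z \<in> ball z0 r - {z0} \<Longrightarrow> summable (laurent_term a z0 j z)"
    and ode: "\<And>j z. j \<in> {1..2*m} \<Longrightarrow> z \<in> ball z0 r - {z0} \<Longrightarrow>
      (laurent_sum a z0 j has_field_derivative (fA m j (\<lambda>i. laurent_sum a z0 i z) + (if j = 2 * m then z else 0))) (at z)"
    using sol unfolding laurent_solution_def painleve_solution_def by auto
  have rad: "fls_conv_radius (comp_fls a (Suc i)) \<ge> ereal r" if "i < 2 * m" for i
    using summable[of "Suc i"] that by (intro comp_fls_conv_radius_ge) auto
  have eq: "laurent_sum a z0 (Suc i) (z0 + t) = eval_fls (comp_fls a (Suc i)) t"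
    if "t \<in> ball 0 r - {0}" "i < 2 * m" for t i
  proof -
    have "ereal (norm (z0 + t - z0)) < fls_conv_radius (comp_fls a (Suc i))"
      using that by (intro ereal_less_of_le[OF _ rad]) auto
    then show ?thesis
      using that(1) by (subst laurent_sum_eq_eval_fls) auto
  qed
  have ev: "eventually (\<lambda>t::complex. t \<in> ball 0 r - {0}) (at 0)"
    using r by (intro eventually_at_in_open) auto
  have exp: "eval_fls (comp_fls a (Suc i)) has_laurent_expansion comp_fls a (Suc i)" if "i < 2 * m" for i
    using ereal_less_of_le[OF r rad[OF that]]
    by (intro eval_fls_has_laurent_expansion) (simp add: zero_ereal_def)
  have exp': "eval_fls (fls_deriv (comp_fls a (Suc i))) has_laurent_expansion fls_deriv (comp_fls a (Suc i))"
    if "i < 2 * m" for i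
  proof (rule eval_fls_has_laurent_expansion)
    have "0 < fls_conv_radius (comp_fls a (Suc i))"
      using ereal_less_of_le[OF r rad[OF that]] by (simp add: zero_ereal_def)
    then show "0 < fls_conv_radius (fls_deriv (comp_fls a (Suc i)))"
      using fls_conv_radius_deriv less_le_trans by blast
  qed
  have deriv: "eval_fls (fls_deriv (comp_fls a (Suc i))) t
    = (if Suc i < 2 * m then eval_fls (comp_fls a (Suc (Suc i))) t
       else deval (\<lambda>i. laurent_sum a z0 (Suc i) (z0 + t)) (painleve_poly m) + (z0 + t))"
    if t: "t \<in> ball 0 r - {0}" and i: "i < 2 * m" for t i
  proof -
    have "eval_fls (fls_deriv (comp_fls a (Suc i))) (z0 + t - z0)
      = fA m (Suc i) (\<lambda>j. laurent_sum a z0 j (z0 + t)) + (if Suc i = 2 * m then z0 + t else 0)"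
      using t i rad[OF i] ode[of "Suc i" "z0 + t"]
      by (intro DERIV_unique[OF has_field_derivative_laurent_sum[where r = r]]) (auto simp: dist_norm)
    then show ?thesis
      using eq[OF t, of "Suc i"] painleve_rhs[OF i, of "laurent_sum a z0" "z0 + t"] by auto
  qed
  have step: "fls_deriv (comp_fls a (Suc i)) = comp_fls a (Suc (Suc i))" if "Suc i < 2 * m" for i
  proof (rule has_laurent_expansion_unique)
    show "eval_fls (fls_deriv (comp_fls a (Suc i))) has_laurent_expansion fls_deriv (comp_fls a (Suc i))"
      using exp' that by simp
    have "eventually (\<lambda>t. eval_fls (comp_fls a (Suc (Suc i))) t = eval_fls (fls_deriv (comp_fls a (Suc i))) t) (at 0)"
      using ev by eventually_elim (use deriv that in auto)
    then show "eval_fls (fls_deriv (comp_fls a (Suc i))) has_laurent_expansion comp_fls a (Suc (Suc i))"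
      using exp[OF that] by (rule has_laurent_expansion_transfer[rotated])
  qed
  have jet: "comp_fls a (Suc i) = jet_fls (a 1) i" if "i < 2 * m" for i
    using that
  proof (induction i)
    case 0
    have "jet_coeffs (a 1) 1 = a 1"
      by (simp add: fun_eq_iff jet_coeffs_def)
    then have "comp_fls a 1 = comp_fls (jet_coeffs (a 1)) 1"
      by (simp only: comp_fls_def)
    then show ?case using comp_fls_jet_coeffs[of "a 1" 0] by simp
  next
    case (Suc i)
    then show ?case
      using step[of i] fls_deriv_jet_fls[of "a 1" i] by simp
  qed
  have "jet_fls (a 1) (2 * m) = peval fls_const (jet_fls (a 1)) (painleve_poly m) + (fls_const z0 + fls_X)"
  proof -
    obtain l where l: "2 * m = Suc l" using m by (cases "2 * m") auto
    \<comment> \<open>A solution says nothing about components beyond \<open>2 m\<close>; they are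
      set to 0 so that every variable has an expansion, which leaves \<open>painleve_poly m\<close>
      unaffected.\<close>
    define f where "f = (\<lambda>i. if i < 2 * m then eval_fls (jet_fls (a 1) i) else (\<lambda>_. 0))"
    define F where "F = (\<lambda>i. if i < 2 * m then jet_fls (a 1) i else 0)"
    have "f i has_laurent_expansion F i" for i
      using exp[of i] jet[of i] by (auto simp: f_def F_def)
    then have "(\<lambda>t. deval (\<lambda>i. f i t) (painleve_poly m) + (z0 + t)) has_laurent_expansion
        peval fls_const F (painleve_poly m) + (fls_const z0 + fls_X)"
      by (intro laurent_expansion_intros has_laurent_expansion_deval)
    moreover have "peval fls_const F (painleve_poly m) = peval fls_const (jet_fls (a 1)) (painleve_poly m)"
      by (rule peval_cong_vars_below[OF vars_below_painleve_poly]) (simp add: F_def)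
    moreover have "eventually (\<lambda>t. deval (\<lambda>i. f i t) (painleve_poly m) + (z0 + t)
        = eval_fls (fls_deriv (comp_fls a (Suc l))) t) (at 0)"
      using ev
    proof eventually_elim
      case (elim t)
      have "deval (\<lambda>i. f i t) (painleve_poly m) = deval (\<lambda>i. laurent_sum a z0 (Suc i) (z0 + t)) (painleve_poly m)"
        unfolding deval_eq_peval using eq[OF elim]
        by (intro peval_cong_vars_below[OF vars_below_painleve_poly]) (simp add: f_def jet)
      then show ?case
        using deriv[OF elim, of l] l by simp
    qed
    ultimately have "eval_fls (fls_deriv (comp_fls a (Suc l))) has_laurent_expansion
        peval fls_const (jet_fls (a 1)) (painleve_poly m) + (fls_const z0 + fls_X)"
      using has_laurent_expansion_transfer by simp
    then have "fls_deriv (comp_fls a (Suc l)) = peval fls_const (jet_fls (a 1)) (painleve_poly m) + (fls_const z0 + fls_X)"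
      using exp'[of l] l has_laurent_expansion_unique by simp
    then show ?thesis
      using jet[of l] l fls_deriv_jet_fls[of "a 1" l] by simp
  qed
  moreover have "a 1 0 = half_tri k"
    using lead[of 1] m leading_coeff_Suc[of k 0] by (simp add: pole_jet_def)
  moreover have "a j n = jet_coeffs (a 1) j n" if j: "j \<in> {1..2*m}" for j n
  proof -
    obtain i where i: "j = Suc i" "i < 2 * m"
      using j by (cases j) auto
    have "comp_fls a j = comp_fls (jet_coeffs (a 1)) j"
      using jet[OF i(2)] i by (simp add: comp_fls_jet_coeffs)
    then have "Abs_fps (a j) = Abs_fps (jet_coeffs (a 1) j)"
      by (simp only: comp_fls_def fls_shift_eq_iff fps_to_fls_eq_iff)
    then show ?thesis
      by (metis fps_nth_Abs_fps)
  qed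
  ultimately show ?thesis
    by (auto simp: formal_solution_iff_fls)
qed

lemma free_parameters_resonances:
  assumes k: "1 \<le> k" "k \<le> m"
  shows "free_parameters m k (resonances m k)"
  unfolding free_parameters_def
proof (intro allI conjI impI)
  have m: "m \<ge> 1" using k by simp
  fix z0 :: complex and \<alpha> :: "nat \<Rightarrow> complex"
  let ?a = "formal_sol m k z0 \<alpha>"
  have a: "formal_solution m k z0 ?a"
    by (rule formal_solution_formal_sol[OF k])
  obtain n0 where n0: "\<forall>B. \<exists>s>0. \<forall>z0 a. formal_solution m k z0 a \<longrightarrow> (\<forall>n<n0. norm (a n) \<le> B)
    \<longrightarrow> (\<forall>n\<ge>1. norm (a n) * s ^ n \<le> 1)"
    using formal_solution_convergent[OF m] by blast
  have B: "\<forall>n<n0. norm (?a n) \<le> (\<Sum>n<n0. norm (?a n))"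
    by (intro allI impI member_le_sum) auto
  obtain s where s: "s > 0" "\<And>z0 a. formal_solution m k z0 a \<Longrightarrow>
      (\<forall>n<n0. norm (a n) \<le> (\<Sum>n<n0. norm (?a n))) \<Longrightarrow> (\<forall>n\<ge>1. norm (a n) * s ^ n \<le> 1)"
    using n0[THEN spec[of _ "\<Sum>n<n0. norm (?a n)"]] by metis
  from s(2)[OF a B] s(1) have "laurent_solution m k z0 s (jet_coeffs ?a)"
    by (intro laurent_solution_jet_coeffs[OF a]) auto
  moreover have "\<forall>n\<in>resonances m k. jet_coeffs ?a 1 n = \<alpha> n"
    by (simp add: jet_coeffs_def formal_sol_resonance)
  ultimately show "\<exists>r a. laurent_solution m k z0 r a \<and> (\<forall>n\<in>resonances m k. a 1 n = \<alpha> n)"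
    by blast
next
  have m: "m \<ge> 1" using k by simp
  fix z0 and \<alpha> :: "nat \<Rightarrow> complex" and r r' a b
  assume sol: "laurent_solution m k z0 r a" "laurent_solution m k z0 r' b"
    and eq: "\<forall>n\<in>resonances m k. a 1 n = \<alpha> n" "\<forall>n\<in>resonances m k. b 1 n = \<alpha> n"
  note a = laurent_solution_imp_formal[OF m sol(1)] and b = laurent_solution_imp_formal[OF m sol(2)]
  have res: "a 1 n = b 1 n" if "n \<in> resonances m k" for n
    using eq(1)[THEN bspec, OF that] eq(2)[THEN bspec, OF that] by (rule trans[OF _ sym])
  have ab: "a 1 = b 1"
    by (rule ext) (rule formal_solution_unique[OF k a[THEN conjunct1] b[THEN conjunct1] res])
  show "\<forall>j\<in>{1..2*m}. \<forall>n. a j n = b j n"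
  proof (intro ballI allI)
    fix j n assume j: "j \<in> {1..2*m}"
    have "a j n = jet_coeffs (a 1) j n" using a j by blast
    also have "\<dots> = jet_coeffs (b 1) j n" by (simp only: ab)
    also have "\<dots> = b j n" using b j by metis
    finally show "a j n = b j n" .
  qed
qed

lemma includes_free_parameters_resonances:
  assumes k: "1 \<le> k" "k \<le> m"
  shows "includes_free_parameters m k (2 * m - k + 1)"
  unfolding includes_free_parameters_def positive_exponents_eq[OF k]
  using free_parameters_resonances[OF k] card_resonances[OF k(2)] by simp

section \<open>Uniqueness for the initial value problem\<close>

lemma peval_fps_cong_upto:
  assumes "vars_below N p" "\<And>i l. i < N \<Longrightarrow> l \<le> n \<Longrightarrow> fps_nth (y i) l = fps_nth (y' i) l"
  shows "fps_nth (peval fps_const y p) n = fps_nth (peval fps_const y' p) n"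
proof -
  let ?cut = "\<lambda>y i. if i < N then y i else (0 :: complex fps)"
  have "peval fps_const y p = peval fps_const (?cut y) p" "peval fps_const y' p = peval fps_const (?cut y') p"
    by (rule peval_cong_vars_below[OF assms(1)]; simp)+
  moreover have "fps_nth (peval fps_const (?cut y) p) n = fps_nth (peval fps_const (?cut y') p) n"
    using peval_fps_taylor[of "Suc n" "?cut y" "?cut y'" p] assms(2) by simp
  ultimately show ?thesis by simp
qed

lemma has_fps_expansion_deval:
  assumes "\<And>i. f i has_fps_expansion F i"
  shows "(\<lambda>t. deval (\<lambda>i. f i t) p) has_fps_expansion peval fps_const F p"
  by (induction p rule: diff_poly_induct)
    (auto simp: deval_simps eval_fps.peval_simps assms intro!: fps_expansion_intros)

lemma has_fps_expansion_transfer: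
  assumes "eventually (\<lambda>t. f t = g t) (nhds 0)" "f has_fps_expansion F"
  shows "g has_fps_expansion F"
  using assms(2) has_fps_expansion_cong[OF assms(1) refl] by blast

lemma painleve_solution_holomorphic:
  assumes "painleve_solution m S x" "open S" "j \<in> {1..2*m}"
  shows "x j holomorphic_on S"
proof -
  have "\<exists>D. (x j has_field_derivative D) (at z)" if "z \<in> S" for z
    using assms(1,3) that unfolding painleve_solution_def by blast
  then show ?thesis
    using assms(2) by (simp add: holomorphic_on_open)
qed

lemma painleve_solution_fps:
  assumes m: "m \<ge> 1" and S: "open S" "z1 \<in> S" and x: "painleve_solution m S x"
  shows "\<exists>X. \<forall>i<2*m. (\<lambda>t. x (Suc i) (z1 + t)) has_fps_expansion X i
    \<and> fps_deriv (X i) = (if Suc i < 2 * m then X (Suc i)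
        else peval fps_const X (painleve_poly m) + (fps_const z1 + fps_X))"
proof -
  define X where "X = (\<lambda>i. if i < 2 * m then fps_expansion (x (Suc i)) z1 else 0)"
  define f where "f = (\<lambda>i t. if i < 2 * m then x (Suc i) (z1 + t) else 0)"
  have ode: "(x (Suc i) has_field_derivative fA m (Suc i) (\<lambda>j. x j z) + (if Suc i = 2 * m then z else 0)) (at z)"
    if "i < 2 * m" "z \<in> S" for i z
    using x that by (auto simp: painleve_solution_def)
  have "x (Suc i) analytic_on {z1}" if "i < 2 * m" for i
    using S(2) painleve_solution_holomorphic[OF x S(1), of "Suc i"] that
      analytic_on_open[OF S(1), of "x (Suc i)"] by (auto intro: analytic_on_subset)
  then have f_exp: "f i has_fps_expansion X i" for i
    unfolding f_def X_def by (auto intro: analytic_at_imp_has_fps_expansion)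
  have ev: "eventually (\<lambda>t. z1 + t \<in> S) (nhds 0)"
  proof -
    have "open ((\<lambda>t. z1 + t) -` S)"
      using S(1) by (intro open_vimage) (auto intro!: continuous_intros)
    then show ?thesis
      using S(2) eventually_nhds_in_open[of "(\<lambda>t. z1 + t) -` S" 0] by simp
  qed
  have "fps_deriv (X i) = (if Suc i < 2 * m then X (Suc i)
        else peval fps_const X (painleve_poly m) + (fps_const z1 + fps_X))" if i: "i < 2 * m" for i
  proof -
    have d: "deriv (f i) has_fps_expansion fps_deriv (X i)"
      by (rule has_fps_expansion_deriv[OF f_exp])
    have deriv: "deriv (f i) t = (if Suc i < 2 * m then f (Suc i) t
        else deval (\<lambda>i. f i t) (painleve_poly m) + (z1 + t))" if t: "z1 + t \<in> S" for t
    proof -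
      have "((\<lambda>t. x (Suc i) (z1 + t)) has_field_derivative
          fA m (Suc i) (\<lambda>j. x j (z1 + t)) + (if Suc i = 2 * m then z1 + t else 0)) (at t)"
      proof -
        have "((\<lambda>t. z1 + t) has_field_derivative 1) (at t)"
          by (auto intro!: derivative_eq_intros)
        from DERIV_chain2[where f = "x (Suc i)" and g = "\<lambda>t. z1 + t", OF ode[OF i t] this] show ?thesis
          by simp
      qed
      moreover have "deval (\<lambda>i. x (Suc i) (z1 + t)) (painleve_poly m) = deval (\<lambda>i. f i t) (painleve_poly m)"
        unfolding deval_eq_peval by (rule peval_cong_vars_below[OF vars_below_painleve_poly]) (simp add: f_def)
      ultimately show ?thesis
        unfolding painleve_rhs[OF i] using i by (auto simp: f_def dest!: DERIV_imp_deriv)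
    qed
    show ?thesis
    proof (cases "Suc i < 2 * m")
      case True
      have "eventually (\<lambda>t. deriv (f i) t = f (Suc i) t) (nhds 0)"
        using ev by eventually_elim (simp add: deriv True)
      then have "f (Suc i) has_fps_expansion fps_deriv (X i)"
        using d by (rule has_fps_expansion_transfer)
      then show ?thesis
        using True fps_expansion_unique_complex[OF _ f_exp] by simp
    next
      case False
      have "eventually (\<lambda>t. deriv (f i) t = deval (\<lambda>i. f i t) (painleve_poly m) + (z1 + t)) (nhds 0)"
        using ev by eventually_elim (simp add: deriv False)
      then have "(\<lambda>t. deval (\<lambda>i. f i t) (painleve_poly m) + (z1 + t)) has_fps_expansion fps_deriv (X i)"
        using d by (rule has_fps_expansion_transfer)
      moreover have "(\<lambda>t. deval (\<lambda>i. f i t) (painleve_poly m) + (z1 + t)) has_fps_expansion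
          peval fps_const X (painleve_poly m) + (fps_const z1 + fps_X)"
        by (intro fps_expansion_intros has_fps_expansion_deval f_exp)
      ultimately have "fps_deriv (X i) = peval fps_const X (painleve_poly m) + (fps_const z1 + fps_X)"
        by (rule fps_expansion_unique_complex)
      then show ?thesis using False by simp
    qed
  qed
  moreover have "(\<lambda>t. x (Suc i) (z1 + t)) has_fps_expansion X i" if "i < 2 * m" for i
    using f_exp[of i] that by (simp add: f_def)
  ultimately show ?thesis by blast
qed

text \<open>The equations determine all Taylor coefficients at \<open>z1\<close> from the initial
  values; the identity theorem extends the equality over the connected set \<open>S\<close>.\<close>

lemma painleve_solution_unique:
  assumes m: "m \<ge> 1" and S: "open S" "connected S" "z1 \<in> S"
    and x: "painleve_solution m S x" and y: "painleve_solution m S y"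
    and init: "\<And>j. j \<in> {1..2*m} \<Longrightarrow> x j z1 = y j z1" and w: "w \<in> S"
  shows "x 1 w = y 1 w"
proof -
  obtain X where X: "\<And>i. i < 2 * m \<Longrightarrow> (\<lambda>t. x (Suc i) (z1 + t)) has_fps_expansion X i"
    "\<And>i. i < 2 * m \<Longrightarrow> fps_deriv (X i) = (if Suc i < 2 * m then X (Suc i)
        else peval fps_const X (painleve_poly m) + (fps_const z1 + fps_X))"
    using painleve_solution_fps[OF m S(1,3) x] by blast
  obtain Y where Y: "\<And>i. i < 2 * m \<Longrightarrow> (\<lambda>t. y (Suc i) (z1 + t)) has_fps_expansion Y i"
    "\<And>i. i < 2 * m \<Longrightarrow> fps_deriv (Y i) = (if Suc i < 2 * m then Y (Suc i)
        else peval fps_const Y (painleve_poly m) + (fps_const z1 + fps_X))"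
    using painleve_solution_fps[OF m S(1,3) y] by blast
  have eq: "\<forall>i<2*m. fps_nth (X i) n = fps_nth (Y i) n" for n
  proof (induction n rule: less_induct)
    case (less n)
    show ?case
    proof (intro allI impI)
      fix i assume i: "i < 2 * m"
      show "fps_nth (X i) n = fps_nth (Y i) n"
      proof (cases n)
        case 0
        have "x (Suc i) (z1 + 0) = fps_nth (X i) 0" "y (Suc i) (z1 + 0) = fps_nth (Y i) 0"
          using has_fps_expansion_imp_0_eq_fps_nth_0[OF X(1)[OF i]]
            has_fps_expansion_imp_0_eq_fps_nth_0[OF Y(1)[OF i]] by simp_all
        then show ?thesis
          using init[of "Suc i"] i 0 by simp
      next
        case (Suc n')
        have "fps_nth (fps_deriv (X i)) n' = fps_nth (fps_deriv (Y i)) n'"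
        proof (cases "Suc i < 2 * m")
          case True
          then show ?thesis using less Suc X(2)[OF i] Y(2)[OF i] by simp
        next
          case False
          have "fps_nth (peval fps_const X (painleve_poly m)) n' = fps_nth (peval fps_const Y (painleve_poly m)) n'"
            using less Suc by (intro peval_fps_cong_upto[OF vars_below_painleve_poly]) auto
          then show ?thesis using False X(2)[OF i] Y(2)[OF i] by simp
        qed
        then show ?thesis
          using Suc by (simp del: of_nat_Suc)
      qed
    qed
  qed
  have "X 0 = Y 0"
    using eq m by (intro fps_ext) auto
  then have exp0: "(\<lambda>t. x 1 (z1 + t) - y 1 (z1 + t)) has_fps_expansion 0"
    using has_fps_expansion_diff[OF X(1)[of 0] Y(1)[of 0]] m by simp
  let ?A = "(\<lambda>z. - z1 + z) ` S"
  have hol: "x 1 holomorphic_on S" "y 1 holomorphic_on S"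
    using painleve_solution_holomorphic[OF x S(1), of 1] painleve_solution_holomorphic[OF y S(1), of 1] m by auto
  have "(\<lambda>t. x 1 (z1 + t) - y 1 (z1 + t)) holomorphic_on ?A"
    by (intro holomorphic_intros holomorphic_on_compose[of "\<lambda>t. z1 + t" _ "x 1", unfolded o_def]
        holomorphic_on_compose[of "\<lambda>t. z1 + t" _ "y 1", unfolded o_def])
      (use hol in \<open>simp_all add: image_image\<close>)
  moreover have "open ?A" "connected ?A"
    using S by (intro open_translation connected_continuous_image continuous_intros; simp)+
  ultimately have "x 1 (z1 + (- z1 + w)) - y 1 (z1 + (- z1 + w)) = 0"
    using S w by (intro has_fps_expansion_0_analytic_continuation[OF exp0, of ?A])
      auto
  then show ?thesis by simp
qed

section \<open>Recovering the pole and the coefficients from values at one point\<close>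

lemma laurent_sum_has_laurent_expansion:
  assumes "r > 0" "\<And>z. z \<in> ball z0 r - {z0} \<Longrightarrow> summable (laurent_term a z0 j z)"
  shows "(\<lambda>t. laurent_sum a z0 j (z0 + t)) has_laurent_expansion comp_fls a j"
proof -
  have rad: "fls_conv_radius (comp_fls a j) \<ge> ereal r"
    using assms(2) by (rule comp_fls_conv_radius_ge)
  have "eventually (\<lambda>t::complex. t \<in> ball 0 r - {0}) (at 0)"
    using assms(1) by (intro eventually_at_in_open) auto
  then have "eventually (\<lambda>t. eval_fls (comp_fls a j) t = laurent_sum a z0 j (z0 + t)) (at 0)"
  proof eventually_elim
    case (elim t)
    then have "ereal (norm (z0 + t - z0)) < fls_conv_radius (comp_fls a j)"
      by (intro ereal_less_of_le[OF _ rad]) auto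
    then show ?case
      using elim laurent_sum_eq_eval_fls(2)[of "z0 + t" z0 a j] by auto
  qed
  moreover have "eval_fls (comp_fls a j) has_laurent_expansion comp_fls a j"
    using ereal_less_of_le[OF assms(1) rad]
    by (intro eval_fls_has_laurent_expansion) (simp add: zero_ereal_def)
  ultimately show ?thesis
    by (rule has_laurent_expansion_transfer[rotated])
qed

text \<open>The ball without both poles is connected, so the solutions agree on it. Different poles
  are impossible: at \<open>z0\<close> one solution tends to infinity, as its leading coefficient is
  nonzero, while the other would be continuous. For equal poles the expansions coincide.\<close>

lemma laurent_solution_determined_by_value:
  assumes m: "m \<ge> 1" and k: "k \<ge> 1"
    and a: "laurent_solution m k z0 s a" and a': "laurent_solution m k z0' s a'"
    and D: "ball b R \<subseteq> ball z0 s" "ball b R \<subseteq> ball z0' s" "z0 \<in> ball b R" "z0' \<in> ball b R"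
      "z1 \<in> ball b R - {z0, z0'}"
    and eq: "\<And>j. j \<in> {1..2*m} \<Longrightarrow> laurent_sum a z0 j z1 = laurent_sum a' z0' j z1"
  shows "z0 = z0' \<and> a 1 = a' 1"
proof -
  let ?x = "laurent_sum a z0 1" and ?y = "laurent_sum a' z0' 1"
  let ?S = "ball b R - {z0, z0'}"
  have sol: "painleve_solution m ?S (laurent_sum a z0)" "painleve_solution m ?S (laurent_sum a' z0')"
    using a a' D(1,2) unfolding laurent_solution_def painleve_solution_def by blast+
  have xy: "?x w = ?y w" if "w \<in> ?S" for w
  proof (rule painleve_solution_unique[OF m _ _ D(5) sol eq that])
    show "connected ?S" by (intro connected_open_delete_finite) auto
    show "open ?S" by (intro open_Diff) auto
  qed
  have s: "s > 0" and one: "1 \<in> {1..2*m}" and a0: "a 1 0 = half_tri k"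
    using a m leading_coeff_Suc[of k 0] by (auto simp: laurent_solution_def pole_jet_def)
  have x_exp: "(\<lambda>t. ?x (z0 + t)) has_laurent_expansion comp_fls a 1"
    using a one by (intro laurent_sum_has_laurent_expansion[OF s]) (auto simp: laurent_solution_def)
  have y_exp: "(\<lambda>t. ?y (z0' + t)) has_laurent_expansion comp_fls a' 1"
    using a' one by (intro laurent_sum_has_laurent_expansion[OF s]) (auto simp: laurent_solution_def)
  have ev: "eventually (\<lambda>w. ?x w = ?y w) (at z0)"
  proof -
    have "eventually (\<lambda>w. w \<in> (ball b R - ({z0'} - {z0})) - {z0}) (at z0)"
      using D(3) by (intro eventually_at_in_open open_Diff open_ball finite_imp_closed) auto
    then show ?thesis
      by eventually_elim (use xy in auto)
  qed
  have z0_eq: "z0 = z0'"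
  proof (rule ccontr)
    assume neq: "z0 \<noteq> z0'"
    have "fls_nth (comp_fls a 1) (- 2) \<noteq> 0"
      using a0 k by (auto simp: comp_fls_def half_tri_def)
        (metis of_nat_Suc of_nat_neq_0 add.commute)
    then have "fls_subdegree (comp_fls a 1) < 0"
      using fls_subdegree_leI[of "comp_fls a 1" "- 2"] by simp
    then have "filterlim ?x at_infinity (at z0)"
      by (rule has_laurent_expansion_imp_filterlim_infinity[OF x_exp])
    then have "filterlim ?y at_infinity (at z0)"
      unfolding filterlim_cong[OF refl refl ev] .
    moreover have "isCont ?y z0"
    proof -
      have "z0 \<in> ball z0' s - {z0'}"
        using D(2,3) neq by auto
      then show ?thesis
        using a' one unfolding laurent_solution_def painleve_solution_def by (blast intro: DERIV_isCont)
    qed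
    then have "(?y \<longlongrightarrow> ?y z0) (at z0)"
      by (simp add: isCont_def)
    ultimately show False
      using not_tendsto_and_filterlim_at_infinity[of "at z0" ?y] by auto
  qed
  have "eventually (\<lambda>t. ?x (z0 + t) = ?y (z0 + t)) (at 0)"
    using ev by (simp add: at_to_0[of z0] eventually_filtermap add.commute)
  then have "(\<lambda>t. ?y (z0 + t)) has_laurent_expansion comp_fls a 1"
    by (rule has_laurent_expansion_transfer[OF x_exp])
  then have "comp_fls a 1 = comp_fls a' 1"
    using y_exp unfolding z0_eq by (rule has_laurent_expansion_unique)
  then have "Abs_fps (a 1) = Abs_fps (a' 1)"
    by (simp only: comp_fls_def fls_shift_eq_iff fps_to_fls_eq_iff)
  then have "a 1 n = a' 1 n" for n
    by (metis fps_nth_Abs_fps)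
  then have "a 1 = a' 1" by (rule ext)
  then show ?thesis using z0_eq by (rule conjI[rotated])
qed

section \<open>The general solution\<close>

text \<open>Invariance of domain is applied in \<open>Euclidean_space (4 * m)\<close>, the real
  sequences vanishing from index \<open>4 m\<close> on, so \<open>2 m\<close> complex numbers are
  stored as pairs of neighbouring real coordinates.\<close>

definition cx :: "(nat \<Rightarrow> real) \<Rightarrow> nat \<Rightarrow> complex" where
  "cx u j = Complex (u (2 * j)) (u (2 * j + 1))"

definition real_coords :: "nat \<Rightarrow> (nat \<Rightarrow> complex) \<Rightarrow> nat \<Rightarrow> real" where
  "real_coords N v i = (if i < 2 * N then if even i then Re (v (i div 2)) else Im (v (i div 2)) else 0)"

lemma continuous_on_cx [continuous_intros]: "continuous_on A (\<lambda>u. cx u j)"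
  unfolding cx_def Complex_eq
  by (intro continuous_intros continuous_on_subset[OF continuous_on_product_coordinates]) auto

lemma real_coords_eq_iff: "real_coords N v = real_coords N v' \<longleftrightarrow> (\<forall>j<N. v j = v' j)"
proof
  assume eq: "real_coords N v = real_coords N v'"
  show "\<forall>j<N. v j = v' j"
  proof (intro allI impI complex_eqI)
    fix j assume j: "j < N"
    show "Re (v j) = Re (v' j)"
      using fun_cong[OF eq, of "2 * j"] j by (simp add: real_coords_def)
    show "Im (v j) = Im (v' j)"
      using fun_cong[OF eq, of "2 * j + 1"] j by (simp add: real_coords_def)
  qed
next
  assume eq: "\<forall>j<N. v j = v' j"
  then have "v (i div 2) = v' (i div 2)" if "i < 2 * N" for i
    using that by (metis less_mult_imp_div_less mult.commute)
  then show "real_coords N v = real_coords N v'"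
    by (auto simp: real_coords_def fun_eq_iff)
qed

lemma open_fun_contains_box:
  fixes w :: "nat \<Rightarrow> real"
  assumes "open G" "w \<in> G"
  shows "\<exists>\<epsilon>>0. \<forall>w'. (\<forall>i<n. dist (w' i) (w i) < \<epsilon>) \<longrightarrow> (\<forall>i\<ge>n. w' i = w i) \<longrightarrow> w' \<in> G"
proof -
  have "openin (product_topology (\<lambda>i. euclidean) UNIV) G"
    using assms(1) by (simp add: open_fun_def)
  from product_topology_open_contains_basis[OF this assms(2)]
  obtain B where B: "w \<in> (\<Pi>\<^sub>E i\<in>UNIV. B i)" "\<forall>i. openin euclidean (B i)" "(\<Pi>\<^sub>E i\<in>UNIV. B i) \<subseteq> G"
    by (elim exE conjE) (rule that)
  have "\<exists>e>0. ball (w i) e \<subseteq> B i" for i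
  proof (rule openE)
    show "open (B i)" using B(2) by simp
    show "w i \<in> B i" using B(1) by (simp add: PiE_iff)
  qed blast
  then obtain e where e: "\<And>i. e i > 0" "\<And>i. ball (w i) (e i) \<subseteq> B i"
    by metis
  define \<epsilon> where "\<epsilon> = Min (insert 1 (e ` {..<n}))"
  have "\<epsilon> > 0" using e(1) by (simp add: \<epsilon>_def)
  moreover have "w' \<in> G" if w': "\<forall>i<n. dist (w' i) (w i) < \<epsilon>" "\<forall>i\<ge>n. w' i = w i" for w'
  proof -
    have "w' i \<in> B i" for i
    proof (cases "i < n")
      case True
      then have "\<epsilon> \<le> e i" by (simp add: \<epsilon>_def)
      moreover have "dist (w i) (w' i) < \<epsilon>"
        using w'(1) True by (simp add: dist_commute)
      ultimately have "w' i \<in> ball (w i) (e i)" by simp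
      then show ?thesis using e(2) by blast
    next
      case False
      then have "w' i = w i" using w'(2) by simp
      then show ?thesis using B(1) by (simp add: PiE_iff)
    qed
    then have "w' \<in> (\<Pi>\<^sub>E i\<in>UNIV. B i)" by (simp add: PiE_iff)
    then show ?thesis using B(3) by (rule subsetD[rotated])
  qed
  ultimately show ?thesis by blast
qed

lemma summable_ffall_geometric:
  assumes "0 \<le> x" "x < 1"
  shows "summable (\<lambda>n. norm (ffall (of_nat n - 2) i) * x ^ n)"
proof -
  have "fls_conv_radius (jet_fls (\<lambda>_. 1) i) \<ge> ereal 1"
    by (rule jet_fls_conv_radius_ge[where C = 1]) auto
  then have "ereal (norm (of_real x :: complex)) < fps_conv_radius (jet_fps (\<lambda>_. 1) i)"
    using assms by (intro ereal_less_of_le[of _ 1]) (auto simp: jet_fls_def)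
  then have "summable (\<lambda>n. norm (fps_nth (jet_fps (\<lambda>_. 1) i) n * of_real x ^ n))"
    by (rule norm_summable_fps)
  then show ?thesis
    using assms by (simp add: norm_mult norm_power)
qed

text \<open>The Weierstrass test applies once the negative power of \<open>z1 - z0\<close> is
  factored out; the polynomially growing falling factorials are harmless against
  \<open>x ^ n\<close>.\<close>

lemma continuous_on_laurent_sum:
  assumes cont: "\<And>n. continuous_on U (\<lambda>u. a u n)" "continuous_on U z0"
    and x: "0 \<le> x" "x < 1"
    and bound: "\<And>u n. u \<in> U \<Longrightarrow> norm (a u n) * norm (z1 - z0 u) ^ n \<le> C * x ^ n"
    and neq: "\<And>u. u \<in> U \<Longrightarrow> z1 \<noteq> z0 u"
  shows "continuous_on U (\<lambda>u. laurent_sum (jet_coeffs (a u)) (z0 u) (Suc i) z1)"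
proof -
  let ?f = "\<lambda>n u. jet_coeffs (a u) (Suc i) n * (z1 - z0 u) ^ n"
  let ?M = "\<lambda>n. C * (norm (ffall (of_nat n - 2) i) * x ^ n)"
  have M: "summable ?M"
    by (intro summable_mult summable_ffall_geometric x)
  have le: "norm (?f n u) \<le> ?M n" if "u \<in> U" for n u
  proof -
    have "norm (?f n u) = norm (ffall (of_nat n - 2) i) * (norm (a u n) * norm (z1 - z0 u) ^ n)"
      by (simp add: jet_coeffs_def norm_mult norm_power)
    also have "\<dots> \<le> norm (ffall (of_nat n - 2) i) * (C * x ^ n)"
      using bound[OF that] by (intro mult_left_mono) auto
    finally show ?thesis by (simp add: mult_ac)
  qed
  have "uniform_limit U (\<lambda>n u. \<Sum>j<n. ?f j u) (\<lambda>u. suminf (\<lambda>j. ?f j u)) sequentially"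
    by (rule Weierstrass_m_test[OF le M])
  then have "continuous_on U (\<lambda>u. suminf (\<lambda>j. ?f j u))"
    by (rule uniform_limit_theorem[rotated])
      (auto simp: jet_coeffs_def intro!: always_eventually continuous_intros cont)
  then have "continuous_on U (\<lambda>u. (suminf (\<lambda>j. ?f j u)) * (z1 - z0 u) powi (- int (Suc i + 1)))"
    using neq by (intro continuous_intros cont) auto
  moreover have "laurent_sum (jet_coeffs (a u)) (z0 u) (Suc i) z1
      = (suminf (\<lambda>j. ?f j u)) * (z1 - z0 u) powi (- int (Suc i + 1))" if "u \<in> U" for u
  proof -
    have "summable (\<lambda>n. ?f n u)"
      by (rule summable_comparison_test'[OF M, of 0]) (rule le[OF that])
    then show ?thesis
      unfolding laurent_sum_def laurent_term_eq[OF neq[OF that]] by (rule suminf_mult2[symmetric])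
  qed
  ultimately show ?thesis
    by (simp cong: continuous_on_cong)
qed

lemma represents_general_solution_1:
  assumes m: "m \<ge> 1"
  shows "represents_general_solution m 1"
  unfolding represents_general_solution_def
proof
  fix z1 :: complex
  have k: "1 \<le> (1::nat)" "1 \<le> m" using m by auto
  have "card (resonances m 1) = card {1..<2*m}"
    using card_resonances[OF k(2)] by simp
  \<comment> \<open>For \<open>k = 1\<close> there are \<open>2 m - 1\<close> resonances. They are
    matched with the parameter slots \<open>1, ..., 2 m - 1\<close>; slot 0 holds the pole.\<close>
  then obtain d where d: "bij_betw d (resonances m 1) {1..<2*m}"
    using finite_same_card_bij[of "resonances m 1" "{1..<2*m}"] by auto
  define a where "a = (\<lambda>u. formal_sol m 1 (cx u 0) (\<lambda>n. cx u (d n)))"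
  have a_sol: "formal_solution m 1 (cx u 0) (a u)" for u
    unfolding a_def by (rule formal_solution_formal_sol[OF k])
  \<comment> \<open>The domain \<open>U\<close> below depends on the radius \<open>s\<close>; this
    larger set is independent of \<open>s\<close> and supplies the bounds from which
    \<open>s\<close> is found.\<close>
  define V where "V = {u. norm (cx u 0 - z1) \<le> 1 \<and> (\<forall>j\<in>{1..<2*m}. norm (cx u j) \<le> 1)}"
  have a_bcont: "bcont V (\<lambda>u. a u n)" for n
    unfolding a_def
  proof (rule bcont_formal_sol)
    have "norm (cx u 0) \<le> 1 + norm z1" if "u \<in> V" for u
      using that norm_triangle_sub[of "cx u 0" z1] by (simp add: V_def)
    then show "bcont V (\<lambda>u. cx u 0)"
      unfolding bcont_def by (blast intro: continuous_on_cx)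
    fix n assume "n \<in> resonances m 1"
    then have "d n \<in> {1..<2*m}" using d by (auto simp: bij_betw_def)
    then show "bcont V (\<lambda>u. cx u (d n))"
      unfolding bcont_def by (auto simp: V_def intro: continuous_on_cx exI[of _ 1])
  qed
  obtain n0 where n0: "\<And>B. \<exists>s>0. \<forall>z0 a. formal_solution m 1 z0 a \<longrightarrow> (\<forall>n<n0. norm (a n) \<le> B)
    \<longrightarrow> (\<forall>n\<ge>1. norm (a n) * s ^ n \<le> 1)"
    using formal_solution_convergent[OF m] by blast
  obtain C where C: "\<And>n u. u \<in> V \<Longrightarrow> norm (a u n) \<le> C n"
    using a_bcont unfolding bcont_def by metis
  have "norm (a u n) \<le> (\<Sum>n<n0. \<bar>C n\<bar>)" if "u \<in> V" "n < n0" for u n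
  proof -
    have "norm (a u n) \<le> \<bar>C n\<bar>" using C[OF that(1), of n] by simp
    also have "\<dots> \<le> (\<Sum>n<n0. \<bar>C n\<bar>)" using that by (intro member_le_sum) auto
    finally show ?thesis .
  qed
  then have B: "\<forall>n<n0. norm (a u n) \<le> (\<Sum>n<n0. \<bar>C n\<bar>)" if "u \<in> V" for u
    using that by blast
  obtain s' where s'0: "s' > 0" and s'1: "\<And>z0 a. formal_solution m 1 z0 a \<Longrightarrow>
      (\<forall>n<n0. norm (a n) \<le> (\<Sum>n<n0. \<bar>C n\<bar>)) \<Longrightarrow> (\<forall>n\<ge>1. norm (a n) * s' ^ n \<le> 1)"
    using n0[of "\<Sum>n<n0. \<bar>C n\<bar>"] by metis
  have s': "norm (a u n) * s' ^ n \<le> 1" if "u \<in> V" "n \<ge> 1" for u n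
    using s'1[OF a_sol B[OF that(1)]] that(2) by blast
  define s where "s = min s' 1"
  have s: "s > 0" "s \<le> 1" using s'0 by (auto simp: s_def)
  have a_le: "norm (a u n) * s ^ n \<le> 1" if "u \<in> V" "n \<ge> 1" for u n
  proof -
    have "norm (a u n) * s ^ n \<le> norm (a u n) * s' ^ n"
      using s by (intro mult_left_mono power_mono) (auto simp: s_def)
    then show ?thesis using s'[OF that] by simp
  qed
  have sol: "laurent_solution m 1 (cx u 0) s (jet_coeffs (a u))" if "u \<in> V" for u
    using a_le[OF that] s(1) by (intro laurent_solution_jet_coeffs[OF a_sol]) auto
  \<comment> \<open>Poles range over the disc of radius \<open>s / 8\<close> about
    \<open>c0\<close>, so their distance from \<open>z1\<close> lies between
    \<open>3 / 8 * s\<close> and \<open>5 / 8 * s\<close>, and the ball of radius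
    \<open>7 / 8 * s\<close> about \<open>c0\<close> contains all poles and lies in every disc of
    convergence.\<close>
  define c0 where "c0 = z1 - of_real (s / 2)"
  define T where "T = {u :: nat \<Rightarrow> real. \<forall>i\<ge>4*m. u i = 0}"
  define W where "W = {u. norm (cx u 0 - c0) < s / 8} \<inter> (\<Inter>j\<in>{1..<2*m}. {u. norm (cx u j) < 1})"
  define U where "U = T \<inter> W"
  have dist_c0: "norm (z1 - c0) = s / 2"
    using s by (simp add: c0_def)
  have z0_close: "norm (cx u 0 - c0) < s / 8" if "u \<in> U" for u
    using that by (simp add: U_def W_def)
  have z0_dist: "norm (z1 - cx u 0) \<le> 5 / 8 * s" "norm (z1 - cx u 0) \<ge> 3 / 8 * s" if "u \<in> U" for u
  proof -
    have "norm (z1 - cx u 0) \<le> norm (z1 - c0) + norm (cx u 0 - c0)"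
      using norm_triangle_ineq4[of "z1 - c0" "cx u 0 - c0"] by simp
    then show "norm (z1 - cx u 0) \<le> 5 / 8 * s"
      using z0_close[OF that] dist_c0 by simp
    have "norm (z1 - c0) \<le> norm (z1 - cx u 0) + norm (cx u 0 - c0)"
      using norm_triangle_ineq[of "z1 - cx u 0" "cx u 0 - c0"] by simp
    then show "norm (z1 - cx u 0) \<ge> 3 / 8 * s"
      using z0_close[OF that] dist_c0 by simp
  qed
  have UV: "U \<subseteq> V"
  proof
    fix u assume u: "u \<in> U"
    then have "norm (cx u 0 - z1) \<le> 1"
      using z0_dist(1)[OF u] s by (simp add: norm_minus_commute)
    then show "u \<in> V" using u by (auto simp: U_def V_def W_def)
  qed
  define X where "X = (\<lambda>u i. laurent_sum (jet_coeffs (a u)) (cx u 0) (Suc i) z1)"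
  define \<Phi> where "\<Phi> = (\<lambda>u. real_coords (2 * m) (X u))"
  have X_cont: "continuous_on U (\<lambda>u. X u i)" for i
    unfolding X_def
  proof (rule continuous_on_laurent_sum[where x = "5 / 8" and C = "1 + norm (half_tri 1)"])
    show "continuous_on U (\<lambda>u. a u n)" for n
      using a_bcont UV by (auto simp: bcont_def intro: continuous_on_subset)
    show "continuous_on U (\<lambda>u. cx u 0)" by (rule continuous_on_cx)
    fix u assume u: "u \<in> U"
    show "z1 \<noteq> cx u 0" using z0_dist(2)[OF u] s by auto
    fix n
    show "norm (a u n) * norm (z1 - cx u 0) ^ n \<le> (1 + norm (half_tri 1)) * (5 / 8) ^ n"
    proof (cases "n = 0")
      case True
      then show ?thesis using a_sol[of u] by (simp add: formal_solution_def)
    next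
      case False
      have "norm (a u n) * norm (z1 - cx u 0) ^ n \<le> norm (a u n) * (5 / 8 * s) ^ n"
        using z0_dist(1)[OF u] by (intro mult_left_mono power_mono) auto
      also have "\<dots> = (norm (a u n) * s ^ n) * (5 / 8) ^ n"
        by (simp only: power_mult_distrib mult_ac)
      also have "\<dots> \<le> (1 + norm (half_tri 1)) * (5 / 8) ^ n"
      proof (rule mult_right_mono)
        have "norm (a u n) * s ^ n \<le> 1"
          using False by (intro a_le subsetD[OF UV u]) auto
        then show "norm (a u n) * s ^ n \<le> 1 + norm (half_tri 1)"
          using norm_ge_zero[of "half_tri 1"] by linarith
      qed simp
      finally show ?thesis .
    qed
  qed auto
  have X_inj: "u = u'" if u: "u \<in> U" "u' \<in> U" and eq: "\<forall>i<2*m. X u i = X u' i" for u u'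
  proof -
    have ball: "ball c0 (7 / 8 * s) \<subseteq> ball (cx v 0) s" "cx v 0 \<in> ball c0 (7 / 8 * s)" if "v \<in> U" for v
    proof -
      have "dist c0 (cx v 0) < s / 8"
        using z0_close[OF that] by (simp add: dist_norm norm_minus_commute)
      then show "cx v 0 \<in> ball c0 (7 / 8 * s)" using s by simp
      show "ball c0 (7 / 8 * s) \<subseteq> ball (cx v 0) s"
      proof
        fix w assume "w \<in> ball c0 (7 / 8 * s)"
        then show "w \<in> ball (cx v 0) s"
          using \<open>dist c0 (cx v 0) < s / 8\<close> dist_triangle[of "cx v 0" w c0] by (simp add: dist_commute)
      qed
    qed
    have z1: "z1 \<in> ball c0 (7 / 8 * s) - {cx u 0, cx u' 0}"
      using dist_c0 s z0_dist(2)[OF u(1)] z0_dist(2)[OF u(2)] by (auto simp: dist_norm norm_minus_commute)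
    have "laurent_sum (jet_coeffs (a u)) (cx u 0) j z1 = laurent_sum (jet_coeffs (a u')) (cx u' 0) j z1"
      if "j \<in> {1..2*m}" for j
      using eq that by (cases j) (auto simp: X_def)
    then have "cx u 0 = cx u' 0 \<and> jet_coeffs (a u) 1 = jet_coeffs (a u') 1"
      using u UV by (intro laurent_solution_determined_by_value[OF m _ sol sol ball(1) ball(1) ball(2) ball(2) z1]) auto
    then have z0: "cx u 0 = cx u' 0" and aa: "a u n = a u' n" for n
      by (auto simp: jet_coeffs_def fun_eq_iff)
    have cx: "cx u j = cx u' j" if "j < 2 * m" for j
    proof (cases "j = 0")
      case False
      then have "j \<in> d ` resonances m 1"
        using d that by (auto simp: bij_betw_def)
      then obtain n where n: "n \<in> resonances m 1" "j = d n" by auto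
      then show ?thesis
        using aa[of n] by (simp add: a_def formal_sol_resonance)
    qed (simp add: z0)
    show "u = u'"
    proof
      fix i
      show "u i = u' i"
      proof (cases "i < 4 * m")
        case True
        then have "cx u (i div 2) = cx u' (i div 2)" by (intro cx) auto
        then have "u (2 * (i div 2)) = u' (2 * (i div 2))" "u (2 * (i div 2) + 1) = u' (2 * (i div 2) + 1)"
          by (simp_all add: cx_def)
        then show ?thesis
          by (cases "even i") (auto elim!: evenE oddE)
      next
        case False
        then show ?thesis using u by (auto simp: U_def T_def)
      qed
    qed
  qed
  have E: "Euclidean_space (4 * m) = top_of_set T"
    by (simp add: Euclidean_space_def T_def euclidean_product_topology)
  have "openin (Euclidean_space (4 * m)) (\<Phi> ` U)"
  proof (rule invariance_of_domain_Euclidean_space)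
    have "open W"
      unfolding W_def by (intro open_Int open_INT open_Collect_less ballI continuous_intros finite_atLeastLessThan)
    then show "openin (Euclidean_space (4 * m)) U"
      unfolding E U_def by (rule openin_open_Int)
    have "continuous_on U \<Phi>"
      unfolding \<Phi>_def
    proof (rule continuous_on_coordinatewise_then_product)
      fix i
      show "continuous_on U (\<lambda>u. real_coords (2 * m) (X u) i)"
        by (cases "i < 2 * (2 * m)"; cases "even i")
          (simp_all add: real_coords_def continuous_on_Re continuous_on_Im X_cont)
    qed
    moreover have "\<Phi> \<in> U \<rightarrow> T"
      by (auto simp: \<Phi>_def T_def real_coords_def)
    moreover have "T \<inter> U = U"
      by (auto simp: U_def)
    ultimately show "continuous_map (subtopology (Euclidean_space (4 * m)) U) (Euclidean_space (4 * m)) \<Phi>"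
      unfolding E by (simp add: subtopology_subtopology continuous_map_subtopology_eu)
    show "inj_on \<Phi> U"
      using X_inj by (auto simp: inj_on_def \<Phi>_def real_coords_eq_iff)
  qed
  then obtain G where G: "open G" "\<Phi> ` U = T \<inter> G"
    unfolding E by (auto simp: openin_open)
  define u0 where "u0 = (\<lambda>i::nat. if i = 0 then Re c0 else if i = 1 then Im c0 else 0)"
  have "cx u0 0 = c0" "cx u0 j = 0" if "j \<ge> 1" for j
    using that by (auto simp: cx_def u0_def complex_eq_iff)
  then have "u0 \<in> U"
    using s m by (auto simp: U_def T_def W_def u0_def)
  then have "\<Phi> u0 \<in> G" using G(2) by blast
  then obtain \<epsilon> where \<epsilon>: "\<epsilon> > 0" "\<And>w'. (\<forall>i<4*m. dist (w' i) (\<Phi> u0 i) < \<epsilon>) \<Longrightarrow> (\<forall>i\<ge>4*m. w' i = \<Phi> u0 i) \<Longrightarrow> w' \<in> G"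
    using open_fun_contains_box[OF G(1), of "\<Phi> u0" "4 * m"] by blast
  have "\<exists>z0 r a. laurent_solution m 1 z0 r a \<and> z1 \<in> ball z0 r - {z0}
      \<and> (\<forall>j\<in>{1..2*m}. laurent_sum a z0 j z1 = \<eta> j)"
    if \<eta>: "\<forall>j\<in>{1..2*m}. dist (\<eta> j) (X u0 (j - 1)) < \<epsilon>" for \<eta>
  proof -
    let ?w = "real_coords (2 * m) (\<lambda>i. \<eta> (Suc i))"
    have "?w \<in> G"
    proof (rule \<epsilon>(2))
      show "\<forall>i<4*m. dist (?w i) (\<Phi> u0 i) < \<epsilon>"
      proof (intro allI impI)
        fix i assume i: "i < 4 * m"
        then have "Suc (i div 2) \<in> {1..2*m}" by auto
        then have "norm (\<eta> (Suc (i div 2)) - X u0 (i div 2)) < \<epsilon>"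
          using \<eta> by (metis diff_Suc_1 dist_norm)
        then show "dist (?w i) (\<Phi> u0 i) < \<epsilon>"
          using i abs_Re_le_cmod[of "\<eta> (Suc (i div 2)) - X u0 (i div 2)"]
            abs_Im_le_cmod[of "\<eta> (Suc (i div 2)) - X u0 (i div 2)"]
          by (auto simp: \<Phi>_def real_coords_def dist_real_def)
      qed
      show "\<forall>i\<ge>4*m. ?w i = \<Phi> u0 i"
        by (auto simp: \<Phi>_def real_coords_def)
    qed
    moreover have "?w \<in> T" by (auto simp: T_def real_coords_def)
    ultimately obtain u where u: "u \<in> U" "\<Phi> u = ?w"
      using G(2) by (metis IntI imageE)
    then have X: "\<forall>i<2*m. X u i = \<eta> (Suc i)"
      by (simp add: \<Phi>_def real_coords_eq_iff)
    have "laurent_sum (jet_coeffs (a u)) (cx u 0) j z1 = \<eta> j" if "j \<in> {1..2*m}" for j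
      using X that by (cases j) (auto simp: X_def)
    moreover have "z1 \<in> ball (cx u 0) s - {cx u 0}"
      using z0_dist[OF u(1)] s by (auto simp: dist_norm norm_minus_commute)
    moreover have "laurent_solution m 1 (cx u 0) s (jet_coeffs (a u))"
      using sol u UV by blast
    ultimately show ?thesis by blast
  qed
  then show "\<exists>\<xi>. \<exists>\<epsilon>>0. \<forall>\<eta>. (\<forall>j\<in>{1..2*m}. dist (\<eta> j) (\<xi> j) < \<epsilon>) \<longrightarrow>
       (\<exists>z0 r a. laurent_solution m 1 z0 r a \<and> z1 \<in> ball z0 r - {z0}
          \<and> (\<forall>j\<in>{1..2*m}. laurent_sum a z0 j z1 = \<eta> j))"
    using \<epsilon>(1) by (intro exI[of _ "\<lambda>j. X u0 (j - 1)"] exI[of _ \<epsilon>]) blast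
qed

theorem theorem4p1:
  fixes m k :: nat
  assumes "1 \<le> m" and "1 \<le> k" and "k \<le> m"
  shows "kovalevskaya_exponents m k =
           image_mset (\<lambda>i. of_nat (2 * i)) (mset_set {1..m - k})
         + image_mset (\<lambda>i. of_nat (2 * k + 1 + 2 * i)) (mset_set {1..m - k})
         + image_mset (\<lambda>i. of_nat (2 * m + 2 + 2 * i)) (mset_set {1..k})
         + image_mset (\<lambda>i. - of_nat (2 * i - 1)) (mset_set {1..k})
       \<and> includes_free_parameters m k (2 * m - k + 1)
       \<and> includes_free_parameters m 1 (2 * m)
       \<and> represents_general_solution m 1"
proof (intro conjI)
  show "includes_free_parameters m 1 (2 * m)"
    using includes_free_parameters_resonances[of 1 m] assms(1) by simp
qed (use assms in \<open>simp_all only: kovalevskaya_exponents_eq_mset_set mset_set_exponents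
    includes_free_parameters_resonances represents_general_solution_1\<close>)

end
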